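(* Let $n\ge2$, let $D\subset\mathbb{R}^n$ be a regular domain and let $\mu>0$. A function $u:D\to\mathbb{R}$ is $\mu$-panharmonic if and only if it has the average property $$u(x)=\psi_n(\mu r)\int_{y\in\partial B_n(x,r)}u(y)\,\sigma_n(r;\mathrm{d}y)$$ for all open balls $B_n(x,r)\subset D$. Equivalently, $$H^x_\mu\left(B_n(x,r);\mathrm{d}y\right)=\psi_n(\mu r)\,\sigma_n(r;\mathrm{d}y),$$ where $H^x_\mu(B_n(x,r);\cdot)$ is the $\mu$-panharmonic measure on $\partial B_n(x,r)$ with pole at the center $x$.
   Context: $B_n(x,r)$ is the open ball in $\mathbb{R}^n$ with center $x$ and radius $r$; $\sigma_n(r;\mathrm{d}y)=\frac{\Gamma(n/2)}{2\pi^{n/2}}r^{1-n}\,\mathrm{d}y$ is the uniform probability measure on the sphere $\partial B_n(x,r)$. For $\mu>0$ and $\nu=(n-2)/2$, $$\psi_n(\mu)=\frac{\mu^\nu}{2^\nu\,\Gamma(\nu+1)\,I_\nu(\mu)},\qquad I_\nu(x)=\sum_{m=0}^\infty\frac{1}{m!\,\Gamma(m+\nu+1)}\left(\frac{x}{2}\right)^{2m+\nu},$$ where $I_\nu$ is the modified Bessel function of the first kind of order $\nu$. Let $W$ be the standard $n$-dimensional Brownian motion, started from $x$ under the probability measure $\mathbb{P}^x$, and for a domain $D\subset\mathbb{R}^n$ let $\tau_D=\inf\{t>0: W(t)\in D^c\}$. The domain $D$ is regular if $\mathbb{P}^x[\tau_D=0]=1$ for all $x\in\partial D$. A regular domain $D$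 is small if $\mathbb{P}^x[\tau_D<\infty]=1$ for all $x\in D$; for example, all bounded domains (in particular balls) are small. A function $u:D\to\mathbb{R}$ is $\mu$-panharmonic in $D$ if its second derivatives are continuous and $\Delta u(x)=\mu^2u(x)$ for all $x\in D$. For a small regular domain $G\subset\mathbb{R}^n$, the $\mu$-panharmonic measure on $\partial G$ with pole at $x\in G$ is the measure $H^x_\mu(G;\cdot)$ such that any bounded $\mu$-panharmonic function $u$ on $\overline{G}$ admits the representation $u(x)=\int_{y\in\partial G}u(y)\,H^x_\mu(G;\mathrm{d}y)$.
   Formalization: In the equivalence u is also required to be locally integrable on D (every panharmonic function is), since integrability on each sphere alone does not suffice (it fails under the continuum hypothesis); the balls are those whose bounding sphere also lies in D. *)

theory Defs
  imports "HOL-Probability.Probability"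
begin

definition bessel_I :: "real \<Rightarrow> real \<Rightarrow> real" where
  "bessel_I \<nu> x =
     (\<Sum>m. 1 / (fact m * Gamma (real m + \<nu> + 1)) * (x / 2) powr (2 * real m + \<nu>))"

definition psi :: "nat \<Rightarrow> real \<Rightarrow> real" where
  "psi n \<mu> = (let \<nu> = (real n - 2) / 2
     in \<mu> powr \<nu> / (2 powr \<nu> * Gamma (\<nu> + 1) * bessel_I \<nu> \<mu>))"

text \<open>
  Surface measure on the sphere of radius r > 0 about x, as a measure on all Borel sets.
  The surface measure of a subset A of the unit sphere is n times the volume of the cone
  {y. 0 < norm y < 1, y / norm y in A}; for radius r it is scaled by the power n - 1 of r.
  With this normalisation Lebesgue measure disintegrates as (surface measure) dr, i.e. it is
  the surface measure of polar coordinates.  The origin, which the projection maps to x,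
  is a null set.
\<close>
definition sphere_surface_measure :: "'a::euclidean_space \<Rightarrow> real \<Rightarrow> 'a measure" where
  "sphere_surface_measure x r =
     scale_measure (ennreal (real DIM('a) * r ^ (DIM('a) - 1)))
       (distr (restrict_space lborel (ball 0 1)) borel (\<lambda>y. x + (r / norm y) *\<^sub>R y))"

definition sphere_uniform :: "'a::euclidean_space \<Rightarrow> real \<Rightarrow> 'a measure" where
  "sphere_uniform x r =
     scale_measure
       (ennreal (Gamma (real DIM('a) / 2) / (2 * pi powr (real DIM('a) / 2))
                 * r powr (1 - real DIM('a))))
       (sphere_surface_measure x r)"

text \<open>
  Standard Brownian motion started at x.  Times are real, only times t \<ge> 0 matter.
  Joint independence over (increment, coordinate) pairs expresses at once that the increments
  are independent and that the coordinates of each increment are independent.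
\<close>
definition brownian_motion_from ::
    "'w measure \<Rightarrow> (real \<Rightarrow> 'w \<Rightarrow> 'a::euclidean_space) \<Rightarrow> 'a \<Rightarrow> bool" where
  "brownian_motion_from M W x \<longleftrightarrow>
     prob_space M \<and>
     (\<forall>t\<ge>0. W t \<in> borel_measurable M) \<and>
     (AE \<omega> in M. W 0 \<omega> = x) \<and>
     (AE \<omega> in M. continuous_on {0..} (\<lambda>t. W t \<omega>)) \<and>
     (\<forall>s t. \<forall>e\<in>Basis. 0 \<le> s \<and> s < t \<longrightarrow>
        distributed M lborel (\<lambda>\<omega>. (W t \<omega> - W s \<omega>) \<bullet> e) (normal_density 0 (sqrt (t - s)))) \<and>
     (\<forall>k (t :: nat \<Rightarrow> real). 0 \<le> t 0 \<and> strict_mono_on {..k} t \<longrightarrow>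
        prob_space.indep_vars M (\<lambda>_. borel)
          (\<lambda>(j, e) \<omega>. (W (t (Suc j)) \<omega> - W (t j) \<omega>) \<bullet> e) ({..<k} \<times> Basis))"

definition exit_time :: "(real \<Rightarrow> 'w \<Rightarrow> 'a) \<Rightarrow> 'a set \<Rightarrow> 'w \<Rightarrow> ereal" where
  "exit_time W D \<omega> = (INF t\<in>{t. 0 < t \<and> W t \<omega> \<in> - D}. ereal t)"

definition regular_domain ::
    "('a::euclidean_space \<Rightarrow> 'w measure) \<Rightarrow> (real \<Rightarrow> 'w \<Rightarrow> 'a) \<Rightarrow> 'a set \<Rightarrow> bool" where
  "regular_domain P W D \<longleftrightarrow>
     open D \<and> connected D \<and> D \<noteq> {} \<and>
     (\<forall>x\<in>frontier D. AE \<omega> in P x. exit_time W D \<omega> = 0)"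

definition partial_deriv :: "'a::euclidean_space \<Rightarrow> ('a \<Rightarrow> real) \<Rightarrow> 'a \<Rightarrow> real" where
  "partial_deriv e u x = frechet_derivative u (at x) e"

text \<open>Twice continuously differentiable on an open set.\<close>
definition C2_on :: "'a::euclidean_space set \<Rightarrow> ('a \<Rightarrow> real) \<Rightarrow> bool" where
  "C2_on D u \<longleftrightarrow>
     u differentiable_on D \<and>
     (\<forall>e\<in>Basis. partial_deriv e u differentiable_on D) \<and>
     (\<forall>e\<in>Basis. \<forall>e'\<in>Basis. continuous_on D (partial_deriv e' (partial_deriv e u)))"

definition laplacian :: "('a::euclidean_space \<Rightarrow> real) \<Rightarrow> 'a \<Rightarrow> real" where
  "laplacian u x = (\<Sum>e\<in>Basis. partial_deriv e (partial_deriv e u) x)"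

definition panharmonic_on :: "real \<Rightarrow> 'a::euclidean_space set \<Rightarrow> ('a \<Rightarrow> real) \<Rightarrow> bool" where
  "panharmonic_on \<mu> D u \<longleftrightarrow> C2_on D u \<and> (\<forall>x\<in>D. laplacian u x = \<mu>\<^sup>2 * u x)"

definition locally_integrable_on :: "'a::euclidean_space set \<Rightarrow> ('a \<Rightarrow> real) \<Rightarrow> bool" where
  "locally_integrable_on D u \<longleftrightarrow> (\<forall>K. compact K \<and> K \<subseteq> D \<longrightarrow> set_integrable lborel K u)"

text \<open>
  Functions on D are total functions whose values outside D are irrelevant, so the balls are
  those whose bounding sphere, too, lies in D.  Integrability is required explicitly because
  the integral of a non-integrable function is 0 by convention.
\<close>
definition has_average_property :: "real \<Rightarrow> 'a::euclidean_space set \<Rightarrow> ('a \<Rightarrow> real) \<Rightarrow> bool" where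
  "has_average_property \<mu> D u \<longleftrightarrow>
     (\<forall>x r. 0 < r \<and> cball x r \<subseteq> D \<longrightarrow>
        set_integrable (sphere_uniform x r) (sphere x r) u \<and>
        u x = psi DIM('a) (\<mu> * r) * (LINT y:sphere x r|sphere_uniform x r. u y))"

text \<open>
  H is a panharmonic measure on the boundary of G with pole x.  Measures on the boundary are
  Borel measures on the whole space that do not charge the complement of the boundary;
  panharmonic on the closure means panharmonic in G and continuous up to the boundary.
  Meant for x in a small regular domain G, such as a ball.
\<close>
definition is_panharmonic_measure ::
    "real \<Rightarrow> 'a::euclidean_space set \<Rightarrow> 'a \<Rightarrow> 'a measure \<Rightarrow> bool" where
  "is_panharmonic_measure \<mu> G x H \<longleftrightarrow>
     sets H = sets borel \<and> emeasure H (- frontier G) = 0 \<and>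
     (\<forall>u. panharmonic_on \<mu> G u \<and> continuous_on (closure G) u \<and> bounded (u ` closure G) \<longrightarrow>
        set_integrable H (frontier G) u \<and> u x = (LINT y:frontier G|H. u y))"

end

theory Submission imports Defs begin

text \<open>
  Write \<open>\<Psi>(s) = \<Sum>m. (\<mu>\<^sup>2 s / 4) ^ m / (m! (n / 2)\<^sub>m)\<close>; then \<open>y \<mapsto> \<Psi>(norm (y - x)\<^sup>2)\<close> is panharmonic and
  \<open>psi n (\<mu> r) = 1 / \<Psi>(r\<^sup>2)\<close>.  The divergence theorem on spheres is avoided by working weakly:
  integrating \<open>u\<close> against a compactly supported radial function \<open>h(norm (y - x)\<^sup>2)\<close>, Green's identity
  and polar coordinates turn \<open>\<Delta> u = \<mu>\<^sup>2 u\<close> into the radial equation for the spherical mean \<open>M\<close> of \<open>u\<close>,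
  tested against \<open>h\<close>.  For \<open>h = \<Psi> \<eta>\<close> this says that the derivative of \<open>M / \<Psi>\<close> vanishes weakly, so
  \<open>M(r) = \<Psi>(r\<^sup>2) u(x)\<close>.  Conversely, the average property makes \<open>u\<close> locally a constant multiple of its
  convolution with a radial bump, hence twice continuously differentiable, and then the same identity
  shows that \<open>\<Delta> u - \<mu>\<^sup>2 u\<close> integrates to 0 against bumps around every point.

  For the panharmonic measure, the functions \<open>exp (a \<bullet> (y - x))\<close> with \<open>norm a = \<mu>\<close> are panharmonic.
  Taking \<open>a = (\<mu> / r) (z - x)\<close> for \<open>z\<close> on the sphere gives a strictly positive definite kernel
  in \<open>y\<close> and \<open>z\<close>, so they already determine a measure on the sphere.
\<close>

subsection \<open>The radial equation\<close>

text \<open>Radial functions are written in \<open>s = r\<^sup>2\<close> because the squared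
  distance to \<open>x\<close> is smooth at \<open>x\<close> while the distance is not: a twice
  continuously differentiable function of \<open>s\<close> on the whole line gives a C2 function on
  the whole space. The singularity at the centre survives only where the Wronskian identity divides
  by \<open>s powr (n / 2)\<close>; the test functions used there vanish near radius 0, and
  \<open>u x\<close> enters through continuity of the spherical mean at radius 0. A difference of
  two tents as \<open>\<kappa>'\<close> then compares the quotient at two radii, so the spherical
  mean is never differentiated. To make its dependence on the radius a matter of dominated
  convergence, every mean is pulled back to the unit ball, where all radii share one measure. In the
  converse, the average property speaks of one sphere at a time; local integrability is what lets
  the averages be integrated over the radius. For uniqueness, positivity of the kernel gives
  equality of all polynomial moments about \<open>x\<close>, and Stone-Weierstrass passes from there
  to continuous functions.\<close>

lemma C2_onI:
  fixes u :: "'a::euclidean_space \<Rightarrow> real" and g :: "'a \<Rightarrow> 'a" and G :: "'a \<Rightarrow> 'a \<Rightarrow> 'a"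
  assumes D: "open D"
    and 1: "\<And>y. y \<in> D \<Longrightarrow> (u has_derivative (\<lambda>v. v \<bullet> g y)) (at y)"
    and 2: "\<And>e y. e \<in> Basis \<Longrightarrow> y \<in> D \<Longrightarrow> ((\<lambda>y. g y \<bullet> e) has_derivative (\<lambda>v. v \<bullet> G e y)) (at y)"
    and 3: "\<And>e e'. e \<in> Basis \<Longrightarrow> e' \<in> Basis \<Longrightarrow> continuous_on D (\<lambda>y. G e y \<bullet> e')"
  shows "C2_on D u" and "\<And>y. y \<in> D \<Longrightarrow> laplacian u y = (\<Sum>e\<in>Basis. G e y \<bullet> e)"
proof -
  have p1: "partial_deriv e u y = g y \<bullet> e" if "y \<in> D" for e y
    using frechet_derivative_at[OF 1[OF that], symmetric] by (simp add: partial_deriv_def inner_commute)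
  \<comment> \<open>\<open>partial_deriv e u\<close> agrees with the component of \<open>g\<close>
    on \<open>D\<close> only; openness of \<open>D\<close> makes this enough for the derivative at
    \<open>y\<close>.\<close>
  have d2: "(partial_deriv e u has_derivative (\<lambda>v. v \<bullet> G e y)) (at y)" if "e \<in> Basis" "y \<in> D" for e y
    by (rule has_derivative_transform_within_open[OF 2[OF that] D that(2)]) (simp add: p1)
  have p2: "partial_deriv e' (partial_deriv e u) y = G e y \<bullet> e'" if "e \<in> Basis" "y \<in> D" for e e' y
    using frechet_derivative_at[OF d2[OF that], symmetric]
    by (simp add: partial_deriv_def[of e' "partial_deriv e u"] inner_commute)
  show "C2_on D u"
    unfolding C2_on_def
  proof (intro conjI ballI)
    show "u differentiable_on D"
      using 1 unfolding differentiable_on_def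
      by (meson differentiableI differentiable_at_withinI)
    fix e :: 'a assume e: "e \<in> Basis"
    show "partial_deriv e u differentiable_on D"
      using d2[OF e] unfolding differentiable_on_def
      by (meson differentiableI differentiable_at_withinI)
    fix e' :: 'a assume e': "e' \<in> Basis"
    show "continuous_on D (partial_deriv e' (partial_deriv e u))"
      using 3[OF e e'] by (rule continuous_on_eq) (simp add: p2 e)
  qed
  show "laplacian u y = (\<Sum>e\<in>Basis. G e y \<bullet> e)" if "y \<in> D" for y
    unfolding laplacian_def using p2 that by simp
qed

lemma
  fixes x :: "'a::euclidean_space" and h h' h'' :: "real \<Rightarrow> real"
  assumes h: "\<And>s. (h has_real_derivative h' s) (at s)"
  shows has_derivative_radial: "((\<lambda>y. h ((y - x) \<bullet> (y - x))) has_derivative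
      (\<lambda>v. v \<bullet> ((2 * h' ((y - x) \<bullet> (y - x))) *\<^sub>R (y - x)))) (at y)"
    and has_derivative_radial_gradient:
      "(\<And>s. (h' has_real_derivative h'' s) (at s)) \<Longrightarrow>
      ((\<lambda>y. ((2 * h' ((y - x) \<bullet> (y - x))) *\<^sub>R (y - x)) \<bullet> e) has_derivative
      (\<lambda>v. v \<bullet> ((4 * h'' ((y - x) \<bullet> (y - x)) * ((y - x) \<bullet> e)) *\<^sub>R (y - x)
        + (2 * h' ((y - x) \<bullet> (y - x))) *\<^sub>R e))) (at y)"
proof -
  define q where "q y = (y - x) \<bullet> (y - x)" for y
  have q: "(q has_derivative (\<lambda>v. 2 * (v \<bullet> (y - x)))) (at y)" for y
    unfolding q_def[abs_def] by (auto intro!: derivative_eq_intros simp: inner_commute)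
  have comp: "((\<lambda>y. H (q y)) has_derivative (\<lambda>v. H' (q y) * (2 * (v \<bullet> (y - x))))) (at y)"
    if "\<And>s. (H has_real_derivative H' s) (at s)" for H H' y
    using has_derivative_compose[OF q[of y], of H "\<lambda>t. H' (q y) * t"] that
    by (simp add: has_field_derivative_def)
  show "((\<lambda>y. h ((y - x) \<bullet> (y - x))) has_derivative
      (\<lambda>v. v \<bullet> ((2 * h' ((y - x) \<bullet> (y - x))) *\<^sub>R (y - x)))) (at y)"
    using comp[OF h, of y] by (simp add: mult_ac q_def)
  assume h': "\<And>s. (h' has_real_derivative h'' s) (at s)"
  have "((\<lambda>y. ((2 * h' (q y)) *\<^sub>R (y - x)) \<bullet> e) has_derivative
      (\<lambda>v. v \<bullet> ((4 * h'' (q y) * ((y - x) \<bullet> e)) *\<^sub>R (y - x) + (2 * h' (q y)) *\<^sub>R e))) (at y)"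
    by (auto intro!: derivative_eq_intros comp[OF h'] simp: inner_simps algebra_simps)
  then show "((\<lambda>y. ((2 * h' ((y - x) \<bullet> (y - x))) *\<^sub>R (y - x)) \<bullet> e) has_derivative
      (\<lambda>v. v \<bullet> ((4 * h'' ((y - x) \<bullet> (y - x)) * ((y - x) \<bullet> e)) *\<^sub>R (y - x)
        + (2 * h' ((y - x) \<bullet> (y - x))) *\<^sub>R e))) (at y)"
    by (simp only: q_def)
qed

text \<open>The Hessian is \<open>4 h''\<close> times the rank-one matrix of \<open>y - x\<close>
  plus \<open>2 h'\<close> times the identity; the formula is its trace.\<close>

lemma C2_on_radial:
  fixes x :: "'a::euclidean_space" and h h' h'' :: "real \<Rightarrow> real"
  assumes h: "\<And>s. (h has_real_derivative h' s) (at s)"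
    and h': "\<And>s. (h' has_real_derivative h'' s) (at s)"
    and h'': "continuous_on UNIV h''"
  shows "C2_on UNIV (\<lambda>y. h ((y - x) \<bullet> (y - x)))" (is ?C2)
    and "laplacian (\<lambda>y. h ((y - x) \<bullet> (y - x))) y =
      4 * ((y - x) \<bullet> (y - x)) * h'' ((y - x) \<bullet> (y - x)) + 2 * real DIM('a) * h' ((y - x) \<bullet> (y - x))"
      (is ?lap)
proof -
  define q where "q y = (y - x) \<bullet> (y - x)" for y
  define g where "g y = (2 * h' (q y)) *\<^sub>R (y - x)" for y
  define G where "G e y = (4 * h'' (q y) * ((y - x) \<bullet> e)) *\<^sub>R (y - x) + (2 * h' (q y)) *\<^sub>R e" for e y
  have 1: "((\<lambda>y. h (q y)) has_derivative (\<lambda>v. v \<bullet> g y)) (at y)" for y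
    unfolding q_def g_def by (rule has_derivative_radial[OF h])
  have 2: "((\<lambda>y. g y \<bullet> e) has_derivative (\<lambda>v. v \<bullet> G e y)) (at y)" for e y
    unfolding q_def g_def G_def by (rule has_derivative_radial_gradient[OF h h'])
  have cq: "continuous_on UNIV (\<lambda>y. H (q y))" if "continuous_on UNIV H" for H :: "real \<Rightarrow> real"
    unfolding q_def
    by (rule continuous_on_compose2[OF that]) (auto intro!: continuous_intros)
  have ch': "continuous_on UNIV h'"
    using h' by (meson DERIV_continuous continuous_at_imp_continuous_on)
  have 3: "continuous_on UNIV (\<lambda>y. G e y \<bullet> e')" for e e'
    unfolding G_def by (intro continuous_intros cq h'' ch')
  note C = C2_onI[of UNIV "\<lambda>y. h (q y)" g G, OF _ 1 2 3]
  show ?C2 using C(1) by (simp add: q_def)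
  have "laplacian (\<lambda>y. h (q y)) y = (\<Sum>e\<in>Basis. G e y \<bullet> e)" using C(2) by simp
  also have "\<dots> = (\<Sum>e\<in>Basis. 4 * h'' (q y) * (((y - x) \<bullet> e) * ((y - x) \<bullet> e)) + 2 * h' (q y))"
    by (intro sum.cong) (auto simp: G_def inner_simps)
  also have "\<dots> = 4 * h'' (q y) * q y + 2 * real DIM('a) * h' (q y)"
    by (simp add: sum.distrib flip: sum_distrib_left)
       (simp add: q_def euclidean_inner[of "y - x" "y - x"])
  finally show ?lap by (simp add: q_def mult_ac)
qed

text \<open>The Taylor coefficients of the hypergeometric function 0F1 with parameter
  \<open>d\<close> at the argument \<open>\<mu>\<^sup>2 * s / 4\<close>, which is the Bessel series
  stripped of its fractional power.\<close>

definition radial_coeff :: "real \<Rightarrow> real \<Rightarrow> nat \<Rightarrow> real" where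
  "radial_coeff d \<mu> m = (\<mu>\<^sup>2 / 4) ^ m / (fact m * pochhammer d m)"

text \<open>With d = n / 2, the radial panharmonic function of \<open>s = r\<^sup>2\<close> that is 1 at the origin.\<close>
definition radial :: "real \<Rightarrow> real \<Rightarrow> real \<Rightarrow> real" where
  "radial d \<mu> s = (\<Sum>m. radial_coeff d \<mu> m * s ^ m)"

text \<open>This recurrence is the radial equation read off coefficient by coefficient; it serves
  both the ratio test and the differential equation.\<close>

lemma radial_coeff_Suc:
  assumes "d > 0"
  shows "real (Suc m) * (real m + d) * radial_coeff d \<mu> (Suc m) = \<mu>\<^sup>2 / 4 * radial_coeff d \<mu> m"
proof -
  have "pochhammer d m > 0" using assms by (rule pochhammer_pos)
  then show ?thesis using assms
    by (simp add: radial_coeff_def pochhammer_Suc divide_simps add_pos_nonneg add_eq_0_iff)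
qed

lemma radial_coeff_pos: "d > 0 \<Longrightarrow> 0 \<le> radial_coeff d \<mu> m"
  unfolding radial_coeff_def by (simp add: pochhammer_pos less_imp_le)

lemma summable_radial:
  assumes d: "d > 0"
  shows "summable (\<lambda>m. radial_coeff d \<mu> m * s ^ m)"
proof -
  \<comment> \<open>The ratio of consecutive terms is
    \<open>\<mu>\<^sup>2 * \<bar>s\<bar> / (4 * (m + 1) * (m + d))\<close>. For m \<ge> N the
    product \<open>(m + 1) * (m + d)\<close> is at least \<open>m\<close>, hence at least
    \<open>\<mu>\<^sup>2 * \<bar>s\<bar>\<close>, and the ratio is at most 1/4.\<close>
  obtain N :: nat where N: "max 1 (\<mu>\<^sup>2 * \<bar>s\<bar>) \<le> real N" using real_arch_simple by blast
  show ?thesis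
  proof (rule summable_ratio_test[of "1/2" N])
    fix m assume "N \<le> m"
    with N have m: "1 \<le> real m" "\<mu>\<^sup>2 * \<bar>s\<bar> \<le> real m" by linarith+
    define c where "c = radial_coeff d \<mu>"
    have c: "real (Suc m) * (real m + d) * c (Suc m) = \<mu>\<^sup>2 / 4 * c m"
      unfolding c_def by (rule radial_coeff_Suc[OF d])
    have c0: "0 \<le> c k" for k unfolding c_def by (rule radial_coeff_pos[OF d])
    have "1 * real m \<le> (real m + d) * real (Suc m)"
      by (rule mult_mono) (use m d in auto)
    then have k: "\<mu>\<^sup>2 * \<bar>s\<bar> \<le> real (Suc m) * (real m + d)"
      using m by (simp add: mult.commute)
    have k0: "0 < real (Suc m) * (real m + d)" using m d by simp
    have "real (Suc m) * (real m + d) * (c (Suc m) * \<bar>s\<bar>) = \<mu>\<^sup>2 * \<bar>s\<bar> * (c m / 4)"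
      using arg_cong[OF c, of "\<lambda>t. t * \<bar>s\<bar>"] by (simp only: mult_ac times_divide_eq_left times_divide_eq_right)
    also have "\<dots> \<le> real (Suc m) * (real m + d) * (c m / 4)"
      by (rule mult_right_mono[OF k]) (use c0 in simp)
    finally have "c (Suc m) * \<bar>s\<bar> \<le> c m / 4" using k0 by (simp only: mult_le_cancel_left_pos)
    then have "c (Suc m) * \<bar>s\<bar> * \<bar>s\<bar> ^ m \<le> c m / 4 * \<bar>s\<bar> ^ m"
      by (rule mult_right_mono) simp
    also have "\<dots> \<le> 1/2 * (c m * \<bar>s\<bar> ^ m)" using c0 by simp
    finally show "norm (radial_coeff d \<mu> (Suc m) * s ^ Suc m) \<le> 1/2 * norm (radial_coeff d \<mu> m * s ^ m)"
      using c0 by (simp add: c_def abs_mult power_abs mult_ac)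
  qed simp
qed

text \<open>Termwise differentiation on the whole line, so that the equation also holds at
  \<open>s = 0\<close> and for negative \<open>s\<close>; the coefficient of \<open>s ^ m\<close> on
  both sides is the recurrence.\<close>

lemma radial_ode:
  assumes d: "d > 0"
  obtains r' r'' where "\<And>s. (radial d \<mu> has_real_derivative r' s) (at s)"
    "\<And>s. (r' has_real_derivative r'' s) (at s)" "continuous_on UNIV r''"
    "\<And>s. 4 * s * r'' s + 4 * d * r' s = \<mu>\<^sup>2 * radial d \<mu> s"
proof -
  define a where "a = radial_coeff d \<mu>"
  have sa: "summable (\<lambda>m. a m * s ^ m)" for s unfolding a_def by (rule summable_radial[OF d])
  have sb: "summable (\<lambda>m. diffs c m * s ^ m)" if "\<And>s. summable (\<lambda>m. c m * s ^ m)" for s and c :: "nat \<Rightarrow> real"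
    using termdiff_converges_all[of c s] that by simp
  define b where "b = diffs a"
  define r' where "r' s = (\<Sum>m. b m * s ^ m)" for s
  define r'' where "r'' s = (\<Sum>m. diffs b m * s ^ m)" for s
  have sb1: "summable (\<lambda>m. b m * s ^ m)" for s unfolding b_def by (rule sb[OF sa])
  have sb2: "summable (\<lambda>m. diffs b m * s ^ m)" for s by (rule sb[OF sb1])
  have D: "((\<lambda>s. \<Sum>m. c m * s ^ m) has_real_derivative (\<Sum>m. diffs c m * s ^ m)) (at s)"
    if "\<And>s. summable (\<lambda>m. c m * s ^ m)" for s and c :: "nat \<Rightarrow> real"
    by (rule termdiffs_strong_converges_everywhere[OF that])
  have 1: "(radial d \<mu> has_real_derivative r' s) (at s)" for s
    using D[OF sa, of s] unfolding radial_def[abs_def] r'_def b_def a_def .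
  have 2: "(r' has_real_derivative r'' s) (at s)" for s
    using D[OF sb1, of s] unfolding r'_def[abs_def] r''_def .
  have "(r'' has_real_derivative (\<Sum>m. diffs (diffs b) m * s ^ m)) (at s)" for s
    using D[OF sb2, of s] unfolding r''_def[abs_def] .
  then have 3: "continuous_on UNIV r''"
    by (meson DERIV_continuous continuous_at_imp_continuous_on)
  have 4: "4 * s * r'' s + 4 * d * r' s = \<mu>\<^sup>2 * radial d \<mu> s" for s
  proof -
    have "(\<lambda>m. s * (diffs b m * s ^ m)) sums (s * r'' s)"
      unfolding r''_def by (intro sums_mult summable_sums sb2)
    then have "(\<lambda>m. real (Suc m) * b (Suc m) * s ^ Suc m) sums (s * r'' s)"
      by (simp add: diffs_def mult_ac)
    \<comment> \<open>Lowering the index adds only the term with \<open>m = 0\<close>, which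
      vanishes because of its factor \<open>real m\<close>.\<close>
    then have "(\<lambda>m. real m * b m * s ^ m) sums (s * r'' s)"
      using sums_Suc_iff[of "\<lambda>m. real m * b m * s ^ m"] by simp
    then have "(\<lambda>m. 4 * (real m * b m * s ^ m) + 4 * d * (b m * s ^ m)) sums (4 * (s * r'' s) + 4 * d * r' s)"
      unfolding r'_def by (intro sums_add sums_mult summable_sums sb1)
    moreover have "(\<lambda>m. 4 * (real m * b m * s ^ m) + 4 * d * (b m * s ^ m)) = (\<lambda>m. \<mu>\<^sup>2 * (a m * s ^ m))"
    proof
      fix m
      have "4 * (real m * b m * s ^ m) + 4 * d * (b m * s ^ m)
        = 4 * s ^ m * (real (Suc m) * (real m + d) * a (Suc m))"
        by (simp add: b_def diffs_def algebra_simps)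
      also have "\<dots> = \<mu>\<^sup>2 * (a m * s ^ m)"
        unfolding a_def by (subst radial_coeff_Suc[OF d]) simp
      finally show "4 * (real m * b m * s ^ m) + 4 * d * (b m * s ^ m) = \<mu>\<^sup>2 * (a m * s ^ m)" .
    qed
    moreover have "(\<lambda>m. \<mu>\<^sup>2 * (a m * s ^ m)) sums (\<mu>\<^sup>2 * radial d \<mu> s)"
      unfolding radial_def a_def by (intro sums_mult summable_sums summable_radial d)
    ultimately show ?thesis using sums_unique2 by fastforce
  qed
  show ?thesis using that[OF 1 2 3 4] .
qed

lemma radial_0: "radial d \<mu> 0 = 1"
  using powser_zero[of "radial_coeff d \<mu>"] by (simp add: radial_def) (simp add: radial_coeff_def)

lemma radial_pos:
  assumes "d > 0" "0 \<le> s"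
  shows "radial d \<mu> s > 0"
proof -
  have "(\<Sum>m<1. radial_coeff d \<mu> m * s ^ m) \<le> radial d \<mu> s"
    unfolding radial_def
    by (rule sum_le_suminf) (use summable_radial radial_coeff_pos assms in auto)
  then show ?thesis by (simp add: radial_coeff_def)
qed

text \<open>Since \<open>\<nu> + 1 = n / 2\<close>, the factors \<open>Gamma (m + \<nu> + 1)\<close>
  are \<open>Gamma (\<nu> + 1)\<close> times Pochhammer symbols. The Bessel series is thus
  \<open>(x / 2) powr \<nu> / Gamma (\<nu> + 1)\<close> times \<open>radial\<close>, and
  \<open>psi\<close> is normalised to cancel exactly this prefactor.\<close>

lemma psi_eq:
  assumes n: "n > 0" and "\<mu> > 0" and r: "r > 0"
  shows "psi n (\<mu> * r) = 1 / radial (real n / 2) \<mu> (r\<^sup>2)"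
proof -
  define \<nu> where "\<nu> = (real n - 2) / 2"
  define x where "x = \<mu> * r"
  have x: "x > 0" using assms by (simp add: x_def)
  have \<nu>: "\<nu> + 1 = real n / 2" by (simp add: \<nu>_def field_simps)
  have G: "Gamma (\<nu> + 1) > 0" using n by (auto simp: \<nu> intro!: Gamma_real_pos)
  have t: "1 / (fact m * Gamma (real m + \<nu> + 1)) * (x / 2) powr (2 * real m + \<nu>)
    = (x / 2) powr \<nu> / Gamma (\<nu> + 1) * (radial_coeff (real n / 2) \<mu> m * (r\<^sup>2) ^ m)" for m
  proof -
    have "pochhammer (\<nu> + 1) m = Gamma (\<nu> + 1 + real m) / Gamma (\<nu> + 1)"
      by (rule pochhammer_Gamma) (use n in \<open>auto simp: \<nu> dest: nonpos_Ints_nonpos\<close>)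
    then have g: "Gamma (real m + \<nu> + 1) = pochhammer (\<nu> + 1) m * Gamma (\<nu> + 1)"
      using G by (simp add: field_simps)
    have "(x / 2) powr (2 * real m) = (x / 2) ^ (2 * m)"
      using x by (simp add: powr_realpow[symmetric])
    also have "\<dots> = (\<mu>\<^sup>2 / 4) ^ m * (r\<^sup>2) ^ m"
      by (simp add: x_def power_mult power_divide power_mult_distrib)
    finally have p: "(x / 2) powr (2 * real m + \<nu>) = (x / 2) powr \<nu> * ((\<mu>\<^sup>2 / 4) ^ m * (r\<^sup>2) ^ m)"
      by (simp add: powr_add)
    show ?thesis unfolding g p radial_coeff_def \<nu>[symmetric] by simp
  qed
  have "bessel_I \<nu> x = (x / 2) powr \<nu> / Gamma (\<nu> + 1) * radial (real n / 2) \<mu> (r\<^sup>2)"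
    unfolding bessel_I_def t radial_def
    by (rule suminf_mult) (rule summable_radial, use n in simp)
  then show ?thesis
    using G x by (simp add: psi_def Let_def flip: \<nu>_def x_def) (simp add: powr_divide)
qed

subsection \<open>Green's identity\<close>

lemma partial_deriv_line:
  assumes "F differentiable (at y)"
  shows "((\<lambda>t. F (y + t *\<^sub>R e)) has_real_derivative partial_deriv e F y) (at 0)"
proof -
  have F: "(F has_derivative frechet_derivative F (at y)) (at (y + 0 *\<^sub>R e))"
    using assms by (simp add: frechet_derivative_works)
  have L: "((\<lambda>t. y + t *\<^sub>R e) has_derivative (\<lambda>t. t *\<^sub>R e)) (at 0)"
    by (auto intro!: derivative_eq_intros)
  interpret linear "frechet_derivative F (at y)"
    using assms by (rule linear_frechet_derivative)
  show ?thesis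
    using has_derivative_compose[OF L F]
    by (simp add: has_field_derivative_def scale partial_deriv_def mult.commute[of _ "frechet_derivative F (at y) e"])
qed

text \<open>\<open>frechet_derivative\<close> is a choice among all derivatives at \<open>y\<close>.
  Functions that agree near \<open>y\<close> have the same candidates, so even the arbitrary value
  chosen when there is none is the same.\<close>

lemma partial_deriv_cong_open:
  assumes "open S" "y \<in> S" "\<And>z. z \<in> S \<Longrightarrow> F z = G z"
  shows "partial_deriv e F y = partial_deriv e G y"
proof -
  have "(F has_derivative D) (at y) \<longleftrightarrow> (G has_derivative D) (at y)" for D
    using has_derivative_transform_within_open[OF _ assms(1,2), of F D UNIV G]
      has_derivative_transform_within_open[OF _ assms(1,2), of G D UNIV F] assms(3) by auto
  then show ?thesis unfolding partial_deriv_def frechet_derivative_def by simp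
qed

lemma partial_deriv_const: "partial_deriv e (\<lambda>y. c) y = 0"
  by (simp add: partial_deriv_def)

lemma integrable_compact_support:
  fixes g :: "'a::euclidean_space \<Rightarrow> real"
  assumes "continuous_on UNIV g" "compact K" "\<And>y. y \<notin> K \<Longrightarrow> g y = 0"
  shows "integrable lborel g"
proof -
  have "integrable lborel (\<lambda>y. indicator K y *\<^sub>R g y)"
    by (rule borel_integrable_compact[OF assms(2)]) (use assms(1) in \<open>auto intro: continuous_on_subset\<close>)
  moreover have "(\<lambda>y. indicator K y *\<^sub>R g y) = g" using assms(3) by (auto simp: indicator_def fun_eq_iff)
  ultimately show ?thesis by simp
qed

text \<open>By translation invariance of Lebesgue measure the integral of every difference quotient
  of \<open>g\<close> vanishes; dominated convergence passes to the limit \<open>g'\<close>.\<close>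

lemma integral_directional_derivative:
  fixes g g' :: "'a::euclidean_space \<Rightarrow> real"
  assumes der: "\<And>y. ((\<lambda>t. g (y + t *\<^sub>R e)) has_real_derivative g' y) (at 0)"
    and g: "continuous_on UNIV g" and g': "continuous_on UNIV g'"
    and K: "compact K" "\<And>y. y \<notin> K \<Longrightarrow> g y = 0" "\<And>y. y \<notin> K \<Longrightarrow> g' y = 0"
  shows "integral\<^sup>L lborel g' = 0"
proof -
  \<comment> \<open>The points whose segment of length parameter 1 in direction \<open>e\<close>
    meets \<open>K\<close>. As the increments \<open>t n\<close> are at most 1, this compact set
    contains the supports of all difference quotients.\<close>
  define K' where "K' = (\<lambda>(y, t). y - t *\<^sub>R e) ` (K \<times> {0..1::real})"
  have K': "compact K'" unfolding K'_def
    by (intro compact_continuous_image compact_Times K)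
       (auto simp: case_prod_unfold intro!: continuous_intros)
  have "bounded (g' ` K)"
    using K(1) g' by (meson compact_continuous_image compact_imp_bounded continuous_on_subset top_greatest)
  then obtain B0 where B0: "\<And>y. y \<in> K \<Longrightarrow> \<bar>g' y\<bar> \<le> B0" unfolding bounded_iff by auto
  define B where "B = max B0 0"
  have B: "\<bar>g' y\<bar> \<le> B" for y
    using B0[of y] K(3)[of y] by (cases "y \<in> K") (auto simp: B_def max_def)
  define t where "t n = 1 / real (Suc n)" for n
  have t: "0 < t n" "t n \<le> 1" for n by (auto simp: t_def)
  define f where "f n y = (g (y + t n *\<^sub>R e) - g y) / t n" for n y
  have meas: "g \<in> borel_measurable borel" "g' \<in> borel_measurable borel"
    using g g' by (auto intro: borel_measurable_continuous_onI)
  have ig: "integrable lborel g" by (rule integrable_compact_support[OF g K(1,2)])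
  have tr: "integrable lborel (\<lambda>y. g (y + c))" "(\<integral>y. g (y + c) \<partial>lborel) = (\<integral>y. g y \<partial>lborel)" for c
    using lborel_distr_plus[of c, symmetric] ig meas
      integrable_distr_eq[of "(+) c" lborel borel g] integral_distr[of "(+) c" lborel borel g]
    by (auto simp: add.commute)
  have f0: "(\<integral>y. f n y \<partial>lborel) = 0" for n
    unfolding f_def using tr ig by simp
  have "(\<lambda>n. \<integral>y. f n y \<partial>lborel) \<longlonglongrightarrow> (\<integral>y. g' y \<partial>lborel)"
  proof (rule integral_dominated_convergence[where w = "\<lambda>y. B * indicator K' y"])
    show "g' \<in> borel_measurable lborel" "f n \<in> borel_measurable lborel" for n
      using meas unfolding f_def by auto
    show "integrable lborel (\<lambda>y. B * indicator K' y)"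
      using K' emeasure_bounded_finite[OF compact_imp_bounded[OF K']]
      by (intro integrable_mult_right integrable_real_indicator) (auto intro: borel_closed compact_imp_closed)
    show "AE y in lborel. (\<lambda>n. f n y) \<longlonglongrightarrow> g' y"
    proof (rule AE_I2)
      fix y
      have "((\<lambda>h. (g (y + h *\<^sub>R e) - g y) / h) \<longlongrightarrow> g' y) (at 0)"
        using der[of y] by (simp add: DERIV_def)
      moreover have "t \<longlonglongrightarrow> 0" unfolding t_def by (rule LIMSEQ_Suc[OF lim_1_over_n])
      then have "filterlim t (at 0) sequentially"
        using t by (auto simp: filterlim_at less_imp_neq[symmetric] intro!: always_eventually)
      ultimately show "(\<lambda>n. f n y) \<longlonglongrightarrow> g' y"
        unfolding f_def by (rule filterlim_compose)
    qed
    show "AE y in lborel. norm (f n y) \<le> B * indicator K' y" for n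
    proof (rule AE_I2)
      fix y
      have d: "((\<lambda>s. g (y + s *\<^sub>R e)) has_real_derivative g' (y + s *\<^sub>R e)) (at s)" for s
        using der[of "y + s *\<^sub>R e"] DERIV_shift[of "\<lambda>s. g (y + s *\<^sub>R e)" "g' (y + s *\<^sub>R e)" 0 s]
        by (simp add: algebra_simps)
      \<comment> \<open>The mean value theorem turns the quotient into a value of \<open>g'\<close>
        on the segment, which yields both the uniform bound \<open>B\<close> and the vanishing
        outside \<open>K'\<close>.\<close>
      obtain z where z: "0 < z" "z < t n" "g (y + t n *\<^sub>R e) - g (y + 0 *\<^sub>R e) = (t n - 0) * g' (y + z *\<^sub>R e)"
        using MVT2[of 0 "t n" "\<lambda>s. g (y + s *\<^sub>R e)" "\<lambda>s. g' (y + s *\<^sub>R e)"] t d by blast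
      then have f: "f n y = g' (y + z *\<^sub>R e)" using t[of n] by (simp add: f_def)
      show "norm (f n y) \<le> B * indicator K' y"
      proof (cases "y \<in> K'")
        case True then show ?thesis using B by (simp add: f)
      next
        case False
        have "y + z *\<^sub>R e \<notin> K"
        proof
          assume "y + z *\<^sub>R e \<in> K"
          then have "(\<lambda>(y, t). y - t *\<^sub>R e) (y + z *\<^sub>R e, z) \<in> K'"
            unfolding K'_def using z t[of n] by (intro imageI) auto
          then show False using False by simp
        qed
        then show ?thesis using K(3) by (simp add: f False)
      qed
    qed
  qed
  then show ?thesis by (simp add: f0 LIMSEQ_const_iff)
qed

lemma C2_on_continuous:
  assumes "C2_on U f"
  shows "continuous_on U f" "e \<in> Basis \<Longrightarrow> continuous_on U (partial_deriv e f)"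
    "continuous_on U (laplacian f)"
proof -
  show "continuous_on U f" "e \<in> Basis \<Longrightarrow> continuous_on U (partial_deriv e f)"
    using assms unfolding C2_on_def by (auto intro: differentiable_imp_continuous_on)
  show "continuous_on U (laplacian f)"
    using assms unfolding C2_on_def laplacian_def[abs_def] by (intro continuous_on_sum) auto
qed

lemma C2_on_subset:
  assumes "C2_on U f" "V \<subseteq> U" shows "C2_on V f"
  using assms unfolding C2_on_def
  by (meson differentiable_on_subset continuous_on_subset)

lemma set_integrable_compact:
  fixes f :: "'a::euclidean_space \<Rightarrow> real"
  assumes "compact K" "continuous_on K f"
  shows "set_integrable lborel K f"
  using borel_integrable_compact[OF assms] unfolding set_integrable_def by simp

text \<open>In each coordinate direction the derivative of
  \<open>\<phi> * partial_deriv e f - f * partial_deriv e \<phi>\<close> is \<open>\<phi>\<close>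
  times the second derivative of \<open>f\<close> minus the reverse, since the products of first
  derivatives cancel. Its integral vanishes by compact support, and summing over the basis gives the
  Laplacians.\<close>

lemma green_identity:
  fixes f \<phi> :: "'a::euclidean_space \<Rightarrow> real"
  assumes U: "open U" and f: "C2_on U f" and \<phi>: "C2_on UNIV \<phi>"
    and K: "compact K" "K \<subseteq> U" and supp: "\<And>y. y \<notin> K \<Longrightarrow> \<phi> y = 0"
  shows "(LINT y:K|lborel. \<phi> y * laplacian f y) = (LINT y:K|lborel. f y * laplacian \<phi> y)"
proof -
  have oK: "open (- K)" using K by (simp add: compact_imp_closed open_Compl)
  have UK: "U \<union> - K = UNIV" using K by auto
  have pd0: "partial_deriv e \<phi> y = 0" if "y \<notin> K" for e y
    using partial_deriv_cong_open[OF oK, of y \<phi> "\<lambda>_. 0" e] that supp by (simp add: partial_deriv_const)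
  have pd1: "partial_deriv e (partial_deriv e \<phi>) y = 0" if "y \<notin> K" for e y
    using partial_deriv_cong_open[OF oK, of y "partial_deriv e \<phi>" "\<lambda>_. 0" e] that pd0
    by (simp add: partial_deriv_const)
  \<comment> \<open>Nothing is known about \<open>f\<close> outside \<open>U\<close>, so the value
    there is set to 0. This is consistent: everything vanishes off \<open>K\<close>, and the open
    sets \<open>U\<close> and \<open>- K\<close> cover the space, so continuity and derivatives can
    be checked on each of them.\<close>
  define g where "g e y = (if y \<in> U then \<phi> y * partial_deriv e f y - f y * partial_deriv e \<phi> y else 0)" for e y
  define g' where "g' e y = (if y \<in> U then \<phi> y * partial_deriv e (partial_deriv e f) y
      - f y * partial_deriv e (partial_deriv e \<phi>) y else 0)" for e y
  have g0: "g e y = 0" "g' e y = 0" if "y \<notin> K" for e y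
    using that by (auto simp: g_def g'_def pd0 pd1 supp)
  have cont: "continuous_on UNIV F"
    if c: "continuous_on U F0" and F: "\<And>y. y \<in> U \<Longrightarrow> F y = F0 y" "\<And>y. y \<notin> K \<Longrightarrow> F y = 0"
    for F F0 :: "'a \<Rightarrow> real"
  proof -
    have "continuous_on (U \<union> - K) F"
    proof (rule continuous_on_open_Un[OF U oK])
      show "continuous_on U F" by (rule continuous_on_eq[OF c]) (simp add: F)
      show "continuous_on (- K) F" by (rule continuous_on_eq[OF continuous_on_const[of _ 0]]) (simp add: F)
    qed
    then show ?thesis by (simp add: UK)
  qed
  have c\<phi>: "continuous_on U \<phi>" "e \<in> Basis \<Longrightarrow> continuous_on U (partial_deriv e \<phi>)"
     "continuous_on U (laplacian \<phi>)" for e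
    using C2_on_continuous[OF C2_on_subset[OF \<phi>]] by auto
  have cont2: "e \<in> Basis \<Longrightarrow> continuous_on U (partial_deriv e (partial_deriv e f))"
     "e \<in> Basis \<Longrightarrow> continuous_on U (partial_deriv e (partial_deriv e \<phi>))" for e
    using f C2_on_subset[OF \<phi>, of U] unfolding C2_on_def by auto
  have int0: "integrable lborel (g' e)" "integral\<^sup>L lborel (g' e) = 0" if e: "e \<in> Basis" for e
  proof -
    have cg: "continuous_on UNIV (g e)"
      by (rule cont[of "\<lambda>y. \<phi> y * partial_deriv e f y - f y * partial_deriv e \<phi> y"])
         (auto simp: supp pd0 g_def intro!: continuous_intros c\<phi> C2_on_continuous[OF f] e)
    have cg': "continuous_on UNIV (g' e)"
      by (rule cont[of "\<lambda>y. \<phi> y * partial_deriv e (partial_deriv e f) y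
            - f y * partial_deriv e (partial_deriv e \<phi>) y"])
         (auto simp: supp pd1 g'_def intro!: continuous_intros c\<phi> cont2 C2_on_continuous[OF f] e)
    show "integrable lborel (g' e)" by (rule integrable_compact_support[OF cg' K(1) g0(2)])
    show "integral\<^sup>L lborel (g' e) = 0"
    proof (rule integral_directional_derivative[OF _ cg cg' K(1) g0])
      fix y show "((\<lambda>t. g e (y + t *\<^sub>R e)) has_real_derivative g' e y) (at 0)"
      proof (cases "y \<in> U")
        case True
        have df: "f differentiable (at y)" "partial_deriv e f differentiable (at y)"
          using f True U e unfolding C2_on_def by (auto simp: differentiable_on_eq_differentiable_at)
        have d\<phi>: "\<phi> differentiable (at y)" "partial_deriv e \<phi> differentiable (at y)"
          using \<phi> e unfolding C2_on_def by (auto simp: differentiable_on_eq_differentiable_at)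
        have "((\<lambda>t. \<phi> (y + t *\<^sub>R e) * partial_deriv e f (y + t *\<^sub>R e)
            - f (y + t *\<^sub>R e) * partial_deriv e \<phi> (y + t *\<^sub>R e)) has_real_derivative g' e y) (at 0)"
          using True
          by (auto intro!: derivative_eq_intros partial_deriv_line df d\<phi> simp: g'_def algebra_simps)
        moreover have "open ((\<lambda>t. y + t *\<^sub>R e) -` U)"
          by (intro continuous_open_vimage U) (auto intro!: continuous_intros)
        ultimately show ?thesis
          by (rule has_field_derivative_transform_within_open) (use True in \<open>auto simp: g_def\<close>)
      next
        case False
        have "((\<lambda>t. 0) has_real_derivative g' e y) (at 0)"
          using False by (simp add: g'_def)
        moreover have "open ((\<lambda>t. y + t *\<^sub>R e) -` (- K))"
          by (intro continuous_open_vimage oK) (auto intro!: continuous_intros)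
        ultimately show ?thesis
          by (rule has_field_derivative_transform_within_open)
             (use False K in \<open>auto simp: g0\<close>)
      qed
    qed
  qed
  have "(\<Sum>e\<in>Basis. integral\<^sup>L lborel (g' e)) = 0" using int0 by simp
  then have "(\<integral>y. (\<Sum>e\<in>Basis. g' e y) \<partial>lborel) = 0"
    by (subst Bochner_Integration.integral_sum) (use int0 in auto)
  moreover have "(\<Sum>e\<in>Basis. g' e y) = indicator K y *\<^sub>R (\<phi> y * laplacian f y - f y * laplacian \<phi> y)" for y
  proof (cases "y \<in> K")
    case True
    then have "y \<in> U" using K by auto
    then show ?thesis using True
      by (simp add: g'_def laplacian_def sum_subtractf sum_distrib_left)
  qed (simp add: g0)
  ultimately have "(LINT y:K|lborel. \<phi> y * laplacian f y - f y * laplacian \<phi> y) = 0"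
    unfolding set_lebesgue_integral_def by simp
  moreover have "continuous_on K F" if "continuous_on U F" for F :: "'a \<Rightarrow> real"
    using that K continuous_on_subset by blast
  ultimately show ?thesis
    by (subst (asm) set_integral_diff)
       (auto intro!: set_integrable_compact K continuous_on_mult C2_on_continuous[OF f] c\<phi>)
qed

subsection \<open>Polar coordinates and spherical means\<close>

lemma nn_integral_scaleR:
  fixes f :: "'a::euclidean_space \<Rightarrow> ennreal"
  assumes [measurable]: "f \<in> borel_measurable borel" and c: "c \<noteq> 0"
  shows "(\<integral>\<^sup>+x. f x \<partial>lborel) = ennreal (\<bar>c\<bar> ^ DIM('a)) * (\<integral>\<^sup>+x. f (c *\<^sub>R x) \<partial>lborel)"
  by (subst lborel_affine[OF c, of 0])
     (simp add: nn_integral_density nn_integral_distr nn_integral_cmult)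

text \<open>Tonelli with the substitutions \<open>t = s * norm z\<close> for fixed z and then \<open>w = s *\<^sub>R z\<close>
  for fixed s leaves the integral of \<open>n * s powr (- n - 1)\<close> over \<open>s > norm w\<close>.\<close>
lemma nn_integral_polar:
  fixes f :: "'a::euclidean_space \<Rightarrow> ennreal"
  assumes f[measurable]: "f \<in> borel_measurable borel"
  shows "(\<integral>\<^sup>+y. f y \<partial>lborel) =
    (\<integral>\<^sup>+t. \<integral>\<^sup>+z. ennreal (indicator {0<..} t * (real DIM('a) * t ^ (DIM('a) - 1)) * indicator (ball 0 1) z)
       * f ((t / norm z) *\<^sub>R z) \<partial>(lborel :: 'a measure) \<partial>lborel)" (is "_ = ?R")
proof -
  define n where "n = DIM('a)"
  have n: "0 < n" by (simp add: n_def)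
  \<comment> \<open>The weights before the substitutions, after \<open>t = s * norm z\<close>, and
    after \<open>w = s *\<^sub>R z\<close>. The first contributes the Jacobian
    \<open>norm z\<close>, which completes \<open>norm z ^ (n - 1)\<close> to
    \<open>norm z ^ n\<close>; the second contributes \<open>s ^ n\<close>, and
    \<open>norm z ^ n\<close> becomes \<open>norm w ^ n / s ^ n\<close>.\<close>
  define a :: "real \<Rightarrow> 'a \<Rightarrow> real" where
    "a t z = indicator {0<..} t * (real n * t ^ (n - 1)) * indicator (ball 0 1) z" for t z
  define b :: "real \<Rightarrow> 'a \<Rightarrow> real" where
    "b s z = indicator {0<..} s * (real n * s ^ (n - 1)) * (norm z ^ n * indicator (ball 0 1) z)" for s z
  define c :: "real \<Rightarrow> 'a \<Rightarrow> real" where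
    "c s w = indicator {0<..} s * (real n / s ^ (n + 1)) * (norm w ^ n * indicator {..< s} (norm w))" for s w
  have [measurable]: "ball (0::'a) 1 \<in> sets borel" by simp
  have [measurable]: "(\<lambda>(t, z). a t z) \<in> borel_measurable (borel \<Otimes>\<^sub>M borel)"
    "(\<lambda>(t, z). b t z) \<in> borel_measurable (borel \<Otimes>\<^sub>M borel)"
    unfolding a_def b_def by measurable
  have [measurable]: "(\<lambda>(t, z). c t z) \<in> borel_measurable (borel \<Otimes>\<^sub>M borel)"
  proof -
    have "c = (\<lambda>s w. indicator {0<..} s * (real n / s ^ (n + 1)) * (norm w ^ n * (if norm w < s then 1 else 0)))"
      by (auto simp: c_def fun_eq_iff)
    then show ?thesis by simp
  qed
  have ab: "(\<integral>\<^sup>+t. ennreal (a t z) * f ((t / norm z) *\<^sub>R z) \<partial>lborel)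
      = (\<integral>\<^sup>+s. ennreal (b s z) * f (s *\<^sub>R z) \<partial>lborel)" if z: "z \<noteq> 0" for z
  proof -
    have "(\<integral>\<^sup>+t. ennreal (a t z) * f ((t / norm z) *\<^sub>R z) \<partial>lborel)
      = ennreal \<bar>norm z\<bar> * (\<integral>\<^sup>+s. ennreal (a (0 + norm z * s) z) * f (((0 + norm z * s) / norm z) *\<^sub>R z) \<partial>lborel)"
      by (rule nn_integral_real_affine) (use z in auto)
    also have "\<dots> = (\<integral>\<^sup>+s. ennreal (norm z) * (ennreal (a (norm z * s) z) * f (s *\<^sub>R z)) \<partial>lborel)"
      using z by (subst nn_integral_cmult[symmetric]) auto
    also have "\<dots> = (\<integral>\<^sup>+s. ennreal (b s z) * f (s *\<^sub>R z) \<partial>lborel)"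
    proof (rule nn_integral_cong)
      fix s
      have "norm z * a (norm z * s) z = b s z"
        using z n by (cases n) (auto simp: a_def b_def indicator_def zero_less_mult_iff power_mult_distrib)
      then show "ennreal (norm z) * (ennreal (a (norm z * s) z) * f (s *\<^sub>R z)) = ennreal (b s z) * f (s *\<^sub>R z)"
        by (metis ennreal_mult' mult.assoc norm_ge_zero)
    qed
    finally show ?thesis .
  qed
  have bc: "(\<integral>\<^sup>+z. ennreal (b s z) * f (s *\<^sub>R z) \<partial>lborel) = (\<integral>\<^sup>+w. ennreal (c s w) * f w \<partial>lborel)" for s
  proof (cases "s > 0")
    case True
    have "(\<integral>\<^sup>+w. ennreal (c s w) * f w \<partial>lborel)
      = ennreal (\<bar>s\<bar> ^ DIM('a)) * (\<integral>\<^sup>+z. ennreal (c s (s *\<^sub>R z)) * f (s *\<^sub>R z) \<partial>lborel)"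
      by (rule nn_integral_scaleR) (use True in auto)
    also have "\<dots> = (\<integral>\<^sup>+z. ennreal (s ^ n) * (ennreal (c s (s *\<^sub>R z)) * f (s *\<^sub>R z)) \<partial>lborel)"
      using True by (subst nn_integral_cmult[symmetric]) (auto simp: n_def)
    also have "\<dots> = (\<integral>\<^sup>+z. ennreal (b s z) * f (s *\<^sub>R z) \<partial>lborel)"
    proof (rule nn_integral_cong)
      fix z :: 'a
      have "s ^ n * c s (s *\<^sub>R z) = b s z"
        using True n by (cases n) (auto simp: c_def b_def indicator_def power_mult_distrib field_simps)
      then show "ennreal (s ^ n) * (ennreal (c s (s *\<^sub>R z)) * f (s *\<^sub>R z)) = ennreal (b s z) * f (s *\<^sub>R z)"
        using True by (metis ennreal_mult' mult.assoc zero_le_power less_imp_le)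
    qed
    finally show ?thesis by simp
  qed (simp add: b_def c_def)
  have c1: "(\<integral>\<^sup>+s. ennreal (c s w) \<partial>lborel) = 1" if w: "w \<noteq> 0" for w
  proof -
    have "(\<integral>\<^sup>+s. ennreal (c s w) \<partial>lborel)
      = (\<integral>\<^sup>+s. ennreal (real n / s ^ (n + 1) * norm w ^ n) * indicator {norm w..} s \<partial>lborel)"
    \<comment> \<open>The strict inequality in \<open>c\<close> and the closed half-line differ only
      at the single point \<open>s = norm w\<close>.\<close>
    proof (rule nn_integral_cong_AE, rule AE_mp[OF AE_lborel_singleton[of "norm w"]], intro AE_I2 impI)
      fix s :: real assume s: "s \<noteq> norm w"
      show "ennreal (c s w) = ennreal (real n / s ^ (n + 1) * norm w ^ n) * indicator {norm w..} s"
      proof (cases "norm w < s")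
        case True
        moreover have "0 < s" using True by (meson norm_ge_zero le_less_trans)
        ultimately show ?thesis by (simp add: c_def)
      qed (use s in \<open>simp add: c_def\<close>)
    qed
    also have "\<dots> = ennreal (0 - (- (norm w ^ n / norm w ^ n)))"
    proof (rule nn_integral_FTC_atLeast[where F = "\<lambda>s. - (norm w ^ n / s ^ n)"])
      fix s assume s: "norm w \<le> s"
      then have s0: "0 < s" using w by (meson less_le_trans zero_less_norm_iff)
      obtain k where k: "n = Suc k" using n by (cases n) auto
      have [simp]: "0 < k \<Longrightarrow> s * s ^ (k - Suc 0) = s ^ k" by (cases k) auto
      have "((\<lambda>s. - (norm w ^ Suc k / s ^ Suc k)) has_real_derivative real (Suc k) / s ^ (Suc k + 1) * norm w ^ Suc k) (at s)"
        using s0 by (auto intro!: derivative_eq_intros simp: field_simps)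
      then show "((\<lambda>s. - (norm w ^ n / s ^ n)) has_real_derivative real n / s ^ (n + 1) * norm w ^ n) (at s)"
        by (simp only: k)
      show "0 \<le> real n / s ^ (n + 1) * norm w ^ n" using s0 by simp
    next
      have "((\<lambda>s. - (norm w ^ n / s ^ n)) \<longlongrightarrow> - 0) at_top"
        using n by (intro tendsto_minus tendsto_divide_0[OF tendsto_const] filterlim_at_top_imp_at_infinity
            filterlim_pow_at_top filterlim_ident)
      then show "((\<lambda>s. - (norm w ^ n / s ^ n)) \<longlongrightarrow> 0) at_top" by simp
    qed simp
    also have "\<dots> = 1" using w by simp
    finally show ?thesis .
  qed
  have "?R = (\<integral>\<^sup>+t. \<integral>\<^sup>+z. ennreal (a t z) * f ((t / norm z) *\<^sub>R z) \<partial>lborel \<partial>lborel)"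
    by (simp add: a_def n_def)
  also have "\<dots> = (\<integral>\<^sup>+z. \<integral>\<^sup>+t. ennreal (a t z) * f ((t / norm z) *\<^sub>R z) \<partial>lborel \<partial>lborel)"
    by (rule lborel_pair.Fubini'[symmetric]) measurable
  also have "\<dots> = (\<integral>\<^sup>+z. \<integral>\<^sup>+s. ennreal (b s z) * f (s *\<^sub>R z) \<partial>lborel \<partial>lborel)"
    by (rule nn_integral_cong_AE, rule AE_mp[OF AE_lborel_singleton[of 0]]) (simp add: ab)
  also have "\<dots> = (\<integral>\<^sup>+s. \<integral>\<^sup>+z. ennreal (b s z) * f (s *\<^sub>R z) \<partial>lborel \<partial>lborel)"
    by (rule lborel_pair.Fubini') measurable
  also have "\<dots> = (\<integral>\<^sup>+s. \<integral>\<^sup>+w. ennreal (c s w) * f w \<partial>lborel \<partial>lborel)"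
    by (simp add: bc)
  also have "\<dots> = (\<integral>\<^sup>+w. \<integral>\<^sup>+s. ennreal (c s w) * f w \<partial>lborel \<partial>lborel)"
    by (rule lborel_pair.Fubini'[symmetric]) measurable
  also have "\<dots> = (\<integral>\<^sup>+w. f w \<partial>lborel)"
    by (rule nn_integral_cong_AE, rule AE_mp[OF AE_lborel_singleton[of 0]])
       (simp add: nn_integral_multc c1)
  finally show ?thesis by simp
qed

text \<open>Applied to indicators, the formula for nonnegative functions exhibits
  \<open>lborel\<close> as the image under \<open>T\<close> of a weighted product measure.
  Integrability then transfers to the product, where Fubini applies to signed functions.\<close>

lemma integral_polar:
  fixes f :: "'a::euclidean_space \<Rightarrow> real"
  assumes f: "integrable lborel f"
  shows "(\<integral>y. f y \<partial>lborel) =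
    (\<integral>t. indicator {0<..} t * (real DIM('a) * t ^ (DIM('a) - 1)) *
      (LINT z:ball 0 1|lborel. f ((t / norm z) *\<^sub>R z)) \<partial>lborel)"
proof -
  define a :: "real \<times> 'a \<Rightarrow> real" where
    "a = (\<lambda>(t, z). indicator {0<..} t * (real DIM('a) * t ^ (DIM('a) - 1)) * indicator (ball 0 1) z)"
  define T :: "real \<times> 'a \<Rightarrow> 'a" where "T = (\<lambda>(t, z). (t / norm z) *\<^sub>R z)"
  have [measurable]: "ball (0::'a) 1 \<in> sets borel" by simp
  have a[measurable]: "a \<in> borel_measurable (lborel \<Otimes>\<^sub>M lborel)" unfolding a_def by measurable
  have T[measurable]: "T \<in> (lborel \<Otimes>\<^sub>M lborel) \<rightarrow>\<^sub>M borel" unfolding T_def by measurable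
  have a0: "0 \<le> a p" for p by (auto simp: a_def indicator_def split: prod.splits)
  have [measurable]: "f \<in> borel_measurable borel" using borel_measurable_integrable[OF f] by simp
  have eq: "lborel = distr (density (lborel \<Otimes>\<^sub>M lborel) (\<lambda>p. ennreal (a p))) borel T"
  proof (rule measure_eqI)
    fix A :: "'a set" assume "A \<in> sets lborel"
    then have A[measurable]: "A \<in> sets borel" by simp
    have "emeasure lborel A = (\<integral>\<^sup>+y. indicator A y \<partial>lborel)" by simp
    also have "\<dots> = (\<integral>\<^sup>+t. \<integral>\<^sup>+z. ennreal (a (t, z)) * indicator A (T (t, z)) \<partial>lborel \<partial>lborel)"
      by (subst nn_integral_polar) (auto simp: a_def T_def)
    also have "\<dots> = (\<integral>\<^sup>+p. ennreal (a p) * indicator A (T p) \<partial>(lborel \<Otimes>\<^sub>M lborel))"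
      by (subst lborel.nn_integral_fst[symmetric]) auto
    also have "\<dots> = (\<integral>\<^sup>+y. indicator A y \<partial>distr (density (lborel \<Otimes>\<^sub>M lborel) (\<lambda>p. ennreal (a p))) borel T)"
      by (subst nn_integral_distr) (auto simp: nn_integral_density)
    finally show "emeasure lborel A = emeasure (distr (density (lborel \<Otimes>\<^sub>M lborel) (\<lambda>p. ennreal (a p))) borel T) A"
      by simp
  qed simp
  have i: "integrable (lborel \<Otimes>\<^sub>M lborel) (\<lambda>p. a p * f (T p))"
  proof -
    have "integrable (distr (density (lborel \<Otimes>\<^sub>M lborel) (\<lambda>p. ennreal (a p))) borel T) f"
      using f by (subst eq[symmetric])
    then show ?thesis
      by (subst (asm) integrable_distr_eq) (auto simp: integrable_density a0)
  qed
  have "(\<integral>y. f y \<partial>lborel) = (\<integral>y. f y \<partial>distr (density (lborel \<Otimes>\<^sub>M lborel) (\<lambda>p. ennreal (a p))) borel T)"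
    by (subst eq) simp
  also have "\<dots> = (\<integral>p. a p * f (T p) \<partial>(lborel \<Otimes>\<^sub>M lborel))"
    by (subst integral_distr) (auto simp: integral_density a0)
  also have "\<dots> = (\<integral>t. \<integral>z. a (t, z) * f (T (t, z)) \<partial>lborel \<partial>lborel)"
    by (rule lborel_pair.integral_fst'[symmetric, OF i])
  also have "\<dots> = (\<integral>t. \<integral>z. (indicator {0<..} t * (real DIM('a) * t ^ (DIM('a) - 1))) *
      (indicator (ball 0 1) z * f ((t / norm z) *\<^sub>R z)) \<partial>lborel \<partial>lborel)"
    by (simp add: a_def T_def mult_ac)
  finally show ?thesis unfolding set_lebesgue_integral_def by simp
qed

text \<open>An average over the unit ball along the radial projection. In this form the measure does
  not depend on \<open>r\<close>, and \<open>r = 0\<close> is meaningful: the projection collapses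
  to \<open>x\<close> and the mean is \<open>u x\<close>.\<close>

definition sphere_mean :: "('a::euclidean_space \<Rightarrow> real) \<Rightarrow> 'a \<Rightarrow> real \<Rightarrow> real" where
  "sphere_mean u x r = (LINT z:ball 0 1|lborel. u (x + (r / norm z) *\<^sub>R z)) / unit_ball_vol DIM('a)"

lemma unit_ball_vol_DIM: "unit_ball_vol (real DIM('a::euclidean_space)) > 0"
  by (rule unit_ball_vol_pos) simp

text \<open>The factor \<open>k\<close> is constant on spheres about \<open>x\<close>, so it leaves
  the spherical integral and a one-dimensional integral of the mean remains.\<close>

lemma integral_polar_sphere_mean:
  fixes u :: "'a::euclidean_space \<Rightarrow> real" and k :: "real \<Rightarrow> real"
  assumes f: "integrable lborel (\<lambda>y. u y * k ((y - x) \<bullet> (y - x)))"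
  shows "(\<integral>y. u y * k ((y - x) \<bullet> (y - x)) \<partial>lborel) =
    real DIM('a) * unit_ball_vol DIM('a) *
    (\<integral>t. indicator {0<..} t * t ^ (DIM('a) - 1) * k (t\<^sup>2) * sphere_mean u x t \<partial>lborel)"
proof -
  define f where "f y = u y * k ((y - x) \<bullet> (y - x))" for y
  define V where "V = unit_ball_vol DIM('a)"
  have V: "V > 0" unfolding V_def by (rule unit_ball_vol_DIM)
  have fi: "integrable lborel f" using f by (simp add: f_def[abs_def])
  have [measurable]: "f \<in> borel_measurable borel" using borel_measurable_integrable[OF fi] by simp
  have [measurable]: "ball (0::'a) 1 \<in> sets borel" by simp
  have i: "integrable lborel (\<lambda>y. f (x + y))" and e: "(\<integral>y. f y \<partial>lborel) = (\<integral>y. f (x + y) \<partial>lborel)"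
    using fi lborel_distr_plus[of x, symmetric]
      integrable_distr_eq[of "(+) x" lborel borel f] integral_distr[of "(+) x" lborel borel f] by auto
  have s: "(LINT z:ball 0 1|lborel. f (x + (t / norm z) *\<^sub>R z)) = k (t\<^sup>2) * (V * sphere_mean u x t)" for t
  proof -
    define g where "g z = k (t\<^sup>2) * (indicator (ball 0 1) z * u (x + (t / norm z) *\<^sub>R z))" for z :: 'a
    have fg: "indicator (ball 0 1) z *\<^sub>R f (x + (t / norm z) *\<^sub>R z) = g z" if "z \<noteq> 0" for z
      using that by (auto simp: f_def g_def dot_square_norm power2_eq_square field_simps)
    \<comment> \<open>Only the product \<open>f\<close> is known to be measurable, not
      \<open>u\<close> where \<open>k\<close> vanishes. So measurability of \<open>g\<close> is
      taken from \<open>f\<close>, from which it differs at most at \<open>z = 0\<close>, where the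
      projection lands on \<open>x\<close> instead of the sphere.\<close>
    then have "g = (\<lambda>z. if z = 0 then g 0 else indicator (ball 0 1) z *\<^sub>R f (x + (t / norm z) *\<^sub>R z))"
      by auto
    also have "\<dots> \<in> borel_measurable borel" by measurable
    finally have g: "g \<in> borel_measurable borel" .
    have "(LINT z:ball 0 1|lborel. f (x + (t / norm z) *\<^sub>R z)) = (\<integral>z. g z \<partial>lborel)"
      unfolding set_lebesgue_integral_def
    proof (rule integral_cong_AE)
      show "AE z in lborel. indicator (ball 0 1) z *\<^sub>R f (x + (t / norm z) *\<^sub>R z) = g z"
        by (rule AE_mp[OF AE_lborel_singleton[of 0]]) (intro AE_I2 impI fg)
    qed (use g in auto)
    then show ?thesis using V[unfolded V_def, THEN less_imp_neq] by (simp add: g_def sphere_mean_def V_def set_lebesgue_integral_def)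
  qed
  have "(\<integral>y. f y \<partial>lborel) = (\<integral>t. indicator {0<..} t * (real DIM('a) * t ^ (DIM('a) - 1)) *
      (k (t\<^sup>2) * (V * sphere_mean u x t)) \<partial>lborel)"
    unfolding e integral_polar[OF i] s ..
  also have "\<dots> = (\<integral>t. real DIM('a) * V * (indicator {0<..} t * t ^ (DIM('a) - 1) * k (t\<^sup>2) * sphere_mean u x t) \<partial>lborel)"
    by (simp add: mult_ac)
  finally show ?thesis by (simp add: f_def V_def)
qed

section \<open>The uniform measure on a sphere and continuity of spherical means\<close>

lemma scale_measure_density: "scale_measure c M = density M (\<lambda>_. c)"
  by (rule measure_eqI) (simp_all add: emeasure_density nn_integral_cmult)

text \<open>The powers of \<open>r\<close> cancel, and
  \<open>Gamma (n / 2 + 1) = n / 2 * Gamma (n / 2)\<close> turns the remaining constant into the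
  reciprocal of the unit ball volume: the measure is the image of the uniform probability on the
  unit ball.\<close>

lemma sphere_uniform_eq:
  fixes x :: "'a::euclidean_space"
  assumes r: "r > 0"
  shows "sphere_uniform x r = distr (density lborel (\<lambda>z. ennreal (indicator (ball 0 1) z / unit_ball_vol DIM('a))))
     borel (\<lambda>z. x + (r / norm z) *\<^sub>R z)"
proof (rule measure_eqI)
  define T where "T z = x + (r / norm z) *\<^sub>R z" for z :: 'a
  define V where "V = unit_ball_vol DIM('a)"
  define n where "n = DIM('a)"
  have n: "0 < n" by (simp add: n_def)
  have V: "V > 0" unfolding V_def by (rule unit_ball_vol_DIM)
  have [measurable]: "T \<in> borel \<rightarrow>\<^sub>M borel" unfolding T_def by measurable
  have [measurable]: "ball (0::'a) 1 \<in> sets borel" by simp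
  fix A :: "'a set" assume "A \<in> sets (sphere_uniform x r)"
  then have [measurable]: "A \<in> sets borel" by (simp add: sphere_uniform_def sphere_surface_measure_def)
  have [measurable]: "T -` A \<in> sets borel" by (rule measurable_sets_borel[of T borel A]) simp_all
  define a where "a = Gamma (real n / 2) / (2 * pi powr (real n / 2)) * r powr (1 - real n)"
  have a0: "0 \<le> a" using n by (simp add: a_def Gamma_real_pos less_imp_le)
  have "r powr (1 - real n) * r ^ (n - 1) = 1"
    using r n by (simp add: powr_realpow[symmetric] powr_add[symmetric] of_nat_diff)
  moreover have "Gamma (real n / 2 + 1) = real n / 2 * Gamma (real n / 2)"
    using n by (intro Gamma_plus1) (auto dest: nonpos_Ints_nonpos)
  ultimately have aV: "a * (real n * r ^ (n - 1)) = 1 / V"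
    using n r Gamma_real_pos[of "real n / 2"] by (simp add: a_def V_def unit_ball_vol_def n_def[symmetric] field_simps)
  have e: "emeasure (distr (restrict_space lborel (ball 0 1)) borel T) A = (\<integral>\<^sup>+z. indicator (ball 0 1) z * indicator A (T z) \<partial>lborel)"
  proof -
    have "T \<in> restrict_space lborel (ball 0 1) \<rightarrow>\<^sub>M borel" by (rule measurable_restrict_space1) simp
    then have "emeasure (distr (restrict_space lborel (ball 0 1)) borel T) A
      = (\<integral>\<^sup>+z. indicator A (T z) \<partial>restrict_space lborel (ball 0 1))"
      by (subst nn_integral_indicator[symmetric], simp, subst nn_integral_distr) auto
    then show ?thesis by (subst (asm) nn_integral_restrict_space) (auto simp: mult.commute)
  qed
  have "emeasure (sphere_uniform x r) A = ennreal a * (ennreal (real n * r ^ (n - 1)) *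
      (\<integral>\<^sup>+z. indicator (ball 0 1) z * indicator A (T z) \<partial>lborel))"
    unfolding sphere_uniform_def sphere_surface_measure_def emeasure_scale_measure a_def n_def
    by (simp only: e[unfolded T_def[abs_def]] T_def)
  also have "\<dots> = ennreal (1 / V) * (\<integral>\<^sup>+z. indicator (ball 0 1) z * indicator A (T z) \<partial>lborel)"
    using a0 by (simp only: mult.assoc[of "ennreal a", symmetric] ennreal_mult'[symmetric] aV)
  also have "\<dots> = (\<integral>\<^sup>+z. ennreal (indicator (ball 0 1) z / V) * indicator A (T z) \<partial>lborel)"
    by (subst nn_integral_cmult[symmetric])
       (use V in \<open>auto split: split_indicator intro!: nn_integral_cong\<close>)
  also have "\<dots> = emeasure (distr (density lborel (\<lambda>z. ennreal (indicator (ball 0 1) z / V))) borel T) A"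
    by (subst emeasure_distr) (auto simp: emeasure_density indicator_vimage[symmetric] intro!: nn_integral_cong split: split_indicator)
  finally show "emeasure (sphere_uniform x r) A = emeasure (distr (density lborel
     (\<lambda>z. ennreal (indicator (ball 0 1) z / unit_ball_vol DIM('a)))) borel (\<lambda>z. x + (r / norm z) *\<^sub>R z)) A"
    by (simp only: V_def T_def[abs_def])
qed (simp add: sphere_uniform_def sphere_surface_measure_def)

lemma sets_sphere_uniform [simp, measurable_cong]: "sets (sphere_uniform x r) = sets borel"
  by (simp add: sphere_uniform_def sphere_surface_measure_def)

lemma space_sphere_uniform [simp]: "space (sphere_uniform x r) = UNIV"
  by (simp add: sphere_uniform_def sphere_surface_measure_def space_scale_measure)

lemma integral_sphere_uniform:
  fixes u :: "'a::euclidean_space \<Rightarrow> real"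
  assumes r: "r > 0" and u[measurable]: "u \<in> borel_measurable borel"
  shows "integral\<^sup>L (sphere_uniform x r) u = sphere_mean u x r"
proof -
  have [measurable]: "ball (0::'a) 1 \<in> sets borel" by simp
  show ?thesis
    unfolding sphere_uniform_eq[OF r] sphere_mean_def set_lebesgue_integral_def
    by (subst integral_distr) (auto simp: integral_density)
qed

lemma emeasure_sphere_uniform_Compl:
  fixes x :: "'a::euclidean_space"
  assumes r: "r > 0"
  shows "emeasure (sphere_uniform x r) (- sphere x r) = 0"
proof -
  have [measurable]: "ball (0::'a) 1 \<in> sets borel" by simp
  have d: "x + (r / norm z) *\<^sub>R z \<in> sphere x r" if "z \<noteq> 0" for z
    using that r by (simp add: dist_norm)
  have "AE z in lborel. x + (r / norm z) *\<^sub>R z \<in> sphere x r"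
    by (rule AE_mp[OF AE_lborel_singleton[of 0]]) (intro AE_I2 impI d)
  then have "AE y in sphere_uniform x r. y \<in> sphere x r"
    unfolding sphere_uniform_eq[OF r] by (subst AE_distr_iff) (auto simp: AE_density)
  then have "emeasure (sphere_uniform x r) {y \<in> space (sphere_uniform x r). y \<notin> sphere x r} = 0"
    by (subst AE_iff_measurable[symmetric, where P = "\<lambda>y. y \<in> sphere x r"]) auto
  then show ?thesis by (simp add: Compl_eq)
qed

text \<open>The values of \<open>u\<close> off the sphere may be arbitrary, so the integral formula
  is applied to \<open>u\<close> cut off to the sphere; the projection of every nonzero
  \<open>z\<close> lies on the sphere, where the cut-off changes nothing.\<close>

lemma set_integral_sphere_uniform:
  fixes u :: "'a::euclidean_space \<Rightarrow> real"
  assumes r: "r > 0" and u: "(\<lambda>y. indicator (sphere x r) y * u y) \<in> borel_measurable borel"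
  shows "(LINT y:sphere x r|sphere_uniform x r. u y) = sphere_mean u x r"
proof -
  define w where "w y = indicator (sphere x r) y * u y" for y
  have [measurable]: "ball (0::'a) 1 \<in> sets borel" by simp
  have w[measurable]: "w \<in> borel_measurable borel" using u by (simp add: w_def[abs_def])
  have wu: "w (x + (r / norm z) *\<^sub>R z) = u (x + (r / norm z) *\<^sub>R z)" if "z \<noteq> 0" for z
    using that r by (simp add: w_def dist_norm)
  define g where "g z = indicator (ball 0 1) z *\<^sub>R u (x + (r / norm z) *\<^sub>R z)" for z
  have "g = (\<lambda>z. if z = 0 then g 0 else indicator (ball 0 1) z *\<^sub>R w (x + (r / norm z) *\<^sub>R z))"
    by (auto simp: g_def wu)
  also have "\<dots> \<in> borel_measurable borel" by measurable
  finally have g: "g \<in> borel_measurable borel" .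
  have "(LINT z:ball 0 1|lborel. w (x + (r / norm z) *\<^sub>R z)) = (\<integral>z. g z \<partial>lborel)"
    unfolding set_lebesgue_integral_def
  proof (rule integral_cong_AE)
    show "AE z in lborel. indicator (ball 0 1) z *\<^sub>R w (x + (r / norm z) *\<^sub>R z) = g z"
      by (rule AE_mp[OF AE_lborel_singleton[of 0]]) (simp add: g_def wu)
  qed (use g in auto)
  then have "sphere_mean w x r = sphere_mean u x r" by (simp add: sphere_mean_def g_def set_lebesgue_integral_def)
  then show ?thesis using integral_sphere_uniform[OF r w, of x]
    by (simp add: set_lebesgue_integral_def w_def[abs_def])
qed

lemma finite_measure_sphere_uniform:
  fixes x :: "'a::euclidean_space"
  assumes r: "r > 0" shows "finite_measure (sphere_uniform x r)"
proof (rule finite_measureI)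
  have [measurable]: "ball (0::'a) 1 \<in> sets borel" by simp
  have "emeasure (sphere_uniform x r) (space (sphere_uniform x r)) =
      (\<integral>\<^sup>+z. ennreal (1 / unit_ball_vol DIM('a)) * indicator (ball 0 1) (z :: 'a) \<partial>lborel)"
    unfolding sphere_uniform_eq[OF r]
    by (subst emeasure_distr) (auto simp: emeasure_density split: split_indicator intro!: nn_integral_cong)
  also have "\<dots> = ennreal (1 / unit_ball_vol DIM('a)) * emeasure lborel (ball (0::'a) 1)"
    by (subst nn_integral_cmult) (auto intro!: borel_measurable_indicator)
  also have "\<dots> < \<infinity>" using emeasure_bounded_finite[of "ball (0::'a) 1"] by (simp add: ennreal_mult_less_top)
  finally show "emeasure (sphere_uniform x r) (space (sphere_uniform x r)) \<noteq> \<infinity>" by simp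
qed

lemma sphere_mean_const: "sphere_mean (\<lambda>_. c) (x::'a::euclidean_space) r = c"
proof -
  have "measure lborel (ball (0::'a) 1) = unit_ball_vol DIM('a)"
    using content_ball[of 1 "0::'a"] by simp
  then show ?thesis using unit_ball_vol_DIM[where 'a='a, THEN less_imp_neq]
    by (simp add: sphere_mean_def set_lebesgue_integral_def)
qed

lemma sphere_mean_0: "sphere_mean u (x::'a::euclidean_space) 0 = u x"
  using sphere_mean_const[of "u x" x 0] by (simp add: sphere_mean_def)

lemma continuous_on_sphere_mean:
  fixes u :: "'a::euclidean_space \<Rightarrow> real"
  assumes u: "continuous_on (cball x R) u"
  shows "continuous_on {0..R} (sphere_mean u x)"
proof (cases "0 \<le> R")
  case R: True
  have [measurable]: "ball (0::'a) 1 \<in> sets borel" by simp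
  \<comment> \<open>Cutting \<open>u\<close> off to the ball gives a Borel function and changes no
    mean of radius at most \<open>R\<close>.\<close>
  define w where "w y = indicator (cball x R) y *\<^sub>R u y" for y
  have w[measurable]: "w \<in> borel_measurable borel"
    unfolding w_def[abs_def] by (rule borel_measurable_continuous_on_indicator[OF _ u]) simp
  have in_cball: "x + (r / norm z) *\<^sub>R z \<in> cball x R" if "r \<in> {0..R}" for r and z :: 'a
    using that R by (simp add: dist_norm)
  have wu: "w (x + (r / norm z) *\<^sub>R z) = u (x + (r / norm z) *\<^sub>R z)" if "r \<in> {0..R}" for r and z :: 'a
    using in_cball[OF that] by (simp add: w_def)
  have "bounded (u ` cball x R)" by (intro compact_imp_bounded compact_continuous_image u) simp
  then obtain B where B: "\<And>y. y \<in> cball x R \<Longrightarrow> \<bar>u y\<bar> \<le> B" unfolding bounded_iff by fastforce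
  have "continuous_on {0..R} (\<lambda>r. LINT z:ball (0::'a) 1|lborel. u (x + (r / norm z) *\<^sub>R z))"
  proof (rule continuous_on_sequentiallyI)
    fix r :: "nat \<Rightarrow> real" and a
    assume r: "\<forall>n. r n \<in> {0..R}" and a: "a \<in> {0..R}" and lim: "r \<longlonglongrightarrow> a"
    have "(\<lambda>n. \<integral>z. indicator (ball 0 1) z *\<^sub>R w (x + (r n / norm z) *\<^sub>R z) \<partial>lborel)
      \<longlonglongrightarrow> (\<integral>z. indicator (ball 0 1) z *\<^sub>R w (x + (a / norm z) *\<^sub>R z) \<partial>lborel)"
    proof (rule integral_dominated_convergence[where w = "\<lambda>z. B * indicator (ball 0 1) z"])
      show "integrable lborel (\<lambda>z::'a. B * indicator (ball 0 1) z)"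
        using emeasure_bounded_finite[of "ball (0::'a) 1"]
        by (intro integrable_mult_right integrable_real_indicator) auto
      show "AE z in lborel. norm (indicator (ball 0 1) z *\<^sub>R w (x + (r n / norm z) *\<^sub>R z)) \<le> B * indicator (ball 0 1) z" for n
        by (rule AE_I2) (use B[OF in_cball] r in \<open>auto simp: wu indicator_def\<close>)
      show "AE z in lborel. (\<lambda>n. indicator (ball 0 1) z *\<^sub>R w (x + (r n / norm z) *\<^sub>R z))
          \<longlonglongrightarrow> indicator (ball 0 1) z *\<^sub>R w (x + (a / norm z) *\<^sub>R z)"
      proof (rule AE_I2, rule tendsto_scaleR[OF tendsto_const])
        fix z :: 'a
        have t: "(\<lambda>n. x + (r n / norm z) *\<^sub>R z) \<longlonglongrightarrow> x + (a / norm z) *\<^sub>R z"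
          by (cases "z = 0") (auto intro!: tendsto_intros lim)
        have "(\<lambda>n. u (x + (r n / norm z) *\<^sub>R z)) \<longlonglongrightarrow> u (x + (a / norm z) *\<^sub>R z)"
          using r a t in_cball by (intro continuous_on_tendsto_compose[OF u]) (auto intro!: always_eventually)
        then show "(\<lambda>n. w (x + (r n / norm z) *\<^sub>R z)) \<longlonglongrightarrow> w (x + (a / norm z) *\<^sub>R z)"
          using r a by (simp add: wu)
      qed
    qed auto
    then show "(\<lambda>n. LINT z:ball (0::'a) 1|lborel. u (x + (r n / norm z) *\<^sub>R z))
      \<longlonglongrightarrow> (LINT z:ball (0::'a) 1|lborel. u (x + (a / norm z) *\<^sub>R z))"
      unfolding set_lebesgue_integral_def using r a by (simp add: wu)
  qed
  then show ?thesis unfolding sphere_mean_def[abs_def]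
    using unit_ball_vol_DIM[where 'a='a, THEN less_imp_neq] by (intro continuous_intros) auto
qed simp

subsection \<open>Panharmonic functions have the average property\<close>

lemma has_real_derivative_zero_beyond:
  fixes h h' :: "real \<Rightarrow> real"
  assumes "\<And>s. (h has_real_derivative h' s) (at s)" "\<And>s. c < s \<Longrightarrow> h s = 0" "c < s"
  shows "h' s = 0"
proof -
  have "(h has_real_derivative 0) (at s)"
    by (rule has_field_derivative_transform_within_open[OF DERIV_const, of "{c<..}"]) (use assms in auto)
  then show ?thesis using assms(1) DERIV_unique by blast
qed

text \<open>Green's identity moves the Laplacian onto the radial test function, whose Laplacian is
  radial again, so polar coordinates leave only the spherical mean of \<open>u\<close>. The
  statement asks for C2 only, because it is read in both directions: a vanishing left side
  constrains the mean, and a known mean determines the left side.\<close>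

lemma radial_integral_zero:
  fixes u :: "'a::euclidean_space \<Rightarrow> real" and h h' h'' :: "real \<Rightarrow> real"
  assumes U: "open U" and u: "C2_on U u" and \<rho>: "0 < \<rho>" "cball x \<rho> \<subseteq> U"
    and h: "\<And>s. (h has_real_derivative h' s) (at s)"
    and h': "\<And>s. (h' has_real_derivative h'' s) (at s)"
    and h'': "continuous_on UNIV h''"
    and supp: "\<And>s. \<rho>\<^sup>2 < s \<Longrightarrow> h s = 0"
  shows "(LINT y:cball x \<rho>|lborel. h ((y - x) \<bullet> (y - x)) * (laplacian u y - \<mu>\<^sup>2 * u y)) =
    real DIM('a) * unit_ball_vol DIM('a) *
    (\<integral>t. indicator {0<..} t * t ^ (DIM('a) - 1) *
       (4 * t\<^sup>2 * h'' (t\<^sup>2) + 2 * real DIM('a) * h' (t\<^sup>2) - \<mu>\<^sup>2 * h (t\<^sup>2)) * sphere_mean u x t \<partial>lborel)"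
proof -
  define q where "q y = (y - x) \<bullet> (y - x)" for y
  define k where "k s = 4 * s * h'' s + 2 * real DIM('a) * h' s - \<mu>\<^sup>2 * h s" for s
  have supp': "h' s = 0" if "\<rho>\<^sup>2 < s" for s
    using has_real_derivative_zero_beyond[OF h supp that] by simp
  have supp'': "h'' s = 0" if "\<rho>\<^sup>2 < s" for s
    using has_real_derivative_zero_beyond[OF h' supp' that] by simp
  have out: "\<rho>\<^sup>2 < q y" if "y \<notin> cball x \<rho>" for y
    using that \<rho> by (simp add: q_def dot_square_norm dist_norm norm_minus_commute power_strict_mono)
  have k0: "k (q y) = 0" if "y \<notin> cball x \<rho>" for y
    using out[OF that] by (simp add: k_def supp supp' supp'')
  have ch: "continuous_on UNIV h" "continuous_on UNIV h'"
    using h h' by (meson DERIV_continuous continuous_at_imp_continuous_on)+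
  have "continuous_on UNIV k" unfolding k_def[abs_def] by (intro continuous_intros ch h'')
  then have ck: "continuous_on S (\<lambda>y. k (q y))" for S
    unfolding q_def by (rule continuous_on_compose2) (auto intro!: continuous_intros)
  have cq: "continuous_on S (\<lambda>y. h (q y))" for S
    unfolding q_def by (rule continuous_on_compose2[OF ch(1)]) (auto intro!: continuous_intros)
  have cu: "continuous_on (cball x \<rho>) u" "continuous_on (cball x \<rho>) (laplacian u)"
    using C2_on_continuous[OF u] \<rho> by (auto intro: continuous_on_subset)
  note radial = C2_on_radial[OF h h' h'', of x, folded q_def]
  have lap: "laplacian (\<lambda>y. h (q y)) y = k (q y) + \<mu>\<^sup>2 * h (q y)" for y
    using radial(2)[of y] by (simp add: k_def q_def)
  have "continuous_on UNIV (laplacian (\<lambda>y. h (q y)))"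
    by (rule C2_on_continuous(3)) (use radial(1) in \<open>simp add: q_def\<close>)
  then have cl: "continuous_on (cball x \<rho>) (laplacian (\<lambda>y. h (q y)))"
    by (rule continuous_on_subset) simp
  have 1: "(LINT y:cball x \<rho>|lborel. h (q y) * laplacian u y)
      = (LINT y:cball x \<rho>|lborel. u y * laplacian (\<lambda>y. h (q y)) y)"
    by (rule green_identity[OF U u]) (use radial(1) \<rho> out supp in \<open>auto simp: q_def\<close>)
  have "(LINT y:cball x \<rho>|lborel. h (q y) * (laplacian u y - \<mu>\<^sup>2 * u y))
     = (LINT y:cball x \<rho>|lborel. h (q y) * laplacian u y) - (LINT y:cball x \<rho>|lborel. \<mu>\<^sup>2 * h (q y) * u y)"
    by (subst set_integral_diff(2)[symmetric])
       (auto intro!: set_integrable_compact continuous_intros cq cu simp: algebra_simps)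
  also have "\<dots> = (LINT y:cball x \<rho>|lborel. u y * k (q y))"
    unfolding 1
    by (subst set_integral_diff(2)[symmetric])
       (auto intro!: set_integrable_compact continuous_intros cq ck cu cl simp: lap algebra_simps)
  also have "\<dots> = (\<integral>y. u y * k (q y) \<partial>lborel)"
    unfolding set_lebesgue_integral_def
    by (rule Bochner_Integration.integral_cong)
       (use k0 in \<open>auto simp: indicator_def\<close>)
  also have "\<dots> = real DIM('a) * unit_ball_vol DIM('a) *
    (\<integral>t. indicator {0<..} t * t ^ (DIM('a) - 1) * k (t\<^sup>2) * sphere_mean u x t \<partial>lborel)"
    unfolding q_def
  proof (rule integral_polar_sphere_mean)
    have "set_integrable lborel (cball x \<rho>) (\<lambda>y. u y * k (q y))"
      by (intro set_integrable_compact continuous_intros ck cu) simp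
    moreover have "(\<lambda>y. indicator (cball x \<rho>) y *\<^sub>R (u y * k (q y))) = (\<lambda>y. u y * k (q y))"
      using k0 by (auto simp: fun_eq_iff indicator_def)
    ultimately show "integrable lborel (\<lambda>y. u y * k ((y - x) \<bullet> (y - x)))"
      by (simp add: set_integrable_def q_def)
  qed
  finally show ?thesis by (simp only: k_def q_def)
qed

lemma real_antiderivative_exists:
  fixes p :: "real \<Rightarrow> real"
  assumes "continuous_on UNIV p"
  obtains \<eta> where "\<And>s. (\<eta> has_real_derivative p s) (at s)" "\<eta> c = 0"
proof
  fix s
  define A where "A = min c s - 1"
  define B where "B = max c s + 1"
  have "((\<lambda>u. LBINT y=c..u. p y) has_vector_derivative p s) (at s within {A..B})"
    by (rule interval_integral_FTC2) (use assms in \<open>auto simp: A_def B_def intro: continuous_on_subset\<close>)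
  moreover have "at s within {A..B} = at s"
    by (rule at_within_interior) (auto simp: A_def B_def)
  ultimately show "((\<lambda>u. LBINT y=c..u. p y) has_real_derivative p s) (at s)"
    by (simp add: has_real_derivative_iff_has_vector_derivative)
qed simp

lemma sphere_mean_radial:
  fixes x :: "'a::euclidean_space"
  assumes "0 < t"
  shows "sphere_mean (\<lambda>y. h ((y - x) \<bullet> (y - x))) x t = h (t\<^sup>2)"
proof -
  have [measurable]: "ball (0::'a) 1 \<in> sets borel" by simp
  have "(LINT z:ball 0 1|lborel. h ((x + (t / norm z) *\<^sub>R z - x) \<bullet> (x + (t / norm z) *\<^sub>R z - x)))
      = (LINT z:ball (0::'a) 1|lborel. h (t\<^sup>2))"
    unfolding set_lebesgue_integral_def
  proof (rule integral_cong_AE)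
    define g where "g z = indicator (ball 0 1) z *\<^sub>R
      h ((x + (t / norm z) *\<^sub>R z - x) \<bullet> (x + (t / norm z) *\<^sub>R z - x))" for z
    have e: "g z = indicator (ball 0 1) z *\<^sub>R h (t\<^sup>2)" if "z \<noteq> 0" for z
      using that by (simp add: g_def dot_square_norm power2_eq_square field_simps)
    have "g = (\<lambda>z. if z = 0 then g 0 else indicator (ball 0 1) z *\<^sub>R h (t\<^sup>2))"
      using e by auto
    also have "\<dots> \<in> borel_measurable borel" by measurable
    finally show "g \<in> borel_measurable lborel" by simp
    show "AE z in lborel. g z = indicator (ball 0 1) z *\<^sub>R h (t\<^sup>2)"
      by (rule AE_mp[OF AE_lborel_singleton[of 0]]) (intro AE_I2 impI e)
  qed auto
  then show ?thesis
    using sphere_mean_const[of "h (t\<^sup>2)" x t] by (simp add: sphere_mean_def)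
qed

text \<open>The test function is \<open>h = radial * \<eta>\<close>, where \<open>\<eta>\<close> is chosen to make
  \<open>4 s h'' + 2 n h' - \<mu>\<^sup>2 h\<close> a multiple of \<open>\<kappa>'\<close>; this is the Wronskian identity for the radial
  equation in weak form.\<close>
lemma panharmonic_weak:
  fixes u :: "'a::euclidean_space \<Rightarrow> real"
  assumes U: "open U" and u: "panharmonic_on \<mu> U u" and \<rho>: "0 < \<rho>" "cball x \<rho> \<subseteq> U"
    and \<kappa>: "\<And>r. (\<kappa> has_real_derivative \<kappa>' r) (at r)" and \<kappa>': "continuous_on UNIV \<kappa>'"
    and \<epsilon>: "0 < \<epsilon>" and lo: "\<And>r. r < \<epsilon> \<Longrightarrow> \<kappa> r = 0" and hi: "\<And>r. \<rho> < r \<Longrightarrow> \<kappa> r = 0"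
  shows "(\<integral>t. indicator {0<..} t * \<kappa>' t * (sphere_mean u x t / radial (real DIM('a) / 2) \<mu> (t\<^sup>2)) \<partial>lborel) = 0"
proof -
  define n where "n = DIM('a)"
  define d where "d = real n / 2"
  have n: "0 < n" by (simp add: n_def)
  have d: "d > 0" using n by (simp add: d_def)
  obtain r' r'' where r: "\<And>s. (radial d \<mu> has_real_derivative r' s) (at s)"
    and r': "\<And>s. (r' has_real_derivative r'' s) (at s)" and r'': "continuous_on UNIV r''"
    and ode: "\<And>s. 4 * s * r'' s + 4 * d * r' s = \<mu>\<^sup>2 * radial d \<mu> s"
    using radial_ode[OF d, of \<mu>] by blast
  have cr: "continuous_on S (radial d \<mu>)" "continuous_on S r'" for S
    using r r' by (meson DERIV_continuous continuous_at_imp_continuous_on)+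
  have c\<kappa>: "continuous_on UNIV \<kappa>"
    using \<kappa> by (meson DERIV_continuous continuous_at_imp_continuous_on)
  have rp: "radial d \<mu> s > 0" if "s > 0" for s using radial_pos[OF d] that by simp
  have lo': "\<kappa>' r = 0" if "r < \<epsilon>" for r
  proof -
    have "(\<kappa> has_real_derivative 0) (at r)"
      by (rule has_field_derivative_transform_within_open[OF DERIV_const, of "{..<\<epsilon>}"]) (use that lo in auto)
    then show ?thesis using \<kappa> DERIV_unique by blast
  qed
  \<comment> \<open>The integrating factor. For \<open>h = radial * \<eta>\<close> and
    \<open>p\<close> the derivative of \<open>\<eta>\<close>, the radial equation reduces the
    operator on \<open>h\<close> to \<open>4 * s * radial / g\<close> times the derivative of
    \<open>g * p\<close>. Choosing \<open>g * p\<close> as \<open>\<kappa> (sqrt s)\<close> turns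
    this into a multiple of \<open>\<kappa>'\<close>.\<close>
  define g where "g s = sqrt s ^ n * (radial d \<mu> s)\<^sup>2" for s
  define g' where "g' s = d / s * sqrt s ^ n * (radial d \<mu> s)\<^sup>2 + sqrt s ^ n * (2 * radial d \<mu> s * r' s)" for s
  have g0: "g s > 0" if "s > 0" for s using rp[OF that] that by (simp add: g_def)
  have dg: "(g has_real_derivative g' s) (at s)" if "s > 0" for s
  proof -
    obtain m where m: "n = Suc m" using n by (cases n) auto
    have "s = sqrt s * sqrt s" using that by simp
    then have e: "real n * (sqrt s ^ m * (inverse (sqrt s) / 2)) = d / s * sqrt s ^ n"
      using that by (simp add: m d_def divide_simps)
    have "((\<lambda>s. sqrt s ^ n) has_real_derivative d / s * sqrt s ^ n) (at s)"
      unfolding e[symmetric] using DERIV_power[OF DERIV_real_sqrt[OF that], of n] by (simp add: m mult_ac)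
    from DERIV_mult[OF this DERIV_power[OF r, of 2]] show ?thesis
      unfolding g_def[abs_def] g'_def by (simp add: mult_ac)
  qed
  \<comment> \<open>Below \<open>\<epsilon>\<^sup>2\<close> the numerator vanishes, so the value 0
    for s \<le> 0 continues the quotient to a continuously differentiable function on the whole
    line.\<close>
  define p where "p s = (if s > 0 then \<kappa> (sqrt s) / g s else 0)" for s
  define p' where "p' s = (if s > 0 then (\<kappa>' (sqrt s) * (inverse (sqrt s) / 2) * g s - \<kappa> (sqrt s) * g' s) / (g s * g s) else 0)" for s
  have p0: "p s = 0" "p' s = 0" if "s < \<epsilon>\<^sup>2" for s
  proof -
    have "sqrt s < \<epsilon>" using real_sqrt_less_mono[OF that] \<epsilon> by simp
    then show "p s = 0" "p' s = 0" by (auto simp: p_def p'_def lo lo')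
  qed
  have U2: "{0<..} \<union> {..<\<epsilon>\<^sup>2} = (UNIV :: real set)" using \<epsilon> by (auto simp: not_less intro: order.strict_trans1)
  have dp: "(p has_real_derivative p' s) (at s)" for s
  proof (cases "s > 0")
    case True
    have "((\<lambda>s. \<kappa> (sqrt s)) has_real_derivative \<kappa>' (sqrt s) * (inverse (sqrt s) / 2)) (at s)"
      by (rule DERIV_chain2[OF \<kappa>]) (use True in \<open>auto intro!: derivative_eq_intros\<close>)
    then have "((\<lambda>s. \<kappa> (sqrt s) / g s) has_real_derivative p' s) (at s)"
      using dg[OF True] g0[OF True] True by (auto intro!: derivative_eq_intros simp: p'_def)
    then show ?thesis
      by (rule has_field_derivative_transform_within_open[of _ _ _ "{0<..}"]) (use True in \<open>auto simp: p_def\<close>)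
  next
    case False
    have "((\<lambda>s. 0) has_real_derivative p' s) (at s)" using False by (simp add: p'_def)
    then show ?thesis
      by (rule has_field_derivative_transform_within_open[of _ _ _ "{..<\<epsilon>\<^sup>2}"])
         (use False \<epsilon> in \<open>auto simp: p0 not_less intro: order.strict_trans1\<close>)
  qed
  have cp: "continuous_on UNIV p"
    using dp by (meson DERIV_continuous continuous_at_imp_continuous_on)
  have cp': "continuous_on UNIV p'"
    unfolding U2[symmetric]
  proof (rule continuous_on_open_Un)
    have gn: "g s \<noteq> 0" if "s > 0" for s using g0[OF that] by simp
    have cg: "continuous_on {0<..} g" using dg by (meson DERIV_continuous continuous_at_imp_continuous_on greaterThan_iff)
    have "continuous_on {0<..} (\<lambda>s. (\<kappa>' (sqrt s) * (inverse (sqrt s) / 2) * g s - \<kappa> (sqrt s) * g' s) / (g s * g s))"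
      unfolding g'_def
      by (intro continuous_intros cg cr continuous_on_compose2[OF \<kappa>'] continuous_on_compose2[OF c\<kappa>])
         (auto simp: gn)
    then show "continuous_on {0<..} p'" by (rule continuous_on_eq) (simp add: p'_def)
    show "continuous_on {..<\<epsilon>\<^sup>2} p'" by (rule continuous_on_eq[OF continuous_on_const[of _ 0]]) (simp add: p0)
  qed auto
  \<comment> \<open>Beyond \<open>\<rho>\<^sup>2\<close> the function \<open>p\<close> is 0; fixing
    the antiderivative to be 0 at \<open>\<rho>\<^sup>2\<close> makes it, and with it
    \<open>h\<close>, vanish from there on.\<close>
  obtain \<eta> where \<eta>: "\<And>s. (\<eta> has_real_derivative p s) (at s)" and \<eta>0: "\<eta> (\<rho>\<^sup>2) = 0"
    using real_antiderivative_exists[OF cp, of "\<rho>\<^sup>2"] by blast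
  have \<eta>1: "\<eta> s = 0" if s: "\<rho>\<^sup>2 < s" for s
  proof -
    obtain z where z: "\<rho>\<^sup>2 < z" "\<eta> s - \<eta> (\<rho>\<^sup>2) = (s - \<rho>\<^sup>2) * p z"
      using MVT2[OF s, of \<eta> p] \<eta> by blast
    have "\<rho> < sqrt z" using z \<rho> by (simp add: real_less_rsqrt)
    then show ?thesis using z \<eta>0 by (simp add: p_def hi)
  qed
  define h where "h s = radial d \<mu> s * \<eta> s" for s
  define h' where "h' s = r' s * \<eta> s + radial d \<mu> s * p s" for s
  define h'' where "h'' s = r'' s * \<eta> s + 2 * r' s * p s + radial d \<mu> s * p' s" for s
  have c\<eta>: "continuous_on UNIV \<eta>"
    using \<eta> by (meson DERIV_continuous continuous_at_imp_continuous_on)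
  have h: "(h has_real_derivative h' s) (at s)" for s
    unfolding h_def[abs_def] h'_def by (auto intro!: derivative_eq_intros r \<eta>)
  have h': "(h' has_real_derivative h'' s) (at s)" for s
    unfolding h'_def[abs_def] h''_def by (auto intro!: derivative_eq_intros r r' \<eta> dp)
  have h'': "continuous_on UNIV h''"
    unfolding h''_def[abs_def] by (intro continuous_intros cr c\<eta> cp cp' r'')
  \<comment> \<open>The polar weight \<open>t ^ (n - 1)\<close> absorbs the factor
    \<open>t ^ n\<close> of \<open>g\<close>, so that \<open>\<kappa>'\<close> divided by
    \<open>radial\<close> is all that is left.\<close>
  have k: "t ^ (n - 1) * (4 * t\<^sup>2 * h'' (t\<^sup>2) + 2 * real n * h' (t\<^sup>2) - \<mu>\<^sup>2 * h (t\<^sup>2)) = 2 * \<kappa>' t / radial d \<mu> (t\<^sup>2)"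
    if t: "t > 0" for t
  proof -
    define s where "s = t\<^sup>2"
    have s: "s > 0" "sqrt s = t" using t by (simp_all add: s_def)
    obtain m where m: "n = Suc m" using n by (cases n) auto
    define R where "R = radial d \<mu> s"
    have R: "R \<noteq> 0" using rp[OF s(1)] by (simp add: R_def)
    have G: "g s \<noteq> 0" using g0[OF s(1)] by simp
    have gg: "g' s = g s * (d / s + 2 * r' s / R)"
      using R by (simp add: g'_def g_def R_def field_simps power2_eq_square)
    have gv: "g s = t ^ n * R\<^sup>2" by (simp add: g_def s R_def)
    have pv: "p s = \<kappa> t / g s" using s by (simp add: p_def)
    have pv': "p' s = \<kappa>' t / (2 * t * g s) - p s * (d / s + 2 * r' s / R)"
      using s G t by (simp add: p'_def pv gg divide_simps) (simp add: algebra_simps)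
    have "4 * s * h'' s + 2 * real n * h' s - \<mu>\<^sup>2 * h s
       = \<eta> s * (4 * s * r'' s + 4 * d * r' s - \<mu>\<^sup>2 * R) + 8 * s * r' s * p s + 4 * d * R * p s + 4 * s * R * p' s"
      by (simp add: h_def h'_def h''_def R_def d_def algebra_simps)
    also have "\<dots> = 8 * s * r' s * p s + 4 * d * R * p s + 4 * s * R * p' s"
      using ode[of s] by (simp add: R_def)
    also have "\<dots> = 2 * s * R * \<kappa>' t / (t * g s)"
      using s(1) R t G by (simp add: pv' field_simps)
    finally have e: "4 * s * h'' s + 2 * real n * h' s - \<mu>\<^sup>2 * h s = 2 * s * R * \<kappa>' t / (t * g s)" .
    show ?thesis
      unfolding s_def[symmetric] e gv R_def[symmetric]
      using t R by (simp add: m s_def field_simps power2_eq_square)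
  qed
  have C2: "C2_on U u" and pan: "\<And>y. y \<in> U \<Longrightarrow> laplacian u y = \<mu>\<^sup>2 * u y"
    using u by (auto simp: panharmonic_on_def)
  have "(LINT y:cball x \<rho>|lborel. h ((y - x) \<bullet> (y - x)) * (laplacian u y - \<mu>\<^sup>2 * u y)) = (LINT y:cball x \<rho>|lborel. 0)"
    by (rule set_lebesgue_integral_cong) (use pan \<rho> in auto)
  also have "\<dots> = 0" by simp
  finally have "(\<integral>t. indicator {0<..} t * t ^ (DIM('a) - 1) *
       (4 * t\<^sup>2 * h'' (t\<^sup>2) + 2 * real DIM('a) * h' (t\<^sup>2) - \<mu>\<^sup>2 * h (t\<^sup>2)) * sphere_mean u x t \<partial>lborel) = 0"
    using radial_integral_zero[OF U C2 \<rho> h h' h'', where \<mu> = \<mu>] \<eta>1 n unit_ball_vol_DIM[where 'a='a, THEN less_imp_neq]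
    by (simp add: h_def)
  moreover have "indicator {0<..} t * t ^ (DIM('a) - 1) *
       (4 * t\<^sup>2 * h'' (t\<^sup>2) + 2 * real DIM('a) * h' (t\<^sup>2) - \<mu>\<^sup>2 * h (t\<^sup>2)) * sphere_mean u x t
     = 2 * (indicator {0<..} t * \<kappa>' t * (sphere_mean u x t / radial d \<mu> (t\<^sup>2)))" for t
    using k[of t] by (cases "t > 0") (simp_all add: n_def mult.assoc[symmetric])
  ultimately have "(\<integral>t. 2 * (indicator {0<..} t * \<kappa>' t * (sphere_mean u x t / radial d \<mu> (t\<^sup>2))) \<partial>lborel) = 0"
    by (simp only:)
  then have "2 * (\<integral>t. indicator {0<..} t * \<kappa>' t * (sphere_mean u x t / radial d \<mu> (t\<^sup>2)) \<partial>lborel) = 0"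
    by (simp only: integral_mult_right_zero)
  then show ?thesis by (simp add: d_def n_def)
qed

text \<open>At 0 the difference quotient is at most \<open>max 0 h ^ m\<close>, which tends to 0
  because \<open>m > 0\<close>. Such powers supply all test functions with just the smoothness
  required: squares for the steps, cubes for the bumps.\<close>

lemma has_real_derivative_pos_part_power:
  fixes r :: real
  assumes m: "m > 0"
  shows "((\<lambda>r. max 0 r ^ Suc m) has_real_derivative real (Suc m) * max 0 r ^ m) (at r)"
proof -
  consider "r > 0" | "r < 0" | "r = 0" by linarith
  then show ?thesis
  proof cases
    case 1
    have "((\<lambda>r. r ^ Suc m) has_real_derivative real (Suc m) * max 0 r ^ m) (at r)"
      using DERIV_pow[of "Suc m" r] 1 by simp
    then show ?thesis
      by (rule has_field_derivative_transform_within_open[of _ _ _ "{0<..}"]) (use 1 in auto)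
  next
    case 2
    have "((\<lambda>r. 0) has_real_derivative real (Suc m) * max 0 r ^ m) (at r)"
      using m 2 by (simp add: zero_power)
    then show ?thesis
      by (rule has_field_derivative_transform_within_open[of _ _ _ "{..<0}"]) (use 2 in auto)
  next
    case 3
    have "((\<lambda>h. max 0 h ^ Suc m / h) \<longlongrightarrow> 0) (at (0::real))"
    proof (rule Lim_null_comparison)
      show "\<forall>\<^sub>F h in at (0::real). norm (max 0 h ^ Suc m / h) \<le> max 0 h ^ m"
        by (rule always_eventually) (auto simp: max_def abs_mult)
      have "((\<lambda>h. max 0 h ^ m) \<longlongrightarrow> max 0 0 ^ m) (at (0::real))" by (intro tendsto_intros)
      then show "((\<lambda>h. max 0 h ^ m) \<longlongrightarrow> 0) (at (0::real))"
        by (simp only: max.idem zero_power[OF m])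
    qed
    then show ?thesis using 3 m by (simp add: DERIV_def zero_power)
  qed
qed

lemma integral_pos_on_ball:
  fixes f :: "'a::euclidean_space \<Rightarrow> real"
  assumes f: "integrable lborel f" "\<And>y. 0 \<le> f y" and r: "0 < r" and pos: "\<And>y. y \<in> ball x r \<Longrightarrow> 0 < f y"
  shows "0 < (\<integral>y. f y \<partial>lborel)"
proof (rule ccontr)
  assume "\<not> ?thesis"
  moreover have "0 \<le> (\<integral>y. f y \<partial>lborel)" using f(2) by simp
  ultimately have "(\<integral>y. f y \<partial>lborel) = 0" by linarith
  then have "AE y in lborel. f y = 0"
    using integral_nonneg_eq_0_iff_AE[OF f(1)] f(2) by simp
  then have "AE y in lborel. y \<notin> ball x r"
    by (rule AE_mp) (use pos in \<open>force intro!: AE_I2\<close>)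
  then have "ball x r \<in> null_sets lborel"
    by (subst AE_iff_null_sets) auto
  then have "emeasure lborel (ball x r) = 0" by auto
  then show False using r unit_ball_vol_DIM[where 'a='a, THEN less_imp_neq]
    by (simp add: emeasure_ball)
qed

lemma panharmonic_radial:
  fixes x :: "'a::euclidean_space"
  shows "panharmonic_on \<mu> UNIV (\<lambda>y. radial (real DIM('a) / 2) \<mu> ((y - x) \<bullet> (y - x)))"
proof -
  obtain r' r'' where r: "\<And>s. (radial (real DIM('a) / 2) \<mu> has_real_derivative r' s) (at s)"
    "\<And>s. (r' has_real_derivative r'' s) (at s)" "continuous_on UNIV r''"
    and ode: "\<And>s. 4 * s * r'' s + 4 * (real DIM('a) / 2) * r' s = \<mu>\<^sup>2 * radial (real DIM('a) / 2) \<mu> s"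
    using radial_ode[of "real DIM('a) / 2" \<mu>] by auto
  show ?thesis
    unfolding panharmonic_on_def using C2_on_radial[OF r, of x] ode by simp
qed

text \<open>If \<open>q b < q a\<close>, let \<open>m\<close> lie between and let
  \<open>\<kappa>'\<close> be a tent at \<open>a\<close> minus a tent at \<open>b\<close>, so narrow
  that \<open>q > m\<close> on the first and \<open>q < m\<close> on the second. Then
  \<open>\<kappa>' * (q - m)\<close> is nonnegative and positive near \<open>a\<close>, whereas the
  weak identity makes its integral 0. Since \<open>a\<close> and \<open>b\<close> may be exchanged,
  the quotient is constant.\<close>

lemma sphere_mean_quotient_le:
  fixes u :: "'a::euclidean_space \<Rightarrow> real"
  assumes U: "open U" and u: "panharmonic_on \<mu> U u" and \<rho>: "cball x \<rho> \<subseteq> U"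
    and a: "0 < a" "a < \<rho>" and b: "0 < b" "b < \<rho>"
  defines "q \<equiv> \<lambda>t. sphere_mean u x t / radial (real DIM('a) / 2) \<mu> (t\<^sup>2)"
  shows "q a \<le> q b"
proof (rule ccontr)
  assume "\<not> q a \<le> q b"
  then have ab: "q b < q a" by simp
  define d where "d = real DIM('a) / 2"
  have d: "d > 0" by (simp add: d_def)
  have R: "radial d \<mu> (t\<^sup>2) > 0" for t by (rule radial_pos[OF d]) simp
  have cr: "continuous_on S (radial d \<mu>)" for S
    using radial_ode[OF d, of \<mu>] by (metis DERIV_continuous continuous_at_imp_continuous_on)
  have cu: "continuous_on (cball x \<rho>) u"
    using u C2_on_continuous(1) \<rho> continuous_on_subset by (metis panharmonic_on_def)
  have cq: "continuous_on {0..\<rho>} q"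
    unfolding q_def d_def[symmetric]
    by (intro continuous_intros continuous_on_sphere_mean cu continuous_on_compose2[OF cr[of UNIV]])
       (use R in \<open>auto dest: less_imp_neq[symmetric]\<close>)
  define m where "m = (q a + q b) / 2"
  have m: "q b < m" "m < q a" using ab by (simp_all add: m_def)
  have op: "open {0<..<\<rho>}" "a \<in> {0<..<\<rho>}" "b \<in> {0<..<\<rho>}" using a b by auto
  have cq': "continuous (at t) q" if "t \<in> {0<..<\<rho>}" for t
    by (rule continuous_on_interior[OF cq]) (use that in auto)
  have "\<forall>\<^sub>F t in nhds a. m < q t \<and> t \<in> {0<..<\<rho>}"
    using order_tendstoD(1)[OF cq'[OF op(2), unfolded isCont_def, unfolded tendsto_at_iff_tendsto_nhds] m(2)]
      eventually_nhds_in_open[OF op(1,2)] by (rule eventually_conj)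
  then obtain d1 where d1: "d1 > 0" "\<And>t. \<bar>t - a\<bar> < d1 \<Longrightarrow> m < q t \<and> t \<in> {0<..<\<rho>}"
    unfolding eventually_nhds_metric dist_real_def by blast
  have "\<forall>\<^sub>F t in nhds b. q t < m \<and> t \<in> {0<..<\<rho>}"
    using order_tendstoD(2)[OF cq'[OF op(3), unfolded isCont_def, unfolded tendsto_at_iff_tendsto_nhds] m(1)]
      eventually_nhds_in_open[OF op(1,3)] by (rule eventually_conj)
  then obtain d2 where d2: "d2 > 0" "\<And>t. \<bar>t - b\<bar> < d2 \<Longrightarrow> q t < m \<and> t \<in> {0<..<\<rho>}"
    unfolding eventually_nhds_metric dist_real_def by blast
  define \<delta> where "\<delta> = min d1 d2 / 2"
  have \<delta>: "0 < \<delta>" "\<delta> < d1" "\<delta> < d2" using d1 d2 by (auto simp: \<delta>_def)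
  have near: "m < q t \<and> 0 < t \<and> t < \<rho>" if "\<bar>t - a\<bar> \<le> \<delta>" for t using d1(2)[of t] that \<delta> by auto
  have near': "q t < m \<and> 0 < t \<and> t < \<rho>" if "\<bar>t - b\<bar> \<le> \<delta>" for t using d2(2)[of t] that \<delta> by auto
  define \<alpha> \<beta> where "\<alpha> = min a b - \<delta>" and "\<beta> = max a b + \<delta>"
  have \<alpha>\<beta>: "0 < \<alpha>" "\<beta> < \<rho>" "\<alpha> \<le> a - \<delta>" "\<alpha> \<le> b - \<delta>" "a + \<delta> \<le> \<beta>" "b + \<delta> \<le> \<beta>"
    using near[of "a - \<delta>"] near'[of "b - \<delta>"] near[of "a + \<delta>"] near'[of "b + \<delta>"] \<delta>
    by (auto simp: \<alpha>_def \<beta>_def)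
  \<comment> \<open>Second differences: of the squared positive part, giving a C1 step from 0 up to
    \<open>2 * \<delta>\<^sup>2\<close>, and of twice the positive part, giving its derivative, a
    tent supported in \<open>{- \<delta>..\<delta>}\<close>. Subtracting two translated steps
    cancels the plateau, so \<open>\<kappa>\<close> has compact support.\<close>
  define step where "step r = max 0 (r + \<delta>) ^ 2 - 2 * max 0 r ^ 2 + max 0 (r - \<delta>) ^ 2" for r :: real
  define tent where "tent r = 2 * (max 0 (r + \<delta>) - 2 * max 0 r + max 0 (r - \<delta>))" for r :: real
  have dstep: "(step has_real_derivative tent r) (at r)" for r
  proof -
    have P: "((\<lambda>r. max 0 (r + c) ^ 2) has_real_derivative 2 * max 0 (r + c)) (at r)" for c
      using has_real_derivative_pos_part_power[of 1 "r + c"]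
        DERIV_shift[of "\<lambda>r. max 0 r ^ 2" "2 * max 0 (r + c)" r c] by (simp add: numeral_2_eq_2)
    show ?thesis
      using DERIV_add[OF DERIV_diff[OF P[of \<delta>] DERIV_cmult[OF P[of 0], of 2]] P[of "- \<delta>"]]
      unfolding step_def[abs_def] tent_def by (simp add: algebra_simps)
  qed
  have step_lo: "step r = 0" if "r \<le> - \<delta>" for r
    using that \<delta> by (simp add: step_def max_absorb1)
  have step_hi: "step r = 2 * \<delta>\<^sup>2" if "\<delta> \<le> r" for r
    using that \<delta> by (simp add: step_def max_absorb2 power2_eq_square algebra_simps)
  have tent0: "0 \<le> tent r" "\<bar>r\<bar> \<ge> \<delta> \<Longrightarrow> tent r = 0" "\<bar>r\<bar> < \<delta> \<Longrightarrow> tent r > 0" for r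
    using \<delta> by (auto simp: tent_def max_def)
  define \<kappa> where "\<kappa> r = step (r - a) - step (r - b)" for r
  define \<kappa>' where "\<kappa>' r = tent (r - a) - tent (r - b)" for r
  have \<kappa>: "(\<kappa> has_real_derivative \<kappa>' r) (at r)" for r
  proof -
    have P: "((\<lambda>r. step (r + c)) has_real_derivative tent (r + c)) (at r)" for c
      using dstep[of "r + c"] DERIV_shift[of step "tent (r + c)" r c] by simp
    show ?thesis
      using DERIV_diff[OF P[of "- a"] P[of "- b"]] unfolding \<kappa>_def[abs_def] \<kappa>'_def by simp
  qed
  have c\<kappa>': "continuous_on S \<kappa>'" for S
    unfolding \<kappa>'_def[abs_def] tent_def[abs_def] by (intro continuous_intros)
  have lo: "\<kappa> r = 0" if "r < \<alpha>" for r
    using that \<alpha>\<beta> by (simp add: \<kappa>_def step_lo)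
  have hi: "\<kappa> r = 0" if "\<rho> < r" for r
    using that \<alpha>\<beta> by (simp add: \<kappa>_def step_hi)
  have \<kappa>'0: "\<kappa>' t = 0" if "t \<notin> {\<alpha>..\<beta>}" for t
    using that \<alpha>\<beta> tent0(2)[of "t - a"] tent0(2)[of "t - b"] by (auto simp: \<kappa>'_def)
  have ind: "indicator {0<..} t * \<kappa>' t = \<kappa>' t" for t
    using \<kappa>'0[of t] \<alpha>\<beta> by (cases "t > 0") auto
  have "0 < \<rho>" using a by simp
  note weak = panharmonic_weak[OF _ _ this _ \<kappa> c\<kappa>' \<alpha>\<beta>(1) lo hi, folded d_def]
  have 1: "(\<integral>t. \<kappa>' t * q t \<partial>lborel) = 0"
    using weak[OF U u \<rho>] by (simp add: ind q_def d_def)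
  \<comment> \<open>The weak identity for the radial panharmonic function itself, whose quotient is
    1, yields that \<open>\<kappa>'\<close> has integral 0; this allows the constant
    \<open>m\<close> to be subtracted from \<open>q\<close>.\<close>
  have pan: "panharmonic_on \<mu> UNIV (\<lambda>y. radial d \<mu> ((y - x) \<bullet> (y - x)))"
    unfolding d_def by (rule panharmonic_radial)
  have "(\<integral>t. indicator {0<..} t * \<kappa>' t * (sphere_mean (\<lambda>y. radial d \<mu> ((y - x) \<bullet> (y - x))) x t / radial d \<mu> (t\<^sup>2)) \<partial>lborel) = 0"
    using weak[OF _ pan] by (simp add: d_def)
  moreover have "indicator {0<..} t * \<kappa>' t * (sphere_mean (\<lambda>y. radial d \<mu> ((y - x) \<bullet> (y - x))) x t / radial d \<mu> (t\<^sup>2)) = \<kappa>' t" for t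
    using R[of t] ind[of t] sphere_mean_radial[of t "radial d \<mu>" x] by (cases "t > 0") auto
  ultimately have 2: "(\<integral>t. \<kappa>' t \<partial>lborel) = 0" by simp
  have sub: "{\<alpha>..\<beta>} \<subseteq> {0..\<rho>}" using \<alpha>\<beta> by auto
  have i: "integrable lborel (\<lambda>t. \<kappa>' t * w t)" if w: "continuous_on {\<alpha>..\<beta>} w" for w
  proof -
    have "set_integrable lborel {\<alpha>..\<beta>} (\<lambda>t. \<kappa>' t * w t)"
      by (intro set_integrable_compact continuous_intros c\<kappa>' w) simp
    moreover have "(\<lambda>t. indicator {\<alpha>..\<beta>} t *\<^sub>R (\<kappa>' t * w t)) = (\<lambda>t. \<kappa>' t * w t)"
      using \<kappa>'0 by (auto simp: fun_eq_iff indicator_def)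
    ultimately show ?thesis by (simp add: set_integrable_def)
  qed
  have i1: "integrable lborel (\<lambda>t. \<kappa>' t * q t)" and i2: "integrable lborel (\<lambda>t. \<kappa>' t * m)"
    by (rule i[OF continuous_on_subset[OF cq sub]], rule i[OF continuous_on_const])
  have 3: "(\<integral>t. \<kappa>' t * (q t - m) \<partial>lborel) = 0"
    using Bochner_Integration.integral_diff[OF i1 i2] 1 2 by (simp add: algebra_simps)
  have i3: "integrable lborel (\<lambda>t. \<kappa>' t * (q t - m))"
    using Bochner_Integration.integrable_diff[OF i1 i2] by (simp add: algebra_simps)
  have nonneg: "0 \<le> \<kappa>' t * (q t - m)" for t
  proof -
    have "0 \<le> tent (t - a) * (q t - m)"
      using tent0(1,2)[of "t - a"] near[of t] by (cases "\<bar>t - a\<bar> \<le> \<delta>") auto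
    moreover have "tent (t - b) * (q t - m) \<le> 0"
      using tent0(1,2)[of "t - b"] near'[of t] by (cases "\<bar>t - b\<bar> \<le> \<delta>") (auto intro: mult_nonneg_nonpos)
    ultimately show ?thesis by (simp add: \<kappa>'_def left_diff_distrib)
  qed
  have pos: "0 < \<kappa>' t * (q t - m)" if t: "t \<in> {a - \<delta><..<a + \<delta>}" for t
  proof -
    have "0 < tent (t - a) * (q t - m)"
      using tent0(3)[of "t - a"] near[of t] t by (auto simp: abs_if)
    moreover have "tent (t - b) * (q t - m) \<le> 0"
      using tent0(1,2)[of "t - b"] near'[of t] by (cases "\<bar>t - b\<bar> \<le> \<delta>") (auto intro: mult_nonneg_nonpos)
    ultimately show ?thesis by (simp add: \<kappa>'_def left_diff_distrib)
  qed
  have "(\<integral>t. \<kappa>' t * (q t - m) \<partial>lborel) > 0"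
    by (rule integral_pos_on_ball[OF i3 nonneg \<delta>(1), of a]) (use pos in \<open>auto simp: ball_eq_greaterThanLessThan\<close>)
  then show False using 3 by simp
qed

text \<open>The quotient of means is constant on positive radii below \<open>\<rho>\<close>, and its
  continuity at radius 0 identifies the constant as \<open>u x\<close>. The radius
  \<open>\<rho>\<close> lies strictly between \<open>r\<close> and \<open>R\<close>, so that
  \<open>r\<close> is interior to the range and the closed ball stays in the domain.\<close>

lemma sphere_mean_panharmonic:
  fixes u :: "'a::euclidean_space \<Rightarrow> real"
  assumes u: "panharmonic_on \<mu> (ball x R) u" and r: "0 \<le> r" "r < R"
  shows "sphere_mean u x r = u x * radial (real DIM('a) / 2) \<mu> (r\<^sup>2)"
proof (cases "r = 0")
  case True then show ?thesis by (simp add: sphere_mean_0 radial_0)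
next
  case False
  with r have r0: "0 < r" by simp
  define d where "d = real DIM('a) / 2"
  have d: "d > 0" by (simp add: d_def)
  have Rp: "radial d \<mu> (t\<^sup>2) > 0" for t by (rule radial_pos[OF d]) simp
  define q where "q t = sphere_mean u x t / radial d \<mu> (t\<^sup>2)" for t
  define \<rho> where "\<rho> = (r + R) / 2"
  have \<rho>: "r < \<rho>" "0 < \<rho>" "cball x \<rho> \<subseteq> ball x R" using r r0 by (auto simp: \<rho>_def)
  have cr: "continuous_on S (radial d \<mu>)" for S
    using radial_ode[OF d, of \<mu>] by (metis DERIV_continuous continuous_at_imp_continuous_on)
  have cu: "continuous_on (cball x \<rho>) u"
    using u C2_on_continuous(1) \<rho> continuous_on_subset by (metis panharmonic_on_def)
  have cq: "continuous_on {0..\<rho>} q"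
    unfolding q_def
    by (intro continuous_intros continuous_on_sphere_mean cu continuous_on_compose2[OF cr[of UNIV]])
       (use Rp in \<open>auto dest: less_imp_neq[symmetric]\<close>)
  have eq: "q t = q r" if "0 < t" "t < \<rho>" for t
    using sphere_mean_quotient_le[OF open_ball u \<rho>(3) that r0 \<rho>(1)]
      sphere_mean_quotient_le[OF open_ball u \<rho>(3) r0 \<rho>(1) that] by (simp add: q_def d_def)
  \<comment> \<open>The denominators start at 2, which keeps every \<open>t n\<close> strictly below
    \<open>\<rho>\<close>.\<close>
  define t where "t n = \<rho> / real (Suc (Suc n))" for n
  have t: "0 < t n" "t n < \<rho>" for n using \<rho> by (auto simp: t_def field_simps add_pos_nonneg)
  have "t \<longlonglongrightarrow> 0" unfolding t_def
    using LIMSEQ_Suc[OF LIMSEQ_Suc[OF lim_const_over_n[of \<rho>]]] by simp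
  then have "(\<lambda>n. q (t n)) \<longlonglongrightarrow> q 0"
    using t \<rho> by (intro continuous_on_tendsto_compose[OF cq]) (auto intro!: always_eventually less_imp_le)
  then have "q 0 = q r" using eq[OF t] by (simp add: LIMSEQ_const_iff)
  then show ?thesis using Rp[of r] by (simp add: q_def sphere_mean_0 radial_0 field_simps flip: d_def)
qed

text \<open>Continuity of the mean carries the identity from smaller radii to \<open>R\<close>. This
  is the form fitting a panharmonic measure, whose test functions are only continuous up to the
  bounding sphere.\<close>

lemma sphere_mean_panharmonic_cball:
  fixes u :: "'a::euclidean_space \<Rightarrow> real"
  assumes u: "panharmonic_on \<mu> (ball x R) u" and R: "0 < R" and cu: "continuous_on (cball x R) u"
  shows "sphere_mean u x R = u x * radial (real DIM('a) / 2) \<mu> (R\<^sup>2)"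
proof -
  define d where "d = real DIM('a) / 2"
  have d: "d > 0" by (simp add: d_def)
  have cr: "continuous_on S (radial d \<mu>)" for S
    using radial_ode[OF d, of \<mu>] by (metis DERIV_continuous continuous_at_imp_continuous_on)
  define F where "F t = sphere_mean u x t - u x * radial d \<mu> (t\<^sup>2)" for t
  have cF: "continuous_on {0..R} F"
    unfolding F_def by (intro continuous_intros continuous_on_sphere_mean cu continuous_on_compose2[OF cr[of UNIV]]) auto
  have F0: "F t = 0" if "0 \<le> t" "t < R" for t
    using sphere_mean_panharmonic[OF u that] by (simp add: F_def d_def)
  have "(\<lambda>n. F (R - R / real (Suc n))) \<longlonglongrightarrow> F R"
  proof (rule continuous_on_tendsto_compose[OF cF])
    have "(\<lambda>n. R - R / real (Suc n)) \<longlonglongrightarrow> R - 0"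
      by (intro tendsto_diff tendsto_const LIMSEQ_Suc[OF lim_const_over_n])
    then show "(\<lambda>n. R - R / real (Suc n)) \<longlonglongrightarrow> R" by simp
  qed (use R in \<open>auto intro!: always_eventually simp: field_simps\<close>)
  moreover have "F (R - R / real (Suc n)) = 0" for n
    by (rule F0) (use R in \<open>auto simp: field_simps\<close>)
  ultimately have "F R = 0" by (simp add: LIMSEQ_const_iff)
  then show ?thesis by (simp add: F_def d_def)
qed

subsection \<open>Functions with the average property are panharmonic\<close>

lemma bounded_range_compact_support:
  fixes f :: "'a::euclidean_space \<Rightarrow> 'b::real_normed_vector"
  assumes "continuous_on UNIV f" "compact K" "\<And>z. z \<notin> K \<Longrightarrow> f z = 0"
  shows "bounded (range f)"
proof -
  have "bounded (f ` K)"
    using assms(1,2) by (meson compact_continuous_image compact_imp_bounded continuous_on_subset top_greatest)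
  then have "bounded (insert 0 (f ` K))" by simp
  then show ?thesis by (rule bounded_subset) (use assms(3) in auto)
qed

lemma integrable_mult_bounded:
  fixes U :: "'a::euclidean_space \<Rightarrow> real" and k :: "'a \<Rightarrow> 'b::euclidean_space"
  assumes U: "integrable lborel U" and k: "k \<in> borel_measurable borel" "bounded (range k)"
  shows "integrable lborel (\<lambda>y. U y *\<^sub>R k y)"
proof -
  obtain B where B: "\<And>z. norm (k z) \<le> B" using k(2) unfolding bounded_iff by auto
  have "norm (U y *\<^sub>R k y) \<le> norm (\<bar>U y\<bar> * B)" for y
    using mult_left_mono[OF order_trans[OF B abs_ge_self], of "\<bar>U y\<bar>" y] by (simp add: abs_mult)
  moreover have "integrable lborel (\<lambda>y. \<bar>U y\<bar> * B)" using U by simp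
  moreover have "(\<lambda>y. U y *\<^sub>R k y) \<in> borel_measurable lborel"
    using borel_measurable_integrable[OF U] k(1) by measurable
  ultimately show ?thesis
    by (auto intro: Bochner_Integration.integrable_bound[of lborel "\<lambda>y. \<bar>U y\<bar> * B"])
qed

lemma continuous_on_convolution:
  fixes U :: "'a::euclidean_space \<Rightarrow> real" and k :: "'a \<Rightarrow> 'b::euclidean_space"
  assumes U: "integrable lborel U" and k: "continuous_on UNIV k" "bounded (range k)"
  shows "continuous_on UNIV (\<lambda>x. \<integral>y. U y *\<^sub>R k (x - y) \<partial>lborel)"
proof (rule continuous_on_sequentiallyI)
  obtain B where B: "\<And>z. norm (k z) \<le> B" using k(2) unfolding bounded_iff by auto
  have [measurable]: "U \<in> borel_measurable borel" using borel_measurable_integrable[OF U] by simp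
  have [measurable]: "k \<in> borel_measurable borel" using k(1) by (rule borel_measurable_continuous_onI)
  fix X :: "nat \<Rightarrow> 'a" and x assume X: "X \<longlonglongrightarrow> x"
  show "(\<lambda>n. \<integral>y. U y *\<^sub>R k (X n - y) \<partial>lborel) \<longlonglongrightarrow> (\<integral>y. U y *\<^sub>R k (x - y) \<partial>lborel)"
  proof (rule integral_dominated_convergence[where w = "\<lambda>y. \<bar>U y\<bar> * B"])
    show "integrable lborel (\<lambda>y. \<bar>U y\<bar> * B)" using U by simp
    show "AE y in lborel. (\<lambda>n. U y *\<^sub>R k (X n - y)) \<longlonglongrightarrow> U y *\<^sub>R k (x - y)"
      by (intro AE_I2 tendsto_scaleR tendsto_const continuous_on_tendsto_compose[OF k(1)] tendsto_diff X) auto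
    show "AE y in lborel. norm (U y *\<^sub>R k (X n - y)) \<le> \<bar>U y\<bar> * B" for n
      by (intro AE_I2) (simp add: B mult_left_mono)
  qed measurable
qed

text \<open>All derivatives fall on the kernel. A bounded gradient makes \<open>k\<close> Lipschitz,
  so the remainder quotient \<open>R v z\<close> is bounded by \<open>2 * B\<close>; it tends to 0
  pointwise, and \<open>2 * B\<close> times the absolute value of \<open>U\<close> is an integrable
  majorant.\<close>

lemma has_derivative_convolution:
  fixes U k :: "'a::euclidean_space \<Rightarrow> real" and Dk :: "'a \<Rightarrow> 'a"
  assumes U: "integrable lborel U"
    and k: "\<And>z. (k has_derivative (\<lambda>v. v \<bullet> Dk z)) (at z)" "bounded (range k)"
    and Dk: "continuous_on UNIV Dk" "bounded (range Dk)"
  shows "((\<lambda>x. \<integral>y. U y * k (x - y) \<partial>lborel) has_derivative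
      (\<lambda>v. v \<bullet> (\<integral>y. U y *\<^sub>R Dk (x - y) \<partial>lborel))) (at x)"
proof -
  obtain B where B: "\<And>z. norm (Dk z) \<le> B" using Dk(2) unfolding bounded_iff by auto
  have B0: "0 \<le> B" using order_trans[OF norm_ge_zero B[of 0]] .
  have ck: "continuous_on UNIV k"
    using k(1) by (meson continuous_at_imp_continuous_on has_derivative_continuous)
  have [measurable]: "U \<in> borel_measurable borel" using borel_measurable_integrable[OF U] by simp
  have [measurable]: "k \<in> borel_measurable borel" "Dk \<in> borel_measurable borel"
    using ck Dk(1) by (auto intro: borel_measurable_continuous_onI)
  have ran: "bounded (range (\<lambda>y. k (x - y)))" "bounded (range (\<lambda>y. Dk (x - y)))" for x
    by (rule bounded_subset[OF k(2)] bounded_subset[OF Dk(2)], auto)+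
  have i1: "integrable lborel (\<lambda>y. U y * k (x - y))" for x
    using integrable_mult_bounded[OF U _ ran(1)[of x]] by simp
  have i2: "integrable lborel (\<lambda>y. U y *\<^sub>R Dk (x - y))" for x
    using integrable_mult_bounded[OF U _ ran(2)[of x]] by simp
  define F where "F x = (\<integral>y. U y * k (x - y) \<partial>lborel)" for x
  define G where "G = (\<integral>y. U y *\<^sub>R Dk (x - y) \<partial>lborel)"
  define R where "R v z = (k (z + v) - k z - v \<bullet> Dk z) / norm v" for v z
  have lip: "\<bar>k (z + v) - k z\<bar> \<le> B * norm v" for z v
  proof -
    have "onorm (\<lambda>v. v \<bullet> Dk z) \<le> B" for z
    proof (rule onorm_bound[OF B0])
      fix v show "norm (v \<bullet> Dk z) \<le> B * norm v"
        using order_trans[OF Cauchy_Schwarz_ineq2 mult_left_mono[OF B norm_ge_zero]]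
        by (simp add: mult.commute)
    qed
    then show ?thesis
      using differentiable_bound[of UNIV k "\<lambda>z v. v \<bullet> Dk z" B "z + v" z] k(1) by auto
  qed
  have Rb: "\<bar>R v z\<bar> \<le> 2 * B" for v z
  proof (cases "v = 0")
    case False
    have "\<bar>v \<bullet> Dk z\<bar> \<le> norm v * norm (Dk z)" by (rule Cauchy_Schwarz_ineq2)
    also have "\<dots> \<le> B * norm v" using mult_left_mono[OF B norm_ge_zero] by (simp add: mult.commute)
    finally have "\<bar>k (z + v) - k z - v \<bullet> Dk z\<bar> \<le> 2 * B * norm v"
      using lip[of z v] by linarith
    then show ?thesis using False by (simp add: R_def pos_divide_le_eq)
  qed (use B0 in \<open>simp add: R_def\<close>)
  have diff: "(F (x + v) - F x - v \<bullet> G) / norm v = (\<integral>y. U y * R v (x - y) \<partial>lborel)" for v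
  proof -
    have i3: "integrable lborel (\<lambda>y. U y * (v \<bullet> Dk (x - y)))"
      and e3: "v \<bullet> G = (\<integral>y. U y * (v \<bullet> Dk (x - y)) \<partial>lborel)"
      using integrable_inner_right[of v, OF i2[of x]] integral_inner_right[of v, OF i2[of x]]
      by (auto simp: G_def)
    have "(\<integral>y. U y * R v (x - y) \<partial>lborel)
      = (\<integral>y. (U y * k (x + v - y) - U y * k (x - y) - U y * (v \<bullet> Dk (x - y))) / norm v \<partial>lborel)"
      by (simp add: R_def algebra_simps)
    also have "\<dots> = (F (x + v) - F x - v \<bullet> G) / norm v"
      unfolding F_def e3 using i1 i3 by simp
    finally show ?thesis ..
  qed
  have "((\<lambda>v. \<integral>y. U y * R v (x - y) \<partial>lborel) \<longlongrightarrow> 0) (at 0)"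
    unfolding tendsto_at_iff_sequentially
  proof (intro allI impI)
    fix X :: "nat \<Rightarrow> 'a" assume X0: "\<forall>i. X i \<in> UNIV - {0}" and X: "X \<longlonglongrightarrow> 0"
    have "(\<lambda>i. \<integral>y. U y * R (X i) (x - y) \<partial>lborel) \<longlonglongrightarrow> (\<integral>y. 0 \<partial>(lborel :: 'a measure))"
    proof (rule integral_dominated_convergence[where w = "\<lambda>y. \<bar>U y\<bar> * (2 * B)" and f = "\<lambda>_. 0"])
      show "integrable lborel (\<lambda>y. \<bar>U y\<bar> * (2 * B))" using U by simp
      show "AE y in lborel. norm (U y * R (X n) (x - y)) \<le> \<bar>U y\<bar> * (2 * B)" for n
        by (intro AE_I2) (simp add: abs_mult mult_left_mono Rb del: mult_le_cancel_left)
      show "(\<lambda>y. U y * R (X n) (x - y)) \<in> borel_measurable lborel" for n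
        unfolding R_def by measurable
      show "AE y in lborel. (\<lambda>n. U y * R (X n) (x - y)) \<longlonglongrightarrow> 0"
      proof (rule AE_I2)
        fix y
        have "((\<lambda>v. norm (k (x - y + v) - k (x - y) - v \<bullet> Dk (x - y)) / norm v) \<longlongrightarrow> 0) (at 0)"
          using k(1)[of "x - y"] unfolding has_derivative_at by blast
        then have "((\<lambda>v. norm (R v (x - y))) \<longlongrightarrow> 0) (at 0)"
          by (simp add: R_def)
        then have "((\<lambda>v. R v (x - y)) \<longlongrightarrow> 0) (at 0)"
          by (rule tendsto_norm_zero_cancel)
        moreover have "filterlim X (at 0) sequentially"
          using X X0 by (auto simp: filterlim_at intro!: always_eventually)
        ultimately have "(\<lambda>n. R (X n) (x - y)) \<longlonglongrightarrow> 0" by (rule filterlim_compose)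
        then show "(\<lambda>n. U y * R (X n) (x - y)) \<longlonglongrightarrow> 0" by (rule tendsto_mult_right_zero)
      qed
    qed simp
    then show "((\<lambda>v. \<integral>y. U y * R v (x - y) \<partial>lborel) \<circ> X) \<longlonglongrightarrow> 0" by (simp add: o_def)
  qed
  then have "((\<lambda>v. (F (x + v) - F x - v \<bullet> G) / norm v) \<longlongrightarrow> 0) (at 0)" by (simp only: diff)
  then have "((\<lambda>v. norm (F (x + v) - F x - v \<bullet> G) / norm v) \<longlongrightarrow> 0) (at 0)"
    using tendsto_norm_zero[of "\<lambda>v. (F (x + v) - F x - v \<bullet> G) / norm v"] by simp
  then have "(F has_derivative (\<lambda>v. v \<bullet> G)) (at x)"
    unfolding has_derivative_at by (simp add: bounded_linear_inner_left)
  then show ?thesis by (simp only: F_def[abs_def] G_def)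
qed

section \<open>Radial bumps and averages over balls\<close>

lemma C2_on_local:
  fixes u :: "'a::euclidean_space \<Rightarrow> real"
  assumes D: "open D" and loc: "\<And>x. x \<in> D \<Longrightarrow> \<exists>V. open V \<and> x \<in> V \<and> C2_on V u"
  shows "C2_on D u"
  unfolding C2_on_def
proof (intro conjI ballI)
  have at: "u differentiable (at x)" "e \<in> Basis \<Longrightarrow> partial_deriv e u differentiable (at x)"
    "e \<in> Basis \<Longrightarrow> e' \<in> Basis \<Longrightarrow> continuous (at x) (partial_deriv e' (partial_deriv e u))"
    if xD: "x \<in> D" for x e e'
  proof -
    obtain V where V: "open V" "x \<in> V" and u: "C2_on V u" using loc[OF xD] by blast
    show "u differentiable (at x)" "e \<in> Basis \<Longrightarrow> partial_deriv e u differentiable (at x)"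
      "e \<in> Basis \<Longrightarrow> e' \<in> Basis \<Longrightarrow> continuous (at x) (partial_deriv e' (partial_deriv e u))"
      using u V unfolding C2_on_def
      by (auto simp: differentiable_on_eq_differentiable_at continuous_on_eq_continuous_at)
  qed
  show "u differentiable_on D"
    using at(1) D by (simp add: differentiable_on_eq_differentiable_at)
  fix e :: 'a assume e: "e \<in> Basis"
  show "partial_deriv e u differentiable_on D"
    using at(2)[OF _ e] D by (simp add: differentiable_on_eq_differentiable_at)
  fix e' :: 'a assume e': "e' \<in> Basis"
  show "continuous_on D (partial_deriv e' (partial_deriv e u))"
    using at(3)[OF _ e e'] D by (simp add: continuous_on_eq_continuous_at)
qed

text \<open>The cube is the lowest integer power of the positive part that is twice continuously
  differentiable, which is what Green's identity asks of a test function.\<close>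

definition bump :: "real \<Rightarrow> real \<Rightarrow> real" where "bump \<rho> s = max 0 (\<rho>\<^sup>2 - s) ^ 3"

lemma bump_derivs:
  "(bump \<rho> has_real_derivative - 3 * max 0 (\<rho>\<^sup>2 - s) ^ 2) (at s)"
  "((\<lambda>s. - 3 * max 0 (\<rho>\<^sup>2 - s) ^ 2) has_real_derivative 6 * max 0 (\<rho>\<^sup>2 - s)) (at s)"
  "continuous_on UNIV (\<lambda>s. 6 * max 0 (\<rho>\<^sup>2 - s))"
proof -
  have d: "((\<lambda>s. \<rho>\<^sup>2 - s) has_real_derivative - 1) (at s)" by (auto intro!: derivative_eq_intros)
  have P: "((\<lambda>s. max 0 (\<rho>\<^sup>2 - s) ^ Suc m) has_real_derivative - (real (Suc m) * max 0 (\<rho>\<^sup>2 - s) ^ m)) (at s)"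
    if "m > 0" for m
    using DERIV_chain2[OF has_real_derivative_pos_part_power[OF that] d] by simp
  show "(bump \<rho> has_real_derivative - 3 * max 0 (\<rho>\<^sup>2 - s) ^ 2) (at s)"
    using P[of 2] unfolding bump_def[abs_def] by (simp add: numeral_3_eq_3)
  show "((\<lambda>s. - 3 * max 0 (\<rho>\<^sup>2 - s) ^ 2) has_real_derivative 6 * max 0 (\<rho>\<^sup>2 - s)) (at s)"
    using DERIV_cmult[OF P[of 1], of "- 3"] by (simp add: numeral_2_eq_2)
  show "continuous_on UNIV (\<lambda>s. 6 * max 0 (\<rho>\<^sup>2 - s))" by (intro continuous_intros)
qed

lemma bump_zero: "\<rho>\<^sup>2 \<le> s \<Longrightarrow> bump \<rho> s = 0" and bump_nonneg: "0 \<le> bump \<rho> s"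
  and bump_pos: "s < \<rho>\<^sup>2 \<Longrightarrow> 0 < bump \<rho> s"
  by (simp_all add: bump_def max_def)

lemma continuous_on_radial: "d > 0 \<Longrightarrow> continuous_on S (radial d \<mu>)"
  using radial_ode[of d \<mu>] by (metis DERIV_continuous continuous_at_imp_continuous_on)

lemma continuous_on_dot_comp:
  fixes x :: "'a::euclidean_space" and k :: "real \<Rightarrow> real"
  assumes "continuous_on UNIV k"
  shows "continuous_on S (\<lambda>y. k ((y - x) \<bullet> (y - x)))"
  by (rule continuous_on_compose2[OF assms]) (auto intro!: continuous_intros)

lemma dot_gt_outside_cball:
  fixes x :: "'a::euclidean_space"
  shows "0 < \<rho> \<Longrightarrow> y \<notin> cball x \<rho> \<Longrightarrow> \<rho>\<^sup>2 < (y - x) \<bullet> (y - x)"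
  by (simp add: dot_square_norm dist_norm norm_minus_commute power_strict_mono)

lemma sphere_mean_average_property:
  fixes u :: "'a::euclidean_space \<Rightarrow> real"
  assumes u: "has_average_property \<mu> D u" and "\<mu> > 0" and r: "0 < r" "cball x r \<subseteq> D"
  shows "sphere_mean u x r = u x * radial (real DIM('a) / 2) \<mu> (r\<^sup>2)"
proof -
  have i: "set_integrable (sphere_uniform x r) (sphere x r) u"
    and e: "u x = psi DIM('a) (\<mu> * r) * (LINT y:sphere x r|sphere_uniform x r. u y)"
    using u r unfolding has_average_property_def by auto
  have "(\<lambda>y. indicator (sphere x r) y * u y) \<in> borel_measurable (sphere_uniform x r)"
    using borel_measurable_integrable[OF i[unfolded set_integrable_def]] by simp
  then have "(\<lambda>y. indicator (sphere x r) y * u y) \<in> borel_measurable borel"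
    by (simp cong: measurable_cong_sets)
  from set_integral_sphere_uniform[OF r(1) this] e
  have "u x = psi DIM('a) (\<mu> * r) * sphere_mean u x r" by simp
  moreover have "radial (real DIM('a) / 2) \<mu> (r\<^sup>2) > 0" by (rule radial_pos) auto
  ultimately show ?thesis using \<open>\<mu> > 0\<close> r by (simp add: psi_eq)
qed

text \<open>The average property is integrated over the radius with weight \<open>k\<close>: each
  sphere contributes \<open>u x\<close> times a factor independent of \<open>u\<close> and
  \<open>x\<close>. The convolution of \<open>u\<close> with a radial kernel is therefore the same
  multiple of \<open>u\<close> at every centre.\<close>

lemma integral_mean_value_radial:
  fixes u :: "'a::euclidean_space \<Rightarrow> real"
  assumes \<rho>: "0 < \<rho>" and u: "set_integrable lborel (cball x \<rho>) u"
    and mv: "\<And>t. 0 < t \<Longrightarrow> t \<le> \<rho> \<Longrightarrow> sphere_mean u x t = u x * radial (real DIM('a) / 2) \<mu> (t\<^sup>2)"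
    and k: "continuous_on UNIV k" "\<And>s. \<rho>\<^sup>2 < s \<Longrightarrow> k s = 0"
  shows "(\<integral>y. indicator (cball x \<rho>) y * u y * k ((y - x) \<bullet> (y - x)) \<partial>lborel) =
    u x * (real DIM('a) * unit_ball_vol DIM('a) *
      (\<integral>t. indicator {0<..} t * t ^ (DIM('a) - 1) * k (t\<^sup>2) * radial (real DIM('a) / 2) \<mu> (t\<^sup>2) \<partial>lborel))"
proof -
  define w where "w y = indicator (cball x \<rho>) y * u y" for y
  have iw: "integrable lborel w" using u by (simp add: w_def[abs_def] set_integrable_def)
  have c: "continuous_on UNIV (\<lambda>y. k ((y - x) \<bullet> (y - x)))" by (rule continuous_on_dot_comp[OF k(1)])
  have "bounded (range (\<lambda>y. k ((y - x) \<bullet> (y - x))))"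
    by (rule bounded_range_compact_support[of _ "cball x \<rho>"])
       (use c k(2) dot_gt_outside_cball[OF \<rho>] in auto)
  from integrable_mult_bounded[OF iw borel_measurable_continuous_onI[OF c] this]
  have i: "integrable lborel (\<lambda>y. w y * k ((y - x) \<bullet> (y - x)))" by simp
  have s: "sphere_mean w x t = u x * radial (real DIM('a) / 2) \<mu> (t\<^sup>2)" if t: "0 < t" "t \<le> \<rho>" for t
  proof -
    have "x + (t / norm z) *\<^sub>R z \<in> cball x \<rho>" for z using t \<rho> by (simp add: dist_norm)
    then have "sphere_mean w x t = sphere_mean u x t" by (simp add: sphere_mean_def w_def)
    then show ?thesis using mv[OF t] by simp
  qed
  have "(\<integral>y. w y * k ((y - x) \<bullet> (y - x)) \<partial>lborel) = real DIM('a) * unit_ball_vol DIM('a) *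
      (\<integral>t. indicator {0<..} t * t ^ (DIM('a) - 1) * k (t\<^sup>2) * sphere_mean w x t \<partial>lborel)"
    by (rule integral_polar_sphere_mean[OF i])
  also have "(\<lambda>t. indicator {0<..} t * t ^ (DIM('a) - 1) * k (t\<^sup>2) * sphere_mean w x t) =
     (\<lambda>t. u x * (indicator {0<..} t * t ^ (DIM('a) - 1) * k (t\<^sup>2) * radial (real DIM('a) / 2) \<mu> (t\<^sup>2)))"
  proof
    fix t :: real
    consider "t \<le> 0" | "0 < t" "t \<le> \<rho>" | "0 < t" "\<rho> < t" by linarith
    then show "indicator {0<..} t * t ^ (DIM('a) - 1) * k (t\<^sup>2) * sphere_mean w x t
      = u x * (indicator {0<..} t * t ^ (DIM('a) - 1) * k (t\<^sup>2) * radial (real DIM('a) / 2) \<mu> (t\<^sup>2))"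
    proof cases
      case 3
      have "k (t\<^sup>2) = 0" by (rule k(2), rule power_strict_mono) (use 3 \<rho> in auto)
      then show ?thesis by simp
    qed (simp_all add: s)
  qed
  finally show ?thesis by (simp add: w_def)
qed

text \<open>Polar coordinates are read backwards: the expression is the integral over space of
  \<open>radial\<close> times the bump, which is positive inside the ball of radius
  \<open>\<rho>\<close>.\<close>

lemma radial_weight_pos:
  assumes \<rho>: "0 < \<rho>"
  shows "0 < real DIM('a::euclidean_space) * unit_ball_vol DIM('a) *
      (\<integral>t. indicator {0<..} t * t ^ (DIM('a) - 1) * bump \<rho> (t\<^sup>2) * radial (real DIM('a) / 2) \<mu> (t\<^sup>2) \<partial>lborel)"
proof -
  define R where "R s = radial (real DIM('a) / 2) \<mu> s" for s
  define q :: "'a \<Rightarrow> real" where "q y = (y - 0) \<bullet> (y - 0)" for y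
  have R: "0 < R s" if "0 \<le> s" for s unfolding R_def by (rule radial_pos) (use that in auto)
  have cb: "continuous_on UNIV (bump \<rho>)"
    using bump_derivs(1) by (meson DERIV_continuous continuous_at_imp_continuous_on)
  have cR: "continuous_on UNIV R" unfolding R_def by (rule continuous_on_radial) simp
  have c: "continuous_on UNIV (\<lambda>y. R (q y) * bump \<rho> (q y))"
    unfolding q_def by (intro continuous_on_mult continuous_on_dot_comp cb cR)
  have i: "integrable lborel (\<lambda>y. R (q y) * bump \<rho> (q y))"
    by (rule integrable_compact_support[OF c, of "cball 0 \<rho>"])
       (use dot_gt_outside_cball[OF \<rho>, of _ "0 :: 'a"] in \<open>auto simp: q_def bump_zero less_imp_le\<close>)
  have nn: "0 \<le> R (q y) * bump \<rho> (q y)" for y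
    using R[of "q y"] by (simp add: bump_nonneg q_def)
  have "0 < (\<integral>y. R (q y) * bump \<rho> (q y) \<partial>lborel)"
  proof (rule integral_pos_on_ball[OF i nn \<rho>])
    fix y :: 'a assume "y \<in> ball 0 \<rho>"
    then have "q y < \<rho>\<^sup>2" by (simp add: q_def dot_square_norm power_strict_mono)
    then show "0 < R (q y) * bump \<rho> (q y)" using R[of "q y"] by (simp add: bump_pos q_def)
  qed
  also have "\<dots> = real DIM('a) * unit_ball_vol DIM('a) *
      (\<integral>t. indicator {0<..} t * t ^ (DIM('a) - 1) * bump \<rho> (t\<^sup>2) * sphere_mean (\<lambda>y. R (q y)) 0 t \<partial>lborel)"
    using integral_polar_sphere_mean[of "\<lambda>y. R (q y)" "bump \<rho>" 0] i by (simp add: q_def)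
  also have "(\<lambda>t. indicator {0<..} t * t ^ (DIM('a) - 1) * bump \<rho> (t\<^sup>2) * sphere_mean (\<lambda>y. R (q y)) 0 t)
    = (\<lambda>t. indicator {0<..} t * t ^ (DIM('a) - 1) * bump \<rho> (t\<^sup>2) * R (t\<^sup>2))"
  proof
    fix t :: real
    show "indicator {0<..} t * t ^ (DIM('a) - 1) * bump \<rho> (t\<^sup>2) * sphere_mean (\<lambda>y. R (q y)) 0 t
      = indicator {0<..} t * t ^ (DIM('a) - 1) * bump \<rho> (t\<^sup>2) * R (t\<^sup>2)"
      using sphere_mean_radial[of t R "0 :: 'a"] by (cases "0 < t") (simp_all add: q_def)
  qed
  finally show ?thesis by (simp only: R_def)
qed

text \<open>On \<open>V\<close> the function \<open>u\<close> is \<open>1 / c\<close> times the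
  convolution of the integrable \<open>U\<close> with the bump, so its gradient and Hessian are
  convolutions with those of the bump.\<close>

lemma C2_on_convolution_bump:
  fixes U :: "'a::euclidean_space \<Rightarrow> real"
  assumes U: "integrable lborel U" and V: "open V" and c: "c \<noteq> 0"
    and u: "\<And>x. x \<in> V \<Longrightarrow> (\<integral>y. U y * bump \<rho> ((x - y) \<bullet> (x - y)) \<partial>lborel) = c * u x" and \<rho>: "0 < \<rho>"
  shows "C2_on V u"
proof -
  define h' where "h' s = - 3 * max 0 (\<rho>\<^sup>2 - s) ^ 2" for s
  define h'' where "h'' s = 6 * max 0 (\<rho>\<^sup>2 - s)" for s
  note b = bump_derivs[of \<rho>, folded h'_def[abs_def] h''_def[abs_def], folded h'_def]
  have b': "(h' has_real_derivative h'' s) (at s)" for s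
    using bump_derivs(2)[of \<rho> s] unfolding h'_def[abs_def] h''_def .
  have cb: "continuous_on UNIV (bump \<rho>)" "continuous_on UNIV h'" "continuous_on UNIV h''"
    using b(1) b' b(3) by (meson DERIV_continuous continuous_at_imp_continuous_on)+
  \<comment> \<open>The centre 0 is kept visible as \<open>z - 0\<close> to match the form of the
    radial derivative lemmas.\<close>
  define q :: "'a \<Rightarrow> real" where "q z = (z - 0) \<bullet> (z - 0)" for z
  define k where "k z = bump \<rho> (q z)" for z
  define g :: "'a \<Rightarrow> 'a" where "g z = (2 * h' (q z)) *\<^sub>R (z - 0)" for z
  define G :: "'a \<Rightarrow> 'a \<Rightarrow> 'a" where
    "G e z = (4 * h'' (q z) * ((z - 0) \<bullet> e)) *\<^sub>R (z - 0) + (2 * h' (q z)) *\<^sub>R e" for e z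
  have out: "\<rho>\<^sup>2 \<le> q z" if "z \<notin> cball 0 \<rho>" for z
    using dot_gt_outside_cball[OF \<rho> that] by (simp add: q_def)
  have z0: "bump \<rho> s = 0" "h' s = 0" "h'' s = 0" if "\<rho>\<^sup>2 \<le> s" for s
    using that by (simp_all add: bump_zero h'_def h''_def max_absorb1)
  have cq: "continuous_on UNIV (\<lambda>z. H (q z))" if "continuous_on UNIV H" for H :: "real \<Rightarrow> real"
    unfolding q_def by (rule continuous_on_dot_comp[OF that])
  have cont: "continuous_on UNIV k" "continuous_on UNIV g" "continuous_on UNIV (G e)"
    "continuous_on UNIV (\<lambda>z. g z \<bullet> e)" for e
    unfolding k_def[abs_def] g_def[abs_def] G_def[abs_def]
    by (intro continuous_intros cq cb)+
  have bdd: "bounded (range k)" "bounded (range g)" "bounded (range (G e))"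
    "bounded (range (\<lambda>z. g z \<bullet> e))" for e
    by (rule bounded_range_compact_support[of _ "cball 0 \<rho>"];
        use cont out z0 in \<open>simp add: k_def g_def G_def\<close>)+
  have dk: "(k has_derivative (\<lambda>v. v \<bullet> g z)) (at z)" for z
    unfolding k_def g_def q_def by (rule has_derivative_radial[OF b(1)])
  have dg: "((\<lambda>z. g z \<bullet> e) has_derivative (\<lambda>v. v \<bullet> G e z)) (at z)" for e z
    unfolding G_def g_def q_def by (rule has_derivative_radial_gradient[OF b(1) b'])
  define Fg where "Fg x = (1 / c) *\<^sub>R (\<integral>y. U y *\<^sub>R g (x - y) \<partial>lborel)" for x
  define FG where "FG e x = (1 / c) *\<^sub>R (\<integral>y. U y *\<^sub>R G e (x - y) \<partial>lborel)" for e x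
  have ig: "integrable lborel (\<lambda>y. U y *\<^sub>R g (x - y))" for x
  proof (rule integrable_mult_bounded[OF U])
    show "bounded (range (\<lambda>y. g (x - y)))" by (rule bounded_subset[OF bdd(2)]) auto
    have "continuous_on UNIV (\<lambda>y. g (x - y))"
      by (rule continuous_on_compose2[OF cont(2)]) (auto intro!: continuous_intros)
    then show "(\<lambda>y. g (x - y)) \<in> borel_measurable borel" by (rule borel_measurable_continuous_onI)
  qed
  show "C2_on V u"
  proof (rule C2_onI(1)[OF V])
    fix x assume x: "x \<in> V"
    have "((\<lambda>x. (1 / c) * (\<integral>y. U y * k (x - y) \<partial>lborel)) has_derivative
        (\<lambda>v. (1 / c) * (v \<bullet> (\<integral>y. U y *\<^sub>R g (x - y) \<partial>lborel)))) (at x)"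
      by (intro has_derivative_mult_right has_derivative_convolution U dk bdd cont)
    then have "((\<lambda>x. (1 / c) * (\<integral>y. U y * k (x - y) \<partial>lborel)) has_derivative (\<lambda>v. v \<bullet> Fg x)) (at x)"
      by (simp add: Fg_def)
    then show "(u has_derivative (\<lambda>v. v \<bullet> Fg x)) (at x)"
      by (rule has_derivative_transform_within_open[OF _ V x]) (simp add: k_def q_def u c)
  next
    fix e x :: 'a assume "x \<in> V"
    have "((\<lambda>x. (1 / c) * (\<integral>y. U y * (g (x - y) \<bullet> e) \<partial>lborel)) has_derivative
        (\<lambda>v. (1 / c) * (v \<bullet> (\<integral>y. U y *\<^sub>R G e (x - y) \<partial>lborel)))) (at x)"
      by (intro has_derivative_mult_right has_derivative_convolution U dg bdd cont)
    moreover have "(1 / c) * (\<integral>y. U y * (g (x - y) \<bullet> e) \<partial>lborel) = Fg x \<bullet> e" for x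
      using integral_inner_left[of e, OF ig[of x]] by (simp add: Fg_def)
    ultimately show "((\<lambda>x. Fg x \<bullet> e) has_derivative (\<lambda>v. v \<bullet> FG e x)) (at x)"
      by (simp add: FG_def)
  next
    fix e e' :: 'a
    have "continuous_on UNIV (\<lambda>x. FG e x \<bullet> e')"
      unfolding FG_def by (intro continuous_intros continuous_on_convolution U cont bdd)
    then show "continuous_on V (\<lambda>x. FG e x \<bullet> e')" by (rule continuous_on_subset) simp
  qed
qed

lemma average_property_C2_on:
  fixes u :: "'a::euclidean_space \<Rightarrow> real"
  assumes D: "open D" and \<mu>: "\<mu> > 0" and loc: "locally_integrable_on D u" and av: "has_average_property \<mu> D u"
  shows "C2_on D u"
proof (rule C2_on_local[OF D])
  fix x0 assume "x0 \<in> D"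
  then obtain r where r: "0 < r" "cball x0 r \<subseteq> D" using D open_contains_cball by blast
  \<comment> \<open>Half the radius: balls of radius \<open>\<rho>\<close> about points of
    \<open>ball x0 \<rho>\<close> stay in \<open>cball x0 r\<close>, so a single cut-off
    \<open>U\<close> serves all these centres.\<close>
  define \<rho> where "\<rho> = r / 2"
  have \<rho>: "0 < \<rho>" using r by (simp add: \<rho>_def)
  have sub: "cball x \<rho> \<subseteq> cball x0 r" if "x \<in> ball x0 \<rho>" for x
  proof
    fix y assume "y \<in> cball x \<rho>"
    then show "y \<in> cball x0 r"
      using that dist_triangle[of x0 y x] by (simp add: \<rho>_def)
  qed
  define U where "U y = indicator (cball x0 r) y * u y" for y
  define c where "c = real DIM('a) * unit_ball_vol DIM('a) *
      (\<integral>t. indicator {0<..} t * t ^ (DIM('a) - 1) * bump \<rho> (t\<^sup>2) * radial (real DIM('a) / 2) \<mu> (t\<^sup>2) \<partial>lborel)"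
  have c: "c > 0" unfolding c_def by (rule radial_weight_pos[OF \<rho>])
  have int: "set_integrable lborel (cball x s) u" if "cball x s \<subseteq> D" for x s
    using loc that unfolding locally_integrable_on_def by simp
  have cb: "continuous_on UNIV (bump \<rho>)"
    using bump_derivs(1) by (meson DERIV_continuous continuous_at_imp_continuous_on)
  have "C2_on (ball x0 \<rho>) u"
  proof (rule C2_on_convolution_bump[OF _ open_ball less_imp_neq[OF c, symmetric] _ \<rho>])
    show "integrable lborel U" using int[OF r(2)] by (simp add: U_def[abs_def] set_integrable_def)
    fix x assume x: "x \<in> ball x0 \<rho>"
    have xD: "cball x \<rho> \<subseteq> D" using sub[OF x] r by blast
    have "U y * bump \<rho> ((x - y) \<bullet> (x - y)) = indicator (cball x \<rho>) y * u y * bump \<rho> ((y - x) \<bullet> (y - x))" for y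
    proof (cases "y \<in> cball x \<rho>")
      case True
      then have "y \<in> cball x0 r" using sub[OF x] by blast
      then show ?thesis using True by (simp add: U_def dot_square_norm norm_minus_commute)
    next
      case False
      then have "bump \<rho> ((y - x) \<bullet> (y - x)) = 0"
        using dot_gt_outside_cball[OF \<rho> False] by (simp add: bump_zero)
      then show ?thesis by (simp add: dot_square_norm norm_minus_commute)
    qed
    then have "(\<integral>y. U y * bump \<rho> ((x - y) \<bullet> (x - y)) \<partial>lborel)
      = (\<integral>y. indicator (cball x \<rho>) y * u y * bump \<rho> ((y - x) \<bullet> (y - x)) \<partial>lborel)" by simp
    also have "\<dots> = u x * c"
      unfolding c_def
    proof (rule integral_mean_value_radial[OF \<rho> int[OF xD] _ cb])
      fix t assume t: "0 < t" "t \<le> \<rho>"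
      have "cball x t \<subseteq> D" using t xD by (meson subset_cball order_trans)
      then show "sphere_mean u x t = u x * radial (real DIM('a) / 2) \<mu> (t\<^sup>2)"
        by (rule sphere_mean_average_property[OF av \<mu> t(1)])
    qed (simp add: bump_zero)
    finally show "(\<integral>y. U y * bump \<rho> ((x - y) \<bullet> (x - y)) \<partial>lborel) = c * u x" by simp
  qed
  then show "\<exists>V. open V \<and> x0 \<in> V \<and> C2_on V u" using \<rho> by (intro exI[of _ "ball x0 \<rho>"]) simp
qed

text \<open>Up to radius \<open>\<rho>\<close> the spherical means of \<open>u\<close> are
  \<open>u x\<close> times those of the radial panharmonic function centred at \<open>x\<close>. The
  integrals against the bump see only these means, so they are proportional too, and for the radial
  function the integral is 0.\<close>

lemma mean_value_bump_integral:
  fixes u :: "'a::euclidean_space \<Rightarrow> real"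
  assumes D: "open D" and u: "C2_on D u" and \<rho>: "0 < \<rho>" "cball x \<rho> \<subseteq> D"
    and mv: "\<And>t. 0 < t \<Longrightarrow> t \<le> \<rho> \<Longrightarrow> sphere_mean u x t = u x * radial (real DIM('a) / 2) \<mu> (t\<^sup>2)"
  shows "(LINT y:cball x \<rho>|lborel. bump \<rho> ((y - x) \<bullet> (y - x)) * (laplacian u y - \<mu>\<^sup>2 * u y)) = 0"
proof -
  define R :: "'a \<Rightarrow> real" where "R y = radial (real DIM('a) / 2) \<mu> ((y - x) \<bullet> (y - x))" for y
  have R: "panharmonic_on \<mu> UNIV R" unfolding R_def by (rule panharmonic_radial)
  define k where "k s = 4 * s * (6 * max 0 (\<rho>\<^sup>2 - s)) + 2 * real DIM('a) * (- 3 * max 0 (\<rho>\<^sup>2 - s) ^ 2) - \<mu>\<^sup>2 * bump \<rho> s" for s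
  define C where "C = real DIM('a) * unit_ball_vol DIM('a)"
  define \<Phi> where "\<Phi> w = (\<integral>t. indicator {0<..} t * t ^ (DIM('a) - 1) * k (t\<^sup>2) * sphere_mean w x t \<partial>lborel)" for w :: "'a \<Rightarrow> real"
  have green: "(LINT y:cball x \<rho>|lborel. bump \<rho> ((y - x) \<bullet> (y - x)) * (laplacian w y - \<mu>\<^sup>2 * w y)) = C * \<Phi> w"
    if "open V" "C2_on V w" "cball x \<rho> \<subseteq> V" for V w
    unfolding C_def \<Phi>_def k_def
    by (rule radial_integral_zero[OF that(1,2) \<rho>(1) that(3) bump_derivs]) (simp add: bump_zero)
  have "(\<lambda>t. indicator {0<..} t * t ^ (DIM('a) - 1) * k (t\<^sup>2) * sphere_mean u x t)
      = (\<lambda>t. u x * (indicator {0<..} t * t ^ (DIM('a) - 1) * k (t\<^sup>2) * sphere_mean R x t))"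
  proof
    fix t :: real
    consider "t \<le> 0" | "0 < t" "t \<le> \<rho>" | "0 < t" "\<rho> < t" by linarith
    then show "indicator {0<..} t * t ^ (DIM('a) - 1) * k (t\<^sup>2) * sphere_mean u x t
      = u x * (indicator {0<..} t * t ^ (DIM('a) - 1) * k (t\<^sup>2) * sphere_mean R x t)"
    proof cases
      case 2
      then show ?thesis
        using mv[OF 2] sphere_mean_radial[of t "radial (real DIM('a) / 2) \<mu>" x] by (simp add: R_def[abs_def])
    next
      case 3
      then have "\<rho>\<^sup>2 \<le> t\<^sup>2" using \<rho> by (intro power_mono) auto
      then have "k (t\<^sup>2) = 0" by (simp add: k_def bump_zero max_absorb1)
      then show ?thesis by simp
    qed simp
  qed
  then have "\<Phi> u = u x * \<Phi> R" unfolding \<Phi>_def by simp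
  moreover have "C * \<Phi> R = 0"
    using green[OF open_UNIV, of R] R by (auto simp: panharmonic_on_def)
  ultimately show ?thesis using green[OF D u \<rho>(2)] by auto
qed

lemma average_property_panharmonic:
  fixes u :: "'a::euclidean_space \<Rightarrow> real"
  assumes D: "open D" and \<mu>: "\<mu> > 0" and loc: "locally_integrable_on D u" and av: "has_average_property \<mu> D u"
  shows "panharmonic_on \<mu> D u"
proof -
  have u: "C2_on D u" by (rule average_property_C2_on[OF assms])
  define L where "L y = laplacian u y - \<mu>\<^sup>2 * u y" for y
  have cL: "continuous_on D L" unfolding L_def by (intro continuous_intros C2_on_continuous[OF u])
  have "L x = 0" if x: "x \<in> D" for x
  proof (rule ccontr)
    assume Lx: "L x \<noteq> 0"
    \<comment> \<open>By continuity \<open>L\<close> keeps the sign of \<open>L x\<close> on a small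
      ball, which contradicts the vanishing integral against the positive bump. Multiplying by
      \<open>L x\<close> treats both signs at once.\<close>
    have "open {y \<in> D. 0 < L x * L y}"
      using continuous_open_preimage[OF continuous_on_mult[OF continuous_on_const cL, of "L x"] D open_greaterThan[of 0]]
      by (simp add: vimage_def Int_def)
    then obtain \<rho> where \<rho>: "0 < \<rho>" "cball x \<rho> \<subseteq> {y \<in> D. 0 < L x * L y}"
      using open_contains_cball[of "{y \<in> D. 0 < L x * L y}"] x Lx by (auto simp: zero_less_mult_iff linorder_neq_iff)
    then have sub: "cball x \<rho> \<subseteq> D" by auto
    define f where "f y = indicator (cball x \<rho>) y * (L x * (bump \<rho> ((y - x) \<bullet> (y - x)) * L y))" for y
    have cb: "continuous_on UNIV (bump \<rho>)"
      using bump_derivs(1) by (meson DERIV_continuous continuous_at_imp_continuous_on)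
    have "set_integrable lborel (cball x \<rho>) (\<lambda>y. L x * (bump \<rho> ((y - x) \<bullet> (y - x)) * L y))"
      by (intro set_integrable_compact continuous_intros continuous_on_dot_comp cb continuous_on_subset[OF cL sub]) simp
    then have i: "integrable lborel f" by (simp add: set_integrable_def f_def[abs_def])
    have nn: "0 \<le> f y" for y
    proof (cases "y \<in> cball x \<rho>")
      case True
      then have "0 < L x * L y" using \<rho>(2) by blast
      then have "0 \<le> bump \<rho> ((y - x) \<bullet> (y - x)) * (L x * L y)"
        by (intro mult_nonneg_nonneg bump_nonneg less_imp_le)
      then show ?thesis using True by (simp add: f_def mult.left_commute[of "L x" "bump \<rho> ((y - x) \<bullet> (y - x))"])
    qed (simp add: f_def)
    have "0 < (\<integral>y. f y \<partial>lborel)"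
    proof (rule integral_pos_on_ball[OF i nn \<rho>(1)])
      fix y assume y: "y \<in> ball x \<rho>"
      then have "(y - x) \<bullet> (y - x) < \<rho>\<^sup>2"
        by (simp add: dot_square_norm dist_norm norm_minus_commute power_strict_mono)
      then have "0 < bump \<rho> ((y - x) \<bullet> (y - x))" by (rule bump_pos)
      moreover have yc: "y \<in> cball x \<rho>" using y by simp
      moreover from yc have "0 < L x * L y" using \<rho>(2) by blast
      ultimately have "0 < bump \<rho> ((y - x) \<bullet> (y - x)) * (L x * L y)" by simp
      then show "0 < f y" using yc
        by (simp add: f_def mult.left_commute[of "L x" "bump \<rho> ((y - x) \<bullet> (y - x))"])
    qed
    also have "(\<integral>y. f y \<partial>lborel) = L x * (LINT y:cball x \<rho>|lborel. bump \<rho> ((y - x) \<bullet> (y - x)) * L y)"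
      unfolding set_lebesgue_integral_def f_def
      by (subst integral_mult_right_zero[symmetric]) (simp add: mult_ac)
    also have "(LINT y:cball x \<rho>|lborel. bump \<rho> ((y - x) \<bullet> (y - x)) * L y) = 0"
      unfolding L_def
    proof (rule mean_value_bump_integral[OF D u \<rho>(1) sub])
      fix t assume t: "0 < t" "t \<le> \<rho>"
      have "cball x t \<subseteq> D" using t sub by (meson subset_cball order_trans)
      then show "sphere_mean u x t = u x * radial (real DIM('a) / 2) \<mu> (t\<^sup>2)"
        by (rule sphere_mean_average_property[OF av \<mu> t(1)])
    qed
    finally show False by simp
  qed
  then show ?thesis using u by (auto simp: panharmonic_on_def L_def)
qed

subsection \<open>Uniqueness of the panharmonic measure\<close>

lemma panharmonic_exp:
  fixes a x :: "'a::euclidean_space"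
  assumes "norm a = \<bar>\<mu>\<bar>"
  shows "panharmonic_on \<mu> UNIV (\<lambda>y. exp (a \<bullet> (y - x)))"
proof -
  define E where "E y = exp (a \<bullet> (y - x))" for y
  have dE: "(E has_derivative (\<lambda>v. v \<bullet> (E y *\<^sub>R a))) (at y)" for y
    unfolding E_def[abs_def] by (auto intro!: derivative_eq_intros simp: inner_commute)
  have dG: "((\<lambda>y. (E y *\<^sub>R a) \<bullet> e) has_derivative (\<lambda>v. v \<bullet> ((a \<bullet> e * E y) *\<^sub>R a))) (at y)" for e y
    by (auto intro!: derivative_eq_intros dE simp: algebra_simps)
  have cE: "continuous_on UNIV E" unfolding E_def[abs_def] by (intro continuous_intros)
  have cG: "continuous_on UNIV (\<lambda>y. ((a \<bullet> e * E y) *\<^sub>R a) \<bullet> e')" for e e'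
    by (intro continuous_intros cE)
  note C = C2_onI[OF open_UNIV dE dG cG]
  have "laplacian E y = (a \<bullet> a) * E y" for y
    unfolding C(2)[OF UNIV_I]
    by (simp add: euclidean_inner[of a a] sum_distrib_left sum_distrib_right mult_ac)
  then have "laplacian E y = \<mu>\<^sup>2 * E y" for y
    using assms by (simp add: dot_square_norm)
  then show ?thesis using C(1) by (simp add: panharmonic_on_def E_def[abs_def])
qed

section \<open>Finite measures determined by continuous functions and by moments\<close>

lemma integrable_continuous_AE_compact:
  fixes f :: "'a::euclidean_space \<Rightarrow> real"
  assumes H: "finite_measure H" "sets H = sets borel" and K: "compact K" "AE y in H. y \<in> K"
    and f: "continuous_on UNIV f"
  shows "integrable H f"
proof -
  have "bounded (f ` K)"
    using K(1) f by (meson compact_continuous_image compact_imp_bounded continuous_on_subset top_greatest)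
  then obtain B where B: "\<And>y. y \<in> K \<Longrightarrow> norm (f y) \<le> B" unfolding bounded_iff by auto
  have "f \<in> borel_measurable H"
    using borel_measurable_continuous_onI[OF f] H(2) by (simp cong: measurable_cong_sets)
  moreover have "AE y in H. norm (f y) \<le> B"
    by (rule AE_mp[OF K(2)]) (use B in \<open>auto intro!: AE_I2\<close>)
  ultimately show ?thesis
    by (rule finite_measure.integrable_const_bound[OF H(1), rotated])
qed

lemma set_integrable_continuous_compact:
  fixes f :: "'a::euclidean_space \<Rightarrow> real"
  assumes H: "finite_measure H" "sets H = sets borel" and K: "compact K" and f: "continuous_on K f"
  shows "set_integrable H K f"
  unfolding set_integrable_def
proof -
  have "bounded (f ` K)"
    using K f by (intro compact_imp_bounded compact_continuous_image)
  then obtain B where B: "\<And>y. y \<in> K \<Longrightarrow> norm (f y) \<le> B" unfolding bounded_iff by auto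
  have "(\<lambda>y. indicator K y *\<^sub>R f y) \<in> borel_measurable borel"
    using K by (intro borel_measurable_continuous_on_indicator f) (auto intro: borel_closed compact_imp_closed)
  then have "(\<lambda>y. indicator K y *\<^sub>R f y) \<in> borel_measurable H"
    using H(2) by (simp cong: measurable_cong_sets)
  moreover have "norm (indicator K y *\<^sub>R f y) \<le> \<bar>B\<bar>" for y
    using B[of y] by (cases "y \<in> K") auto
  ultimately show "integrable H (\<lambda>y. indicator K y *\<^sub>R f y)"
    by (intro finite_measure.integrable_const_bound[OF H(1), of _ "\<bar>B\<bar>"]) auto
qed

text \<open>Closed sets form an intersection-stable generator, and the indicator of a nonempty
  closed set is the limit of the functions \<open>max 0 (1 - n * infdist y C)\<close>.\<close>

lemma finite_measure_eqI_continuous: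
  fixes H1 H2 :: "'a::euclidean_space measure"
  assumes H1: "finite_measure H1" "sets H1 = sets borel" and H2: "finite_measure H2" "sets H2 = sets borel"
    and eq: "\<And>f :: 'a \<Rightarrow> real. continuous_on UNIV f \<Longrightarrow> integral\<^sup>L H1 f = integral\<^sup>L H2 f"
  shows "H1 = H2"
proof (rule measure_eqI_generator_eq[where E = "Collect closed" and \<Omega> = UNIV and A = "\<lambda>_. UNIV"])
  show "sets H1 = sigma_sets UNIV (Collect closed)" "sets H2 = sigma_sets UNIV (Collect closed)"
    using H1 H2 by (simp_all add: borel_eq_closed)
  show "emeasure H1 UNIV \<noteq> \<infinity>"
    using finite_measure.finite_emeasure_space[OF H1(1)] sets_eq_imp_space_eq[OF H1(2)] by simp
  fix C :: "'a set" assume "C \<in> Collect closed"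
  then have C: "closed C" by simp
  show "emeasure H1 C = emeasure H2 C"
  \<comment> \<open>The distance to the empty set is 0 by convention, which would make every
    \<open>f n\<close> the constant 1.\<close>
  proof (cases "C = {}")
    case False
    define f where "f n y = max 0 (1 - real n * infdist y C)" for n y
    have cf: "continuous_on UNIV (f n)" for n unfolding f_def[abs_def] by (intro continuous_intros)
    have f01: "0 \<le> f n y" "f n y \<le> 1" for n y by (auto simp: f_def infdist_nonneg)
    have lim: "(\<lambda>n. f n y) \<longlonglongrightarrow> indicator C y" for y
    proof (cases "y \<in> C")
      case True then show ?thesis by (simp add: f_def)
    next
      case yC: False
      then have d: "0 < infdist y C"
        using C False by (metis in_closed_iff_infdist_zero infdist_nonneg order_le_less)
      obtain N :: nat where N: "1 / infdist y C < real N" using reals_Archimedean2 by blast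
      have "f n y = 0" if "N \<le> n" for n
      proof -
        have "1 / infdist y C < real n" using N that by linarith
        then show ?thesis using d by (simp add: f_def pos_divide_less_eq)
      qed
      then have "\<forall>\<^sub>F n in sequentially. f n y = indicator C y"
        using yC by (auto simp: eventually_sequentially)
      then show ?thesis by (rule tendsto_eventually)
    qed
    have m: "(\<lambda>n. integral\<^sup>L H (f n)) \<longlonglongrightarrow> measure H C"
      if H: "finite_measure H" "sets H = sets borel" for H
    proof -
      interpret finite_measure H by fact
      have [measurable]: "C \<in> sets H" using C H(2) by simp
      have "(\<lambda>n. integral\<^sup>L H (f n)) \<longlonglongrightarrow> integral\<^sup>L H (indicator C)"
      proof (rule integral_dominated_convergence[where w = "\<lambda>_. 1"])
        show "f n \<in> borel_measurable H" for n
          using borel_measurable_continuous_onI[OF cf] H(2) by (simp cong: measurable_cong_sets)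
      qed (use f01 lim in auto)
      then show ?thesis by simp
    qed
    have "measure H1 C = measure H2 C"
      using LIMSEQ_unique[OF m[OF H1]] m[OF H2] eq[OF cf] by simp
    then show ?thesis
      using finite_measure.emeasure_eq_measure[OF H1(1)] finite_measure.emeasure_eq_measure[OF H2(1)] by simp
  qed simp
qed (auto simp: Int_stable_def)

text \<open>Monomials are indexed by words of basis vectors rather than by exponents. Distinct words
  may give the same monomial; in return, powers of the inner product expand with all coefficients
  equal to 1.\<close>

definition monomial :: "'a::euclidean_space \<Rightarrow> 'a list \<Rightarrow> 'a \<Rightarrow> real" where
  "monomial x l y = (\<Prod>e\<leftarrow>l. (y - x) \<bullet> e)"

lemma continuous_on_monomial: "continuous_on S (monomial x l)"
proof (induction l)
  case Nil then show ?case by (simp add: monomial_def[abs_def])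
next
  case (Cons e l)
  then have "continuous_on S (\<lambda>y. (y - x) \<bullet> e * monomial x l y)" by (intro continuous_intros)
  then show ?case by (simp add: monomial_def[abs_def])
qed

definition multi_index :: "nat \<Rightarrow> 'a::euclidean_space list set" where
  "multi_index k = {l. set l \<subseteq> Basis \<and> length l = k}"

lemma finite_multi_index: "finite (multi_index k)"
  unfolding multi_index_def by (rule finite_lists_length_eq) simp

lemma inner_power_eq_sum_monomial: "((z - x) \<bullet> (y - x)) ^ k = (\<Sum>l\<in>multi_index k. monomial x l z * monomial x l (y :: 'a::euclidean_space))"
proof (induction k)
  case 0
  have "multi_index 0 = {[] :: 'a list}" by (auto simp: multi_index_def)
  then show ?case by (simp add: monomial_def)
next
  case (Suc k)
  have m: "multi_index (Suc k) = (\<lambda>(e, l). e # l) ` (Basis \<times> multi_index k)"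
    by (auto simp: multi_index_def length_Suc_conv image_iff)
  have "(\<Sum>l\<in>multi_index (Suc k). monomial x l z * monomial x l y)
      = (\<Sum>(e, l)\<in>Basis \<times> multi_index k. monomial x (e # l) z * monomial x (e # l) y)"
    unfolding m by (subst sum.reindex) (auto simp: inj_on_def case_prod_unfold)
  also have "\<dots> = (\<Sum>e\<in>Basis. \<Sum>l\<in>multi_index k. ((z - x) \<bullet> e * ((y - x) \<bullet> e)) * (monomial x l z * monomial x l y))"
    by (subst sum.cartesian_product[symmetric]) (simp add: monomial_def mult_ac)
  also have "\<dots> = ((z - x) \<bullet> (y - x)) ^ Suc k"
    by (simp add: sum_distrib_left[symmetric] sum_distrib_right[symmetric] Suc.IH[symmetric]
        euclidean_inner[of "z - x" "y - x"])
  finally show ?case by simp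
qed

text \<open>Equal moments mean equal integrals of polynomials, which are uniformly dense on
  \<open>K\<close> by Stone-Weierstrass. Both measures being finite and carried by \<open>K\<close>,
  uniform closeness there makes the integrals close.\<close>

lemma integral_eq_of_moments:
  fixes f :: "'a::euclidean_space \<Rightarrow> real"
  assumes H1: "finite_measure H1" "sets H1 = sets borel" "AE y in H1. y \<in> K"
    and H2: "finite_measure H2" "sets H2 = sets borel" "AE y in H2. y \<in> K"
    and K: "compact K"
    and mom: "\<And>l. set l \<subseteq> Basis \<Longrightarrow> integral\<^sup>L H1 (monomial x l) = integral\<^sup>L H2 (monomial x l)"
    and f: "continuous_on UNIV f"
  shows "integral\<^sup>L H1 f = integral\<^sup>L H2 f"
proof -
  note i1 = integrable_continuous_AE_compact[OF H1(1,2) K H1(3)]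
  note i2 = integrable_continuous_AE_compact[OF H2(1,2) K H2(3)]
  define J where "J g = integral\<^sup>L H1 g - integral\<^sup>L H2 g" for g :: "'a \<Rightarrow> real"
  have J_add: "J (\<lambda>y. g y + h y) = J g + J h" if "continuous_on UNIV g" "continuous_on UNIV h" for g h
    using i1 i2 that by (simp add: J_def)
  have J_cmult: "J (\<lambda>y. c * g y) = c * J g" for c g by (simp add: J_def right_diff_distrib)
  have J_sum: "J (\<lambda>y. \<Sum>e\<in>S. g e y) = (\<Sum>e\<in>S. J (g e))" if "\<And>e. continuous_on UNIV (g e)" for g and S :: "'a set"
    using i1 i2 that by (simp add: J_def Bochner_Integration.integral_sum sum_subtractf)
  \<comment> \<open>V is closed under multiplication by coordinates, hence by polynomials; stating the claim for
    V rather than for single monomials is what carries the induction through products.\<close>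
  define V where "V = {g. continuous_on UNIV g \<and> (\<forall>l. set l \<subseteq> Basis \<longrightarrow> J (\<lambda>y. g y * monomial x l y) = 0)}"
  have V: "(\<lambda>y. p y * g y) \<in> V" if p: "real_polynomial_function p" and "g \<in> V" for p g
    using p \<open>g \<in> V\<close>
  proof (induction arbitrary: g rule: real_polynomial_function.induct)
    case (linear p)
    have cg: "continuous_on UNIV g" and g: "\<And>l. set l \<subseteq> Basis \<Longrightarrow> J (\<lambda>y. g y * monomial x l y) = 0"
      using linear.prems by (auto simp: V_def)
    interpret bounded_linear p by (rule linear.hyps)
    \<comment> \<open>Expanded about \<open>x\<close>, a linear functional is a constant plus
      coordinates, so multiplying by it merely lengthens the word of the monomial by one
      letter.\<close>
    have p: "p y = p x + (\<Sum>e\<in>Basis. p e * ((y - x) \<bullet> e))" for y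
    proof -
      have "p y = p x + p (\<Sum>e\<in>Basis. ((y - x) \<bullet> e) *\<^sub>R e)"
        by (simp add: euclidean_representation diff)
      then show ?thesis by (simp add: sum scaleR mult.commute)
    qed
    have "J (\<lambda>y. p y * g y * monomial x l y) = 0" if l: "set l \<subseteq> Basis" for l
    proof -
      have eq: "(\<lambda>y. p y * g y * monomial x l y)
         = (\<lambda>y. p x * (g y * monomial x l y) + (\<Sum>e\<in>Basis. p e * (g y * monomial x (e # l) y)))"
        by (subst p) (simp add: monomial_def algebra_simps sum_distrib_left sum_distrib_right)
      have "J (\<lambda>y. p y * g y * monomial x l y) = p x * J (\<lambda>y. g y * monomial x l y) + (\<Sum>e\<in>Basis. p e * J (\<lambda>y. g y * monomial x (e # l) y))"
        unfolding eq
        by (subst J_add, (intro continuous_intros cg continuous_on_monomial)+, subst J_sum,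
            (intro continuous_intros cg continuous_on_monomial)+, simp add: J_cmult)
      also have "\<dots> = 0" using g l by simp
      finally show ?thesis .
    qed
    moreover have "continuous_on UNIV p" by (rule linear_continuous_on) (rule linear.hyps)
    ultimately show ?case using cg by (auto simp: V_def intro!: continuous_intros)
  next
    case (const c)
    then have "continuous_on UNIV g" "\<And>l. set l \<subseteq> Basis \<Longrightarrow> J (\<lambda>y. g y * monomial x l y) = 0"
      by (auto simp: V_def)
    then show ?case using J_cmult[of c] by (auto simp: V_def mult.assoc intro!: continuous_intros)
  next
    case (add p q)
    have pq: "(\<lambda>y. p y * g y) \<in> V" "(\<lambda>y. q y * g y) \<in> V" by (rule add.IH, rule add.prems)+
    have "J (\<lambda>y. (p y + q y) * g y * monomial x l y) = 0" if l: "set l \<subseteq> Basis" for l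
    proof -
      have "J (\<lambda>y. p y * g y * monomial x l y + q y * g y * monomial x l y)
        = J (\<lambda>y. p y * g y * monomial x l y) + J (\<lambda>y. q y * g y * monomial x l y)"
        by (rule J_add) (use pq in \<open>auto simp: V_def intro!: continuous_on_mult continuous_on_monomial\<close>)
      then show ?thesis using pq l by (simp add: V_def distrib_right)
    qed
    moreover have "continuous_on UNIV (\<lambda>y. (p y + q y) * g y)"
      unfolding distrib_right by (intro continuous_on_add) (use pq in \<open>auto simp: V_def\<close>)
    ultimately show ?case by (simp add: V_def)
  next
    case (mult p q)
    have "(\<lambda>y. p y * (q y * g y)) \<in> V" by (intro mult.IH mult.prems)
    then show ?case by (simp add: mult.assoc)
  qed
  have 1: "(\<lambda>_. 1) \<in> V" using mom by (simp add: V_def J_def)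
  have poly: "J p = 0" if "real_polynomial_function p" for p
  proof -
    have "(\<lambda>y. p y * 1) \<in> V" by (rule V[OF that 1])
    then have "J (\<lambda>y. p y * 1 * monomial x [] y) = 0" by (simp only: V_def mem_Collect_eq) simp
    then show ?thesis by (simp add: monomial_def)
  qed
  define M where "M = measure H1 UNIV + measure H2 UNIV"
  have M: "0 \<le> M" by (simp add: M_def)
  have "\<bar>J f\<bar> \<le> e * M" if e: "e > 0" for e
  proof -
    obtain p where p: "real_polynomial_function p" and fp: "\<And>y. y \<in> K \<Longrightarrow> \<bar>f y - p y\<bar> < e"
      using Stone_Weierstrass_real_polynomial_function[OF K _ e, of f] f continuous_on_subset by blast
    have cp: "continuous_on UNIV p"
      using continuous_on_polymonial_function p real_polynomial_function_eq by blast
    have bnd: "\<bar>integral\<^sup>L H (\<lambda>y. f y - p y)\<bar> \<le> e * measure H UNIV"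
      if H: "finite_measure H" "sets H = sets borel" "AE y in H. y \<in> K" for H
    proof -
      interpret finite_measure H by fact
      have i: "integrable H (\<lambda>y. f y - p y)"
        by (rule integrable_continuous_AE_compact[OF H(1,2) K H(3)]) (intro continuous_intros f cp)
      have "norm (integral\<^sup>L H (\<lambda>y. f y - p y)) \<le> integral\<^sup>L H (\<lambda>y. norm (f y - p y))"
        by (rule integral_norm_bound)
      also have "\<dots> \<le> integral\<^sup>L H (\<lambda>y. e)"
        by (rule integral_mono_AE[OF integrable_norm[OF i] integrable_const], rule AE_mp[OF H(3)])
           (use fp in \<open>auto intro!: AE_I2 less_imp_le\<close>)
      finally show ?thesis using sets_eq_imp_space_eq[OF H(2)] by (simp add: mult.commute)
    qed
    have "J f = J (\<lambda>y. f y - p y) + J p"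
      using i1 i2 f cp by (simp add: J_def)
    then have "J f = J (\<lambda>y. f y - p y)" using poly[OF p] by simp
    then show ?thesis using bnd[OF H1] bnd[OF H2] by (simp add: J_def M_def algebra_simps)
  qed
  note bound = this
  have "\<bar>J f\<bar> \<le> 0 + e" if e: "e > 0" for e
  proof -
    \<comment> \<open>The denominator is \<open>M + 1\<close> because \<open>M\<close> is 0 when
      both measures vanish.\<close>
    have "\<bar>J f\<bar> \<le> e / (M + 1) * M" using e M by (intro bound) simp
    also have "\<dots> \<le> e" using e M by (simp add: field_simps)
    finally show ?thesis by simp
  qed
  then have "\<bar>J f\<bar> \<le> 0" by (rule field_le_epsilon)
  then show ?thesis by (simp add: J_def)
qed

lemma integral_suminf_AE_bounded:
  fixes f :: "nat \<Rightarrow> 'a::euclidean_space \<Rightarrow> real"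
  assumes H: "finite_measure H" "sets H = sets borel" "AE y in H. y \<in> K" and K: "compact K"
    and f: "\<And>k. continuous_on UNIV (f k)" and bd: "\<And>k y. y \<in> K \<Longrightarrow> \<bar>f k y\<bar> \<le> b k" and b: "summable b"
  shows "(\<lambda>k. integral\<^sup>L H (f k)) sums (\<integral>y. (\<Sum>k. f k y) \<partial>H)"
proof -
  interpret finite_measure H by fact
  have i: "integrable H (f k)" for k
    by (rule integrable_continuous_AE_compact[OF H(1,2) K H(3) f])
  have 1: "AE y in H. summable (\<lambda>k. norm (f k y))"
    by (rule AE_mp[OF H(3)], rule AE_I2, rule impI, rule summable_comparison_test'[OF b, of 0]) (simp add: bd)
  have "integral\<^sup>L H (\<lambda>y. norm (f k y)) \<le> b k * measure H UNIV" for k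
  proof -
    have "integral\<^sup>L H (\<lambda>y. norm (f k y)) \<le> integral\<^sup>L H (\<lambda>y. b k)"
      by (rule integral_mono_AE[OF integrable_norm[OF i] integrable_const], rule AE_mp[OF H(3)])
         (use bd in \<open>auto intro!: AE_I2\<close>)
    then show ?thesis using sets_eq_imp_space_eq[OF H(2)] by (simp add: mult.commute)
  qed
  then have 2: "summable (\<lambda>k. integral\<^sup>L H (\<lambda>y. norm (f k y)))"
    by (intro summable_comparison_test'[OF summable_mult2[OF b, of "measure H UNIV"], of 0]) simp
  show ?thesis by (rule sums_integral[OF i 1 2])
qed

text \<open>The kernel \<open>exp (c * ((z - x) \<bullet> (y - x)))\<close> is a positive combination of the products
  \<open>monomial x l z * monomial x l y\<close>, so its double integral against the difference of the two measures
  is a positive combination of the squared differences of their moments.\<close>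
lemma moments_eq_of_exp:
  fixes H1 H2 :: "'a::euclidean_space measure"
  assumes H1: "finite_measure H1" "sets H1 = sets borel" "AE y in H1. y \<in> cball x r"
    and H2: "finite_measure H2" "sets H2 = sets borel" "AE y in H2. y \<in> cball x r"
    and S1: "AE z in H1. z \<in> S" and S2: "AE z in H2. z \<in> S" and c: "0 < c" and r: "0 \<le> r"
    and eq: "\<And>z. z \<in> S \<Longrightarrow> (\<integral>y. exp (c * ((z - x) \<bullet> (y - x))) \<partial>H1) = (\<integral>y. exp (c * ((z - x) \<bullet> (y - x))) \<partial>H2)"
    and S: "S \<subseteq> cball x r"
    and l: "set l \<subseteq> Basis"
  shows "integral\<^sup>L H1 (monomial x l) = integral\<^sup>L H2 (monomial x l)"
proof -
  define K where "K = cball x r"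
  have K: "compact K" by (simp add: K_def)
  note i1 = integrable_continuous_AE_compact[OF H1(1,2) K H1(3)[folded K_def]]
  note i2 = integrable_continuous_AE_compact[OF H2(1,2) K H2(3)[folded K_def]]
  define J where "J g = integral\<^sup>L H1 g - integral\<^sup>L H2 g" for g :: "'a \<Rightarrow> real"
  have J_cmult: "J (\<lambda>y. c * g y) = c * J g" for c g by (simp add: J_def right_diff_distrib)
  have J_sum: "J (\<lambda>y. \<Sum>l\<in>multi_index k. a l * monomial x l y) = (\<Sum>l\<in>multi_index k. a l * J (monomial x l))" for k a
    using i1[OF continuous_on_monomial] i2[OF continuous_on_monomial]
    by (simp add: J_def Bochner_Integration.integral_sum sum_subtractf right_diff_distrib)
  have J_suminf: "(\<lambda>k. J (f k)) sums J (\<lambda>y. \<Sum>k. f k y)"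
    if "\<And>k. continuous_on UNIV (f k)" "\<And>k y. y \<in> K \<Longrightarrow> \<bar>f k y\<bar> \<le> b k" "summable b"
    for f :: "nat \<Rightarrow> 'a \<Rightarrow> real" and b
    unfolding J_def
    by (intro sums_diff integral_suminf_AE_bounded[OF H1(1,2) H1(3)[folded K_def] K that]
        integral_suminf_AE_bounded[OF H2(1,2) H2(3)[folded K_def] K that])
  define m where "m l = J (monomial x l)" for l
  define w where "w k = c ^ k / fact k" for k :: nat
  have w: "0 < w k" for k using c by (simp add: w_def)
  define B where "B k = w k * (r * r) ^ k" for k
  have "B = (\<lambda>k. inverse (fact k) * (c * (r * r)) ^ k)"
    by (simp add: fun_eq_iff B_def w_def power_mult_distrib divide_inverse)
  then have sB: "summable B" by (simp only: summable_exp)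
  define A where "A k z = (\<Sum>l\<in>multi_index k. monomial x l z * m l)" for k z
  have cA: "continuous_on UNIV (A k)" for k
    unfolding A_def[abs_def] by (intro continuous_intros continuous_on_monomial)
  have A: "A k z = J (\<lambda>y. ((z - x) \<bullet> (y - x)) ^ k)" for k z
    unfolding inner_power_eq_sum_monomial A_def m_def by (rule J_sum[symmetric])
  have pb: "\<bar>((z - x) \<bullet> (y - x)) ^ k\<bar> \<le> (r * r) ^ k" if "z \<in> K" "y \<in> K" for z y k
  proof -
    have "\<bar>(z - x) \<bullet> (y - x)\<bar> \<le> norm (z - x) * norm (y - x)" by (rule Cauchy_Schwarz_ineq2)
    also have "\<dots> \<le> r * r"
      using that r by (intro mult_mono) (auto simp: K_def dist_norm norm_minus_commute)
    finally show ?thesis unfolding power_abs by (rule power_mono) simp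
  qed
  define C where "C = measure H1 UNIV + measure H2 UNIV"
  have Ab: "\<bar>A k z\<bar> \<le> (r * r) ^ k * C" if z: "z \<in> K" for k z
  proof -
    have bnd: "\<bar>integral\<^sup>L H (\<lambda>y. ((z - x) \<bullet> (y - x)) ^ k)\<bar> \<le> (r * r) ^ k * measure H UNIV"
      if H: "finite_measure H" "sets H = sets borel" "AE y in H. y \<in> K" for H
    proof -
      interpret finite_measure H by fact
      have i: "integrable H (\<lambda>y. ((z - x) \<bullet> (y - x)) ^ k)"
        by (rule integrable_continuous_AE_compact[OF H(1,2) K H(3)]) (intro continuous_intros)
      have "norm (integral\<^sup>L H (\<lambda>y. ((z - x) \<bullet> (y - x)) ^ k)) \<le> integral\<^sup>L H (\<lambda>y. norm (((z - x) \<bullet> (y - x)) ^ k))"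
        by (rule integral_norm_bound)
      also have "\<dots> \<le> integral\<^sup>L H (\<lambda>y. (r * r) ^ k)"
        by (rule integral_mono_AE[OF integrable_norm[OF i] integrable_const], rule AE_mp[OF H(3)], rule AE_I2)
           (use pb[OF z] in simp)
      finally show ?thesis using sets_eq_imp_space_eq[OF H(2)] by (simp add: mult.commute)
    qed
    show ?thesis
      using bnd[OF H1(1,2) H1(3)[folded K_def]] bnd[OF H2(1,2) H2(3)[folded K_def]]
      unfolding A J_def C_def by (simp add: distrib_left)
  qed
  have wA: "(\<lambda>k. w k * A k z) sums 0" if z: "z \<in> S" for z
  proof -
    have zK: "z \<in> K" using z S by (auto simp: K_def)
    have "(\<lambda>k. J (\<lambda>y. w k * ((z - x) \<bullet> (y - x)) ^ k)) sums J (\<lambda>y. \<Sum>k. w k * ((z - x) \<bullet> (y - x)) ^ k)"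
    proof (rule J_suminf[OF _ _ sB])
      show "continuous_on UNIV (\<lambda>y. w k * ((z - x) \<bullet> (y - x)) ^ k)" for k
        by (intro continuous_intros)
      show "\<bar>w k * ((z - x) \<bullet> (y - x)) ^ k\<bar> \<le> B k" if "y \<in> K" for k y
        using mult_left_mono[OF pb[OF zK that, of k] less_imp_le[OF w[of k]]] w[of k] by (simp add: B_def abs_mult)
    qed
    also have "(\<lambda>y. \<Sum>k. w k * ((z - x) \<bullet> (y - x)) ^ k) = (\<lambda>y. exp (c * ((z - x) \<bullet> (y - x))))"
      by (simp add: exp_def w_def power_mult_distrib divide_inverse mult_ac)
    also have "J \<dots> = 0" using eq[OF z] by (simp add: J_def)
    finally show ?thesis by (simp add: J_cmult A)
  qed
  \<comment> \<open>The second integration, now over \<open>z\<close>. The bounds hold on the ball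
    \<open>K\<close>, but the series is known to vanish only on \<open>S\<close>; that suffices, as
    both measures are carried by \<open>S\<close>.\<close>
  have "(\<lambda>k. J (\<lambda>z. w k * A k z)) sums J (\<lambda>z. \<Sum>k. w k * A k z)"
  proof (rule J_suminf[OF _ _ summable_mult2[OF sB, of C]])
    show "continuous_on UNIV (\<lambda>z. w k * A k z)" for k by (intro continuous_intros cA)
    show "\<bar>w k * A k z\<bar> \<le> B k * C" if "z \<in> K" for k z
      using mult_left_mono[OF Ab[OF that, of k] less_imp_le[OF w[of k]]] w[of k] by (simp add: B_def abs_mult mult.assoc)
  qed
  moreover have "integral\<^sup>L H (\<lambda>z. \<Sum>k. w k * A k z) = 0" if "AE z in H. z \<in> S" for H
  proof (rule integral_eq_zero_AE)
    show "AE z in H. (\<Sum>k. w k * A k z) = 0"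
      by (rule AE_mp[OF that]) (use wA in \<open>auto intro!: AE_I2 sums_unique[symmetric]\<close>)
  qed
  ultimately have "(\<lambda>k. J (\<lambda>z. w k * A k z)) sums 0" using S1 S2 by (simp add: J_def)
  moreover have "J (\<lambda>z. w k * A k z) = w k * (\<Sum>l\<in>multi_index k. (m l)\<^sup>2)" for k
  proof -
    have "J (A k) = (\<Sum>l\<in>multi_index k. m l * m l)"
      using J_sum[of m k] by (simp add: A_def[abs_def] m_def mult.commute)
    then show ?thesis by (simp add: J_cmult power2_eq_square)
  qed
  ultimately have s: "(\<lambda>k. w k * (\<Sum>l\<in>multi_index k. (m l)\<^sup>2)) sums 0" by simp
  have nn: "0 \<le> w k * (\<Sum>l\<in>multi_index k. (m l)\<^sup>2)" for k
    using w[of k] by (intro mult_nonneg_nonneg sum_nonneg) auto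
  \<comment> \<open>A series of nonnegative terms with sum 0 has only zero terms, and each term is a
    positive weight times a sum of squares.\<close>
  have "w k * (\<Sum>l\<in>multi_index k. (m l)\<^sup>2) = 0" for k
    using suminf_eq_zero_iff[OF sums_summable[OF s] nn] sums_unique[OF s] by simp
  then have "(\<Sum>l\<in>multi_index (length l). (m l)\<^sup>2) = 0" using w[of "length l"] by (metis mult_eq_0_iff less_irrefl)
  moreover have "l \<in> multi_index (length l)" using l by (simp add: multi_index_def)
  ultimately have "(m l)\<^sup>2 = 0"
    using sum_nonneg_0[OF finite_multi_index, of "length l" "\<lambda>l. (m l)\<^sup>2" l] by simp
  then show ?thesis by (simp add: m_def J_def)
qed

section \<open>The average property and the panharmonic measure of a ball\<close>

lemma panharmonic_on_subset: "panharmonic_on \<mu> U u \<Longrightarrow> V \<subseteq> U \<Longrightarrow> panharmonic_on \<mu> V u"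
  unfolding panharmonic_on_def using C2_on_subset by blast

lemma panharmonic_average_property:
  fixes u :: "'a::euclidean_space \<Rightarrow> real"
  assumes \<mu>: "\<mu> > 0" and u: "panharmonic_on \<mu> D u"
  shows "has_average_property \<mu> D u"
  unfolding has_average_property_def
proof (intro allI impI, elim conjE)
  fix x :: 'a and r :: real assume r: "0 < r" "cball x r \<subseteq> D"
  have cu: "continuous_on (cball x r) u"
    using u r C2_on_continuous(1) continuous_on_subset by (metis panharmonic_on_def)
  have cs: "continuous_on (sphere x r) u" by (rule continuous_on_subset[OF cu]) auto
  have "panharmonic_on \<mu> (ball x r) u"
    by (rule panharmonic_on_subset[OF u]) (use r ball_subset_cball in blast)
  then have "sphere_mean u x r = u x * radial (real DIM('a) / 2) \<mu> (r\<^sup>2)"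
    by (rule sphere_mean_panharmonic_cball[OF _ r(1) cu])
  moreover have "radial (real DIM('a) / 2) \<mu> (r\<^sup>2) > 0" by (rule radial_pos) auto
  moreover have "(LINT y:sphere x r|sphere_uniform x r. u y) = sphere_mean u x r"
    using borel_measurable_continuous_on_indicator[OF _ cs]
    by (intro set_integral_sphere_uniform r) simp
  ultimately have "u x = psi DIM('a) (\<mu> * r) * (LINT y:sphere x r|sphere_uniform x r. u y)"
    using \<mu> r by (simp add: psi_eq)
  moreover have "set_integrable (sphere_uniform x r) (sphere x r) u"
    by (rule set_integrable_continuous_compact[OF finite_measure_sphere_uniform[OF r(1)] _ _ cs]) simp_all
  ultimately show "set_integrable (sphere_uniform x r) (sphere x r) u \<and>
    u x = psi DIM('a) (\<mu> * r) * (LINT y:sphere x r|sphere_uniform x r. u y)" by blast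
qed

lemma psi_pos: "0 < n \<Longrightarrow> \<mu> > 0 \<Longrightarrow> r > 0 \<Longrightarrow> psi n (\<mu> * r) > 0"
  by (simp add: psi_eq radial_pos)

text \<open>The factor \<open>psi\<close> is the reciprocal of the factor \<open>radial\<close> in
  the mean value identity on the closed ball, so scaling by it reproduces
  \<open>u x\<close>.\<close>

lemma is_panharmonic_measure_sphere_uniform:
  fixes x :: "'a::euclidean_space"
  assumes \<mu>: "\<mu> > 0" and r: "0 < r"
  shows "is_panharmonic_measure \<mu> (ball x r) x
      (scale_measure (ennreal (psi DIM('a) (\<mu> * r))) (sphere_uniform x r))"
    (is "is_panharmonic_measure _ _ _ ?H")
  unfolding is_panharmonic_measure_def
proof (intro conjI allI impI; (elim conjE)?)
  have p: "psi DIM('a) (\<mu> * r) > 0" by (rule psi_pos) (use \<mu> r in auto)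
  show "sets ?H = sets borel" by simp
  show "emeasure ?H (- frontier (ball x r)) = 0"
    using r by (simp add: emeasure_sphere_uniform_Compl)
  fix u :: "'a \<Rightarrow> real"
  assume u: "panharmonic_on \<mu> (ball x r) u" and c: "continuous_on (closure (ball x r)) u"
  have cu: "continuous_on (cball x r) u" using c r by simp
  have cs: "continuous_on (sphere x r) u" by (rule continuous_on_subset[OF cu]) auto
  have m: "(\<lambda>y. indicator (sphere x r) y *\<^sub>R u y) \<in> borel_measurable borel"
    by (rule borel_measurable_continuous_on_indicator[OF _ cs]) simp
  then have m': "(\<lambda>y. indicator (sphere x r) y *\<^sub>R u y) \<in> borel_measurable (sphere_uniform x r)"
    by (simp cong: measurable_cong_sets)
  have "set_integrable (sphere_uniform x r) (sphere x r) u"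
    by (rule set_integrable_continuous_compact[OF finite_measure_sphere_uniform[OF r] _ _ cs]) simp_all
  then show "set_integrable ?H (frontier (ball x r)) u"
    using r m' p unfolding scale_measure_density set_integrable_def
    by (subst integrable_density) auto
  have "(LINT y:sphere x r|?H. u y) = psi DIM('a) (\<mu> * r) * (LINT y:sphere x r|sphere_uniform x r. u y)"
    using m' p unfolding scale_measure_density set_lebesgue_integral_def
    by (subst integral_density) auto
  also have "(LINT y:sphere x r|sphere_uniform x r. u y) = sphere_mean u x r"
    using m by (intro set_integral_sphere_uniform r) simp
  also have "sphere_mean u x r = u x * radial (real DIM('a) / 2) \<mu> (r\<^sup>2)"
    by (rule sphere_mean_panharmonic_cball[OF u r cu])
  also have "psi DIM('a) (\<mu> * r) * (u x * radial (real DIM('a) / 2) \<mu> (r\<^sup>2)) = u x"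
    using \<mu> r radial_pos[of "real DIM('a) / 2" "r\<^sup>2" \<mu>] by (simp add: psi_eq)
  finally show "u x = (LINT y:frontier (ball x r)|?H. u y)" using r by simp
qed

text \<open>Finiteness is not postulated of a panharmonic measure. It follows from integrability of
  a single exponential, which on the sphere is at least
  \<open>exp (- \<bar>\<mu>\<bar> * r)\<close>. The value 1 in the last claim is that of the
  exponential at the pole.\<close>

lemma is_panharmonic_measure_ball_sphere:
  fixes x :: "'a::euclidean_space"
  assumes r: "0 < r" and H: "is_panharmonic_measure \<mu> (ball x r) x H"
  shows "AE y in H. y \<in> sphere x r"
    and "finite_measure H"
    and "norm a = \<bar>\<mu>\<bar> \<Longrightarrow> (\<integral>y. exp (a \<bullet> (y - x)) \<partial>H) = 1"
proof -
  have sets: "sets H = sets borel" and null: "emeasure H (- sphere x r) = 0"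
    and rep: "\<And>u. panharmonic_on \<mu> (ball x r) u \<Longrightarrow> continuous_on (cball x r) u \<Longrightarrow>
      bounded (u ` cball x r) \<Longrightarrow> set_integrable H (sphere x r) u \<and> u x = (LINT y:sphere x r|H. u y)"
    using H r unfolding is_panharmonic_measure_def by auto
  show AE: "AE y in H. y \<in> sphere x r"
    using null sets by (intro AE_I[of _ _ "- sphere x r"]) auto
  have exp: "set_integrable H (sphere x r) (\<lambda>y. exp (a \<bullet> (y - x)))"
    "(LINT y:sphere x r|H. exp (a \<bullet> (y - x))) = 1" if "norm a = \<bar>\<mu>\<bar>" for a
  proof -
    have c: "continuous_on (cball x r) (\<lambda>y. exp (a \<bullet> (y - x)))" by (intro continuous_intros)
    have "panharmonic_on \<mu> (ball x r) (\<lambda>y. exp (a \<bullet> (y - x)))"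
      by (rule panharmonic_on_subset[OF panharmonic_exp[OF that]]) simp
    from rep[OF this c] show "set_integrable H (sphere x r) (\<lambda>y. exp (a \<bullet> (y - x)))"
      "(LINT y:sphere x r|H. exp (a \<bullet> (y - x))) = 1"
      using compact_imp_bounded[OF compact_continuous_image[OF c compact_cball]] by auto
  qed
  show "(\<integral>y. exp (a \<bullet> (y - x)) \<partial>H) = 1" if a: "norm a = \<bar>\<mu>\<bar>" for a
  proof -
    have cm: "(\<lambda>y. exp (a \<bullet> (y - x))) \<in> borel_measurable H"
      using sets by (simp cong: measurable_cong_sets)
    have "(\<integral>y. exp (a \<bullet> (y - x)) \<partial>H) = (LINT y:sphere x r|H. exp (a \<bullet> (y - x)))"
      unfolding set_lebesgue_integral_def
    proof (rule integral_cong_AE)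
      show "AE y in H. exp (a \<bullet> (y - x)) = indicator (sphere x r) y *\<^sub>R exp (a \<bullet> (y - x))"
        by (rule AE_mp[OF AE]) (auto intro!: AE_I2)
    qed (use cm borel_measurable_integrable[OF exp(1)[OF a, unfolded set_integrable_def]] in auto)
    then show ?thesis using exp(2)[OF a] by simp
  qed
  obtain e :: 'a where e: "e \<in> Basis" using nonempty_Basis by blast
  have i: "integrable H (\<lambda>y. exp (\<bar>\<mu>\<bar> * r) * (indicator (sphere x r) y *\<^sub>R exp ((\<mu> *\<^sub>R e) \<bullet> (y - x))))"
    using exp(1)[of "\<mu> *\<^sub>R e"] e by (simp add: set_integrable_def)
  have "integrable H (indicator (sphere x r) :: 'a \<Rightarrow> real)"
  proof (rule Bochner_Integration.integrable_bound[OF i])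
    show "(indicator (sphere x r) :: 'a \<Rightarrow> real) \<in> borel_measurable H"
      using sets by (intro borel_measurable_indicator) auto
    have "norm (indicator (sphere x r) y :: real)
      \<le> norm (exp (\<bar>\<mu>\<bar> * r) * (indicator (sphere x r) y *\<^sub>R exp ((\<mu> *\<^sub>R e) \<bullet> (y - x))))" for y
    proof (cases "y \<in> sphere x r")
      case True
      have "\<bar>(\<mu> *\<^sub>R e) \<bullet> (y - x)\<bar> \<le> norm (\<mu> *\<^sub>R e) * norm (y - x)" by (rule Cauchy_Schwarz_ineq2)
      also have "\<dots> = \<bar>\<mu>\<bar> * r" using e True by (simp add: dist_norm norm_minus_commute)
      finally have "1 \<le> exp (\<bar>\<mu>\<bar> * r + (\<mu> *\<^sub>R e) \<bullet> (y - x))" by simp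
      then show ?thesis using True by (simp add: exp_add abs_mult)
    qed simp
    then show "AE y in H. norm (indicator (sphere x r) y :: real)
      \<le> norm (exp (\<bar>\<mu>\<bar> * r) * (indicator (sphere x r) y *\<^sub>R exp ((\<mu> *\<^sub>R e) \<bullet> (y - x))))" by simp
  qed
  then have fin: "emeasure H (sphere x r) < \<infinity>"
    using sets_eq_imp_space_eq[OF sets] by (simp add: integrable_indicator_iff)
  have "emeasure H (sphere x r \<union> - sphere x r) = emeasure H (sphere x r) + emeasure H (- sphere x r)"
    by (rule plus_emeasure[symmetric]) (use sets in auto)
  then show "finite_measure H"
    using fin null sets_eq_imp_space_eq[OF sets] by (intro finite_measureI) (simp add: Compl_partition)
qed

text \<open>Both measures assign the integral 1 to every exponential of the kernel, so they agree
  successively on moments, on continuous functions and on Borel sets.\<close>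

lemma is_panharmonic_measure_unique:
  fixes x :: "'a::euclidean_space"
  assumes \<mu>: "\<mu> > 0" and r: "0 < r"
    and H1: "is_panharmonic_measure \<mu> (ball x r) x H1" and H2: "is_panharmonic_measure \<mu> (ball x r) x H2"
  shows "H1 = H2"
proof -
  have sets: "sets H1 = sets borel" "sets H2 = sets borel"
    using H1 H2 by (auto simp: is_panharmonic_measure_def)
  note p1 = is_panharmonic_measure_ball_sphere[OF r H1]
  note p2 = is_panharmonic_measure_ball_sphere[OF r H2]
  have sub: "sphere x r \<subseteq> cball x r" by (rule sphere_cball)
  have c1: "AE y in H1. y \<in> cball x r" by (rule AE_mp[OF p1(1)]) (use sub in \<open>auto intro!: AE_I2\<close>)
  have c2: "AE y in H2. y \<in> cball x r" by (rule AE_mp[OF p2(1)]) (use sub in \<open>auto intro!: AE_I2\<close>)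
  have e: "(\<integral>y. exp (\<mu> / r * ((z - x) \<bullet> (y - x))) \<partial>H1) = (\<integral>y. exp (\<mu> / r * ((z - x) \<bullet> (y - x))) \<partial>H2)"
    if "z \<in> sphere x r" for z
  proof -
    have "norm ((\<mu> / r) *\<^sub>R (z - x)) = \<bar>\<mu>\<bar>"
      using that r \<mu> by (simp add: dist_norm norm_minus_commute)
    from p1(3)[OF this] p2(3)[OF this] show ?thesis by simp
  qed
  have mom: "integral\<^sup>L H1 (monomial x l) = integral\<^sup>L H2 (monomial x l)" if "set l \<subseteq> Basis" for l
    by (rule moments_eq_of_exp[OF p1(2) sets(1) c1 p2(2) sets(2) c2 p1(1) p2(1) _ _ e sub that])
       (use \<mu> r in auto)
  show ?thesis
    by (rule finite_measure_eqI_continuous[OF p1(2) sets(1) p2(2) sets(2)])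
       (rule integral_eq_of_moments[OF p1(2) sets(1) c1 p2(2) sets(2) c2 compact_cball mom])
qed

theorem theorem4p2:
  fixes P :: "real ^ 'n \<Rightarrow> 'w measure"
    and W :: "real \<Rightarrow> 'w \<Rightarrow> real ^ 'n"
    and D :: "(real ^ 'n) set"
    and \<mu> :: real
  assumes "CARD('n) \<ge> 2"
    and "\<And>x. brownian_motion_from (P x) W x"
    and "regular_domain P W D"
    and "\<mu> > 0"
  shows "(\<forall>u. panharmonic_on \<mu> D u \<longleftrightarrow>
              locally_integrable_on D u \<and> has_average_property \<mu> D u) \<and>
         (\<forall>x r. 0 < r \<and> ball x r \<subseteq> D \<longrightarrow>
            (\<forall>H. is_panharmonic_measure \<mu> (ball x r) x H \<longleftrightarrow>
                 H = scale_measure (ennreal (psi CARD('n) (\<mu> * r))) (sphere_uniform x r)))"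
proof (intro conjI allI impI; (elim conjE)?)
  have D: "open D" using assms(3) by (simp add: regular_domain_def)
  show "panharmonic_on \<mu> D u \<longleftrightarrow> locally_integrable_on D u \<and> has_average_property \<mu> D u" for u
  proof
    assume u: "panharmonic_on \<mu> D u"
    then have "continuous_on D u" by (simp add: panharmonic_on_def C2_on_continuous)
    then have "locally_integrable_on D u"
      unfolding locally_integrable_on_def by (blast intro: set_integrable_compact continuous_on_subset)
    then show "locally_integrable_on D u \<and> has_average_property \<mu> D u"
      using panharmonic_average_property[OF assms(4) u] by blast
  qed (use average_property_panharmonic[OF D assms(4)] in blast)
  fix x :: "real ^ 'n" and r :: real and H
  assume r: "0 < r"
  show "is_panharmonic_measure \<mu> (ball x r) x H \<longleftrightarrow>
      H = scale_measure (ennreal (psi CARD('n) (\<mu> * r))) (sphere_uniform x r)"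
    using is_panharmonic_measure_sphere_uniform[OF assms(4) r, of x]
      is_panharmonic_measure_unique[OF assms(4) r, of x] by auto
qed

end
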